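(* Let $X$ be a simply-connected space of constant curvature (spherical, Euclidean or hyperbolic), let $W$ be a cocompact discrete reflection group acting on $X$, with compact fundamental domain $D$ and its interior $D^\circ$. Let $g\in\mathrm{Isom}(X)$. Then there exists a unique element $w\in W$ such that the element $w^{-1}g$ has a fixed point in $D^\circ$.
   Context: $X$ is one of: the $n$-dimensional sphere $\mathbb{S}^n$ embedded in $(n+1)$-dimensional Euclidean space, the $n$-dimensional affine Euclidean space, or the hyperbolic space $\mathbb{H}^n$ (a connected component of the hyperboloid $[x,x]=-1$ in $(n+1)$-dimensional Minkowski space with inner product $[x,y]=-x_0y_0+x_1y_1+\ldots+x_ny_n$). $\mathrm{Isom}(X)$ is the group of isometries of $X$. A discrete reflection group $W$ is a discrete group of isometries of $X$ generated by reflections in hyperplanes. The fundamental domain (chamber) $D$ for the action of $W$ on $X$ is the closure of a connected component of the complement in $X$ of the union of all mirrors of reflections belonging to $W$; $W$ being cocompact means that $D$ is compact. $D^\circ$ is the interior of $D$.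
   Formalization: In the spherical case W is assumed to be nontrivial: for the trivial group D is the whole sphere, which is compact, and the antipodal map g has no fixed point, so the claim would fail. *)

theory Defs
  imports "HOL-Analysis.Analysis" "HOL-Algebra.Bij" "HOL-Algebra.Generated_Groups"
begin

text \<open>
  All three spaces of constant curvature are modelled inside \<^typ>\<open>real \<times> 'a\<close>, where
  \<^typ>\<open>'a::euclidean_space\<close> is a Euclidean space of arbitrary dimension \<open>n \<ge> 1\<close> and the first
  component is the coordinate \<open>x\<^sub>0\<close>.  The \<open>n\<close>-dimensional affine Euclidean space is the affine
  hyperplane \<open>x\<^sub>0 = 1\<close>.
\<close>

datatype geometry = Spherical | Euclidean | Hyperbolic

definition minkowski :: "real \<times> 'a::euclidean_space \<Rightarrow> real \<times> 'a \<Rightarrow> real" where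
  "minkowski x y = - (fst x * fst y) + snd x \<bullet> snd y"

fun cc_space :: "geometry \<Rightarrow> (real \<times> 'a::euclidean_space) set" where
  "cc_space Spherical = sphere 0 1"
| "cc_space Euclidean = {x. fst x = 1}"
| "cc_space Hyperbolic = {x. minkowski x x = -1 \<and> fst x > 0}"

text \<open>
  The intrinsic (geodesic) distances.  Each induces on the space the subspace topology of
  \<^typ>\<open>real \<times> 'a\<close>, which is why topological notions below refer to \<^const>\<open>top_of_set\<close>.
\<close>

fun cc_dist :: "geometry \<Rightarrow> real \<times> 'a::euclidean_space \<Rightarrow> real \<times> 'a \<Rightarrow> real" where
  "cc_dist Spherical x y = arccos (x \<bullet> y)"
| "cc_dist Euclidean x y = dist x y"
| "cc_dist Hyperbolic x y = arcosh (- minkowski x y)"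

text \<open>
  Isometries are extensional functions (\<^const>\<open>undefined\<close> outside the space), so that equality of
  isometries is equality of functions.
\<close>

definition isom_group ::
    "geometry \<Rightarrow> (real \<times> 'a::euclidean_space \<Rightarrow> real \<times> 'a) monoid" where
  "isom_group K = (BijGroup (cc_space K))
     \<lparr>carrier := {g \<in> Bij (cc_space K). \<forall>x\<in>cc_space K. \<forall>y\<in>cc_space K.
                   cc_dist K (g x) (g y) = cc_dist K x y}\<rparr>"

lemma group_isom_group:
  "group (isom_group K :: (real \<times> 'a::euclidean_space \<Rightarrow> real \<times> 'a) monoid)"
proof -
  let ?X = "cc_space K :: (real \<times> 'a) set"
  let ?I = "{g \<in> Bij ?X. \<forall>x\<in>?X. \<forall>y\<in>?X. cc_dist K (g x) (g y) = cc_dist K x y}"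
  interpret B: group "BijGroup ?X" by (rule group_BijGroup)
  have mem: "g x \<in> ?X" if "g \<in> Bij ?X" "x \<in> ?X" for g x
    using that by (auto dest: Bij_imp_funcset)
  have "subgroup ?I (BijGroup ?X)"
  proof (rule B.subgroupI)
    show "?I \<subseteq> carrier (BijGroup ?X)" by (auto simp: BijGroup_def)
    have "(\<lambda>x\<in>?X. x) \<in> ?I" by (simp add: id_Bij)
    then show "?I \<noteq> {}" by blast
  next
    fix g assume g: "g \<in> ?I"
    then have inv: "inv\<^bsub>BijGroup ?X\<^esub> g = (\<lambda>x\<in>?X. inv_into ?X g x)"
      by (simp add: inv_BijGroup)
    have inv_mem: "inv_into ?X g z \<in> ?X" if "z \<in> ?X" for z
      using g that by (intro Bij_inv_into_mem) simp_all
    have g_inv: "g (inv_into ?X g z) = z" if "z \<in> ?X" for z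
      using g that by (intro f_inv_into_f) (simp add: Bij_def bij_betw_def)
    have dist_g: "cc_dist K (g u) (g v) = cc_dist K u v" if "u \<in> ?X" "v \<in> ?X" for u v
      using g that by simp
    have "cc_dist K (inv_into ?X g x) (inv_into ?X g y) = cc_dist K x y"
      if "x \<in> ?X" "y \<in> ?X" for x y
      using dist_g[OF inv_mem[OF that(1)] inv_mem[OF that(2)]] that by (simp only: g_inv)
    then show "inv\<^bsub>BijGroup ?X\<^esub> g \<in> ?I"
      using g by (simp add: inv restrict_inv_into_Bij)
  next
    fix g h assume "g \<in> ?I" "h \<in> ?I"
    then show "g \<otimes>\<^bsub>BijGroup ?X\<^esub> h \<in> ?I"
      by (simp add: BijGroup_def compose_Bij compose_eq mem)
  qed
  then show ?thesis
    unfolding isom_group_def by (rule B.subgroup_imp_group)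
qed

text \<open>
  Hyperplanes are the nonempty sections of the space by linear hyperplanes of \<^typ>\<open>real \<times> 'a\<close>,
  whose dimension is \<open>n = DIM('a)\<close>: great subspheres, affine hyperplanes, and hyperbolic
  hyperplanes, respectively.
\<close>

definition hyperplanes :: "geometry \<Rightarrow> (real \<times> 'a::euclidean_space) set set" where
  "hyperplanes K = {V \<inter> cc_space K | V. subspace V \<and> dim V = DIM('a) \<and> V \<inter> cc_space K \<noteq> {}}"

definition is_reflection ::
    "geometry \<Rightarrow> (real \<times> 'a::euclidean_space) set \<Rightarrow> (real \<times> 'a \<Rightarrow> real \<times> 'a) \<Rightarrow> bool" where
  "is_reflection K H r \<longleftrightarrow>
     H \<in> hyperplanes K \<and> r \<in> carrier (isom_group K) \<and> r \<noteq> \<one>\<^bsub>isom_group K\<^esub> \<and> (\<forall>x\<in>H. r x = x)"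

text \<open>
  Discreteness refers to the topology of pointwise convergence, which on the isometry group
  coincides with the compact-open topology.
\<close>

definition discrete_reflection_group ::
    "geometry \<Rightarrow> (real \<times> 'a::euclidean_space \<Rightarrow> real \<times> 'a) set \<Rightarrow> bool" where
  "discrete_reflection_group K W \<longleftrightarrow>
     (\<exists>R \<subseteq> {r. \<exists>H. is_reflection K H r}. W = generate (isom_group K) R) \<and> discrete W"

definition mirrors ::
    "geometry \<Rightarrow> (real \<times> 'a::euclidean_space \<Rightarrow> real \<times> 'a) set \<Rightarrow> (real \<times> 'a) set set" where
  "mirrors K W = {H. \<exists>r\<in>W. is_reflection K H r}"

definition chambers ::
    "geometry \<Rightarrow> (real \<times> 'a::euclidean_space \<Rightarrow> real \<times> 'a) set \<Rightarrow> (real \<times> 'a) set set" where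
  "chambers K W =
     {top_of_set (cc_space K) closure_of C | C. C \<in> components (cc_space K - \<Union>(mirrors K W))}"

end

theory Submission
  imports Defs
begin

text \<open>
  Uniqueness: if \<open>x\<close> and \<open>y\<close> are interior points of a chamber and \<open>u \<noteq> 1\<close> is an element of the reflection
  group, then \<open>y\<close> is strictly closer to \<open>x\<close> than \<open>u y\<close> is.  Hence \<open>g x = w x\<close> and \<open>g y = w' y\<close>, which give
  \<open>d (x, y) = d (g x, g y) = d (x, w\<^sup>-\<^sup>1 w' y)\<close>, are only possible for \<open>w = w'\<close>.

  Existence: folding the space onto the chamber \<open>D\<close> along the mirrors is a continuous map \<open>\<pi>\<close>, and
  Brouwer's theorem applied to \<open>\<pi> \<circ> g\<close> yields a point \<open>x\<close> of \<open>D\<close> fixed by some \<open>w\<^sup>-\<^sup>1 g\<close>.  If \<open>x\<close> lies on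
  mirrors, the reflections in them form a finite linear group, for which the same statement, applied to
  directions at \<open>x\<close> and proved by induction on the dimension, provides a fixed direction pointing into
  the interior of \<open>D\<close> after a change of \<open>w\<close> by an element fixing \<open>x\<close>.

  All three geometries are treated in linear coordinates: a mirror is the zero set of a functional
  \<open>n\<close>, normalised by \<open>n \<bullet> J n = 1\<close>, and its reflection is \<open>z \<mapsto> z - 2 (n \<bullet> z) J n\<close>, where \<open>J\<close> is diagonal
  with first entry \<open>1\<close>, \<open>0\<close> or \<open>-1\<close>.
\<close>

section \<open>Words in reflections\<close>

text \<open>Both halves of the theorem rest on one inequality. Strict for interior points, it gives
  uniqueness; passed to the limit on the closed chamber, it says that folding does not increase
  distances, which is where the continuity of \<pi> comes from. The inequality itself needs that
  only trivial words map the open chamber into itself, hence the study of words, walls and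
  galleries.

  In the Euclidean case \<open>J\<close> is degenerate: it forgets the offset of an affine
  hyperplane. A mirror therefore carries two separate data, the functional \<open>n\<close> and the
  direction \<open>J n\<close>.

  The sphere is replaced by its ambient vector space, where orbits are finite and the statement
  about linear groups already gives the result. Euclidean and hyperbolic groups may have infinitely
  many mirrors, so local finiteness has to be extracted from discreteness before any argument that
  handles finitely many of them.\<close>

definition reflect :: "('v::euclidean_space \<Rightarrow> 'v) \<Rightarrow> 'v \<Rightarrow> 'v \<Rightarrow> 'v" where
  "reflect J n z = z - (2 * (n \<bullet> z)) *\<^sub>R J n"

text \<open>Words stand in for group elements because they act linearly on the whole ambient space,
  whereas elements of the group are extensional functions on the curved space. The head of the list
  acts last.\<close>

primrec act :: "('v::euclidean_space \<Rightarrow> 'v) \<Rightarrow> 'v list \<Rightarrow> 'v \<Rightarrow> 'v" where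
  "act J [] z = z"
| "act J (n # ns) z = reflect J n (act J ns z)"

lemma act_append [simp]: "act J (xs @ ys) z = act J xs (act J ys z)"
  by (induction xs) auto

lemma linear_reflect: "linear (reflect J n)"
  by (rule linearI) (auto simp: reflect_def algebra_simps inner_add_right scaleR_add_left)

lemma linear_act: "linear (act J ns)"
proof (induction ns)
  case Nil
  show ?case by (rule linearI) auto
next
  case (Cons n ns)
  have "act J (n # ns) = reflect J n \<circ> act J ns" by auto
  then show ?case using Cons linear_reflect linear_compose by metis
qed

lemma reflect_uminus: "linear J \<Longrightarrow> reflect J (- n) = reflect J n"
  by (auto simp: reflect_def linear_neg)

lemma reflect_fix [simp]: "n \<bullet> z = 0 \<Longrightarrow> reflect J n z = z"
  by (simp add: reflect_def)

lemma act_fix: "(\<And>n. n \<in> set ns \<Longrightarrow> n \<bullet> z = 0) \<Longrightarrow> act J ns z = z"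
  by (induction ns) auto

lemma inner_reflect_self: "n \<bullet> J n = 1 \<Longrightarrow> n \<bullet> reflect J n z = - (n \<bullet> z)"
  by (simp add: reflect_def inner_diff_right)

lemma reflect_reflect: "n \<bullet> J n = 1 \<Longrightarrow> reflect J n (reflect J n z) = z"
  by (simp add: reflect_def inner_diff_right algebra_simps flip: scaleR_add_left)

lemma act_rev:
  assumes "\<And>n. n \<in> set ns \<Longrightarrow> n \<bullet> J n = 1"
  shows "act J (rev ns) (act J ns z) = z"
  using assms by (induction ns arbitrary: z) (auto simp: reflect_reflect)

text \<open>\<open>k\<close> is the functional \<open>n\<close> precomposed with the reflection in
  \<open>m\<close>, that is, a normal of the conjugate mirror. The symmetry \<open>sym\<close> makes
  \<open>J k\<close> the reflected vector \<open>J n\<close>, so that conjugating a reflection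
  amounts to transporting its functional.\<close>

lemma reflect_conj:
  assumes J: "linear J" and m: "m \<bullet> J m = 1" and sym: "m \<bullet> J n = n \<bullet> J m"
    and k: "k = n - (2 * (n \<bullet> J m)) *\<^sub>R m"
  shows "k \<bullet> z = n \<bullet> reflect J m z" "reflect J m (reflect J k z) = reflect J n (reflect J m z)"
proof -
  show 1: "k \<bullet> z = n \<bullet> reflect J m z" for z
    by (simp add: k reflect_def inner_diff_left inner_diff_right)
  have Jk: "J k = reflect J m (J n)"
    by (simp add: k reflect_def linear_diff[OF J] linear_scale[OF J] sym)
  have "reflect J m (reflect J k z) = reflect J m z - (2 * (k \<bullet> z)) *\<^sub>R reflect J m (J k)"
    unfolding reflect_def[of J k] by (simp add: linear_diff[OF linear_reflect] linear_scale[OF linear_reflect])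
  also have "\<dots> = reflect J n (reflect J m z)"
    by (simp add: Jk reflect_reflect[where J=J, OF m] 1 reflect_def[of J n])
  finally show "reflect J m (reflect J k z) = reflect J n (reflect J m z)" .
qed

text \<open>Meant for orbits, which may be infinite but meet bounded regions in finite sets.\<close>

lemma finite_arg_min:
  fixes f :: "'b \<Rightarrow> real"
  assumes "x0 \<in> A" and "finite {x \<in> A. f x \<le> f x0}"
  obtains x where "x \<in> A" and "\<And>y. y \<in> A \<Longrightarrow> f x \<le> f y"
proof -
  let ?B = "{x \<in> A. f x \<le> f x0}"
  have "?B \<noteq> {}" using assms(1) by auto
  then obtain x where x: "x \<in> ?B" "\<And>y. y \<in> ?B \<Longrightarrow> f x \<le> f y"
    using assms(2) ex_is_arg_min_if_finite[of ?B f] by (metis is_arg_min_linorder)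
  show thesis
  proof (rule that)
    show "x \<in> A" using x by simp
    show "f x \<le> f y" if "y \<in> A" for y
      using x that by (cases "f y \<le> f x0") fastforce+
  qed
qed

text \<open>Finitely many hyperplanes form a null set, a nonempty open set is not null. This is the
  source of generic points.\<close>

lemma open_avoid_hyperplanes:
  fixes U :: "'v::euclidean_space set"
  assumes "open U" "U \<noteq> {}" "finite L" "0 \<notin> L"
  obtains z where "z \<in> U" "\<And>l. l \<in> L \<Longrightarrow> l \<bullet> z \<noteq> 0"
proof -
  have "negligible (\<Union>l\<in>L. {z. l \<bullet> z = 0})"
    using assms by (intro negligible_Union) (auto intro!: negligible_hyperplane)
  moreover have "\<not> negligible U" using assms(1,2) by (rule open_not_negligible)
  ultimately have "\<not> U \<subseteq> (\<Union>l\<in>L. {z. l \<bullet> z = 0})" using negligible_subset by blast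
  then show thesis using that by blast
qed

text \<open>A step from \<open>x\<close> in direction \<open>v\<close> leaves the space; dividing by
  the gauge \<open>nrm\<close> returns to it. Letting the step shrink yields nearby points of the
  space in a prescribed direction.\<close>

lemma normalised_tendsto:
  fixes x :: "'v::euclidean_space" and nrm :: "'v \<Rightarrow> real"
  assumes "open E" "x \<in> E" "continuous_on E nrm" "nrm x = 1"
  shows "(\<lambda>k. (1 / nrm (x + (1 / real (Suc k)) *\<^sub>R v)) *\<^sub>R (x + (1 / real (Suc k)) *\<^sub>R v))
           \<longlonglongrightarrow> x"
proof -
  have "(\<lambda>k. 1 / real (Suc k)) \<longlonglongrightarrow> 0"
    using LIMSEQ_inverse_real_of_nat by (simp add: inverse_eq_divide)
  then have l: "(\<lambda>k. x + (1 / real (Suc k)) *\<^sub>R v) \<longlonglongrightarrow> x + 0 *\<^sub>R v"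
    by (intro tendsto_intros)
  then have l: "(\<lambda>k. x + (1 / real (Suc k)) *\<^sub>R v) \<longlonglongrightarrow> x" by simp
  have "isCont nrm x"
    using assms continuous_on_eq_continuous_at by blast
  then have "(\<lambda>k. nrm (x + (1 / real (Suc k)) *\<^sub>R v)) \<longlonglongrightarrow> nrm x"
    using l isCont_tendsto_compose by blast
  then have "(\<lambda>k. (1 / nrm (x + (1 / real (Suc k)) *\<^sub>R v)) *\<^sub>R (x + (1 / real (Suc k)) *\<^sub>R v))
      \<longlonglongrightarrow> (1 / nrm x) *\<^sub>R x"
    using l assms(4) by (intro tendsto_intros) auto
  then show ?thesis using assms(4) by simp
qed

section \<open>Mirror systems and folding\<close>

text \<open>A common setting for the curved spaces and for linear groups. \<open>N\<close> holds one
  functional per mirror, with the sign that makes it positive at the base point \<open>p\<close>; by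
  \<open>N_closed\<close>, reflections permute the mirrors, up to this sign. \<open>q\<close> plays
  the role of a squared distance; the comparisons are driven by the identity
  \<open>q_reflect\<close>, not by a triangle inequality. The open cone \<open>E\<close> around
  \<open>X\<close> makes room for adding points of \<open>X\<close>, and \<open>nrm\<close> projects
  the sums back radially.\<close>

locale mirror_system =
  fixes J :: "'v::euclidean_space \<Rightarrow> 'v" and X E :: "'v set" and nrm :: "'v \<Rightarrow> real"
    and q :: "'v \<Rightarrow> 'v \<Rightarrow> real" and N :: "'v set" and p :: 'v
  assumes linear_J: "linear J"
    and N_unit: "n \<in> N \<Longrightarrow> n \<bullet> J n = 1"
    and N_sym: "m \<in> N \<Longrightarrow> n \<in> N \<Longrightarrow> m \<bullet> J n = n \<bullet> J m"
    and N_closed: "m \<in> N \<Longrightarrow> n \<in> N \<Longrightarrow>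
          n - (2 * (n \<bullet> J m)) *\<^sub>R m \<in> N \<or> - (n - (2 * (n \<bullet> J m)) *\<^sub>R m) \<in> N"
    and p_X: "p \<in> X"
    and N_p: "n \<in> N \<Longrightarrow> n \<bullet> p > 0"
    and X_closed: "closed X"
    and reflect_X: "n \<in> N \<Longrightarrow> x \<in> X \<Longrightarrow> reflect J n x \<in> X"
    and q_sym: "x \<in> X \<Longrightarrow> y \<in> X \<Longrightarrow> q x y = q y x"
    and q_nonneg: "x \<in> X \<Longrightarrow> y \<in> X \<Longrightarrow> q x y \<ge> 0"
    and q_eq0: "x \<in> X \<Longrightarrow> y \<in> X \<Longrightarrow> q x y = 0 \<longleftrightarrow> x = y"
    and q_reflect: "n \<in> N \<Longrightarrow> x \<in> X \<Longrightarrow> y \<in> X \<Longrightarrow> q x (reflect J n y) = q x y + 4 * (n \<bullet> x) * (n \<bullet> y)"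
    and q_cont: "continuous_on (X \<times> X) (\<lambda>z. q (fst z) (snd z))"
    and q_bdd: "\<exists>b'. \<forall>y\<in>X. \<forall>z\<in>X. norm y \<le> b \<longrightarrow> q y z \<le> c \<longrightarrow> norm z \<le> b'"
    and orbit_finite: "y \<in> X \<Longrightarrow> finite {act J ns y |ns. set ns \<subseteq> N \<and> norm (act J ns y) \<le> b}"
    and E_open: "open E" and X_E: "X \<subseteq> E"
    and E_cone: "x \<in> E \<Longrightarrow> y \<in> E \<Longrightarrow> b > 0 \<Longrightarrow> x + b *\<^sub>R y \<in> E"
    and nrm_pos: "z \<in> E \<Longrightarrow> nrm z > 0"
    and nrm_X: "z \<in> E \<Longrightarrow> (1 / nrm z) *\<^sub>R z \<in> X"
    and nrm_1: "x \<in> X \<Longrightarrow> nrm x = 1"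
    and nrm_cont: "continuous_on E nrm"
begin

lemma reflect_reflect' [simp]: "n \<in> N \<Longrightarrow> reflect J n (reflect J n z) = z"
  by (simp add: reflect_reflect N_unit)

lemma inner_reflect [simp]: "n \<in> N \<Longrightarrow> n \<bullet> reflect J n z = - (n \<bullet> z)"
  by (simp add: inner_reflect_self N_unit)

lemma act_X: "set ns \<subseteq> N \<Longrightarrow> x \<in> X \<Longrightarrow> act J ns x \<in> X"
  by (induction ns) (auto intro: reflect_X)

lemma act_rev': "set ns \<subseteq> N \<Longrightarrow> act J (rev ns) (act J ns z) = z"
  using N_unit by (intro act_rev) auto

lemma q_reflect_reflect:
  assumes "n \<in> N" "x \<in> X" "y \<in> X"
  shows "q (reflect J n x) (reflect J n y) = q x y"
proof -
  have "q (reflect J n x) (reflect J n y) = q y (reflect J n x) + 4 * (n \<bullet> reflect J n x) * (n \<bullet> y)"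
    using assms q_sym[of "reflect J n x" y] by (simp add: q_reflect reflect_X)
  also have "\<dots> = q x y" using assms q_sym[of y x] by (simp add: q_reflect)
  finally show ?thesis .
qed

lemma q_act: "set ns \<subseteq> N \<Longrightarrow> x \<in> X \<Longrightarrow> y \<in> X \<Longrightarrow> q (act J ns x) (act J ns y) = q x y"
  by (induction ns) (auto simp: q_reflect_reflect act_X)

text \<open>The sign \<sigma> appears because functionals in \<open>N\<close> are normalised at
  \<open>p\<close>. Evaluation at \<open>p\<close> shows what it means: it is \<open>-1\<close>
  exactly when the mirror of \<open>n\<close> separates \<open>p\<close> from its reflected
  image.\<close>

lemma pullback_reflect:
  assumes "m \<in> N" "n \<in> N"
  obtains k \<sigma> where "k \<in> N" "\<sigma> = 1 \<or> \<sigma> = -1" "\<And>z. k \<bullet> z = \<sigma> * (n \<bullet> reflect J m z)"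
    "\<And>z. reflect J m (reflect J k z) = reflect J n (reflect J m z)"
proof -
  define k where "k = n - (2 * (n \<bullet> J m)) *\<^sub>R m"
  note c = reflect_conj[OF linear_J N_unit[OF assms(1)] N_sym[OF assms] k_def]
  have "k \<in> N \<or> - k \<in> N" using N_closed[OF assms] k_def by simp
  then show thesis
  proof
    assume "k \<in> N"
    then show thesis using c by (intro that[of k 1]) auto
  next
    assume "- k \<in> N"
    then show thesis using c by (intro that[of "-k" "-1"]) (auto simp: reflect_uminus linear_J)
  qed
qed

lemma pullback:
  assumes "set ns \<subseteq> N" "n \<in> N"
  obtains k \<sigma> where "k \<in> N" "\<sigma> = 1 \<or> \<sigma> = -1" "\<And>z. k \<bullet> z = \<sigma> * (n \<bullet> act J ns z)"
    "\<And>z. act J ns (reflect J k z) = reflect J n (act J ns z)"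
  using assms
proof (induction ns arbitrary: n thesis)
  case Nil
  then show ?case by (auto intro: Nil(1)[of n 1])
next
  case (Cons a ns)
  obtain k \<sigma> where k: "k \<in> N" "\<sigma> = 1 \<or> \<sigma> = -1" "\<And>z. k \<bullet> z = \<sigma> * (n \<bullet> reflect J a z)"
    "\<And>z. reflect J a (reflect J k z) = reflect J n (reflect J a z)"
    using pullback_reflect[of a n] Cons.prems by auto
  obtain k' \<sigma>' where k': "k' \<in> N" "\<sigma>' = 1 \<or> \<sigma>' = -1" "\<And>z. k' \<bullet> z = \<sigma>' * (k \<bullet> act J ns z)"
    "\<And>z. act J ns (reflect J k' z) = reflect J k (act J ns z)"
    using Cons.IH[of k] Cons.prems k by auto
  show ?case
  proof (rule Cons.prems(1))
    show "k' \<in> N" by fact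
    show "\<sigma> * \<sigma>' = 1 \<or> \<sigma> * \<sigma>' = -1" using k k' by auto
    show "k' \<bullet> z = \<sigma> * \<sigma>' * (n \<bullet> act J (a # ns) z)" for z by (simp add: k k')
    show "act J (a # ns) (reflect J k' z) = reflect J n (act J (a # ns) z)" for z by (simp add: k k')
  qed
qed

lemma q_min:
  assumes "A \<subseteq> N" "x \<in> X" "y \<in> X"
  obtains us where "set us \<subseteq> A" "\<And>vs. set vs \<subseteq> A \<Longrightarrow> q x (act J us y) \<le> q x (act J vs y)"
proof -
  let ?O = "{act J us y |us. set us \<subseteq> A}"
  obtain b where b: "\<And>y' z. y' \<in> X \<Longrightarrow> z \<in> X \<Longrightarrow> norm y' \<le> norm x \<Longrightarrow> q y' z \<le> q x y \<Longrightarrow> norm z \<le> b"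
    using q_bdd[of "norm x" "q x y"] by blast
  have "{z \<in> ?O. q x z \<le> q x y} \<subseteq> {act J ns y |ns. set ns \<subseteq> N \<and> norm (act J ns y) \<le> b}"
    using assms by (force intro!: b[of x] act_X)
  then have fin: "finite {z \<in> ?O. q x z \<le> q x y}"
    using orbit_finite[of y b] assms finite_subset by blast
  have "y \<in> ?O" by (auto intro!: exI[of _ "[]"])
  from finite_arg_min[of y ?O "q x", OF this fin]
  obtain z where z: "z \<in> ?O" "\<And>w. w \<in> ?O \<Longrightarrow> q x z \<le> q x w" by blast
  then show thesis using that by blast
qed

section \<open>Local finiteness of the mirrors\<close>

lemma N_proportional:
  assumes "m \<in> N" "n \<in> N" "n = c *\<^sub>R m"
  shows "n = m"
proof -
  have "n \<bullet> p = c * (m \<bullet> p)" using assms by simp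
  then have "c > 0" using N_p[OF assms(1)] N_p[OF assms(2)] zero_less_mult_pos2 by force
  moreover have "1 = c * c"
    using N_unit[OF assms(2)] N_unit[OF assms(1)] assms(3) by (simp add: linear_scale[OF linear_J])
  ultimately have "c = 1" by (metis abs_of_pos abs_1 real_sqrt_abs2 real_sqrt_one)
  then show ?thesis using assms by simp
qed

text \<open>By \<open>q_reflect\<close>, equal images of \<open>p\<close> force
  \<open>(m \<bullet> p) m\<close> and \<open>(n \<bullet> p) n\<close> to agree on
  \<open>X\<close>, hence on the open cone \<open>E\<close>, hence everywhere. Mirrors can thus be
  counted through the orbit of \<open>p\<close>.\<close>

lemma reflect_p_inj:
  assumes "m \<in> N" "n \<in> N" "reflect J m p = reflect J n p"
  shows "m = n"
proof -
  have x: "(m \<bullet> x) * (m \<bullet> p) = (n \<bullet> x) * (n \<bullet> p)" if "x \<in> X" for x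
    using q_reflect[OF assms(1) that p_X] q_reflect[OF assms(2) that p_X] assms(3) by simp
  have "(m \<bullet> x) * (m \<bullet> p) = (n \<bullet> x) * (n \<bullet> p)" if "x \<in> E" for x
    using x[OF nrm_X[OF that]] nrm_pos[OF that] by simp
  then have d: "((m \<bullet> p) *\<^sub>R m - (n \<bullet> p) *\<^sub>R n) \<bullet> x = 0" if "x \<in> E" for x
    using that by (simp add: inner_diff_left) (metis mult.commute)
  have "(m \<bullet> p) *\<^sub>R m - (n \<bullet> p) *\<^sub>R n = 0"
  proof (rule ccontr)
    assume "\<not> ?thesis"
    then obtain z where "z \<in> E" "((m \<bullet> p) *\<^sub>R m - (n \<bullet> p) *\<^sub>R n) \<bullet> z \<noteq> 0"
      using open_avoid_hyperplanes[OF E_open, of "{(m \<bullet> p) *\<^sub>R m - (n \<bullet> p) *\<^sub>R n}"] p_X X_E by auto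
    with d show False by blast
  qed
  then have "(1 / (n \<bullet> p)) *\<^sub>R ((n \<bullet> p) *\<^sub>R n) = (1 / (n \<bullet> p)) *\<^sub>R ((m \<bullet> p) *\<^sub>R m)" by simp
  then have "n = ((m \<bullet> p) / (n \<bullet> p)) *\<^sub>R m" using N_p[OF assms(2)] by simp
  then show ?thesis using N_proportional[OF assms(1,2)] by metis
qed

text \<open>If the mirror of \<open>m\<close> separates \<open>p\<close> from \<open>y\<close> or
  contains \<open>y\<close>, reflecting \<open>p\<close> in it does not move \<open>p\<close> away
  from \<open>y\<close>. The images of \<open>p\<close> therefore stay in a bounded region, where
  its orbit is finite. The count includes the mirrors that merely separate \<open>p\<close> from a
  point of the region.\<close>

lemma finite_near: "finite {m \<in> N. \<exists>y\<in>X. norm y \<le> b \<and> m \<bullet> y \<le> 0}"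
proof -
  have "compact (X \<inter> cball 0 b)" using X_closed by (simp add: closed_Int_compact)
  moreover have "continuous_on (X \<inter> cball 0 b) (\<lambda>y. q y p)"
  proof -
    have "continuous_on (X \<inter> cball 0 b) ((\<lambda>z. q (fst z) (snd z)) \<circ> (\<lambda>y. (y, p)))"
      using p_X by (intro continuous_on_compose continuous_intros continuous_on_subset[OF q_cont]) auto
    then show ?thesis by (simp add: o_def)
  qed
  ultimately have "bounded ((\<lambda>y. q y p) ` (X \<inter> cball 0 b))"
    using compact_continuous_image compact_imp_bounded by blast
  then obtain c where "\<forall>x\<in>(\<lambda>y. q y p) ` (X \<inter> cball 0 b). norm x \<le> c"
    unfolding bounded_iff by blast
  then have c: "q y p \<le> c" if "y \<in> X" "norm y \<le> b" for y
    using that by force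
  obtain b' where b': "\<And>y z. y \<in> X \<Longrightarrow> z \<in> X \<Longrightarrow> norm y \<le> b \<Longrightarrow> q y z \<le> c \<Longrightarrow> norm z \<le> b'"
    using q_bdd[of b c] by blast
  let ?M = "{m \<in> N. \<exists>y\<in>X. norm y \<le> b \<and> m \<bullet> y \<le> 0}"
  have "reflect J m p \<in> {act J ns p |ns. set ns \<subseteq> N \<and> norm (act J ns p) \<le> b'}" if m: "m \<in> ?M" for m
  proof -
    obtain y where y: "y \<in> X" "norm y \<le> b" "m \<bullet> y \<le> 0" "m \<in> N" using m by auto
    have "q y (reflect J m p) \<le> q y p"
      using y N_p[of m] by (simp add: q_reflect p_X mult_nonpos_nonneg)
    then have "norm (reflect J m p) \<le> b'" using y c[of y] by (intro b'[of y]) (auto intro: reflect_X p_X)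
    then show ?thesis using y by (auto intro!: exI[of _ "[m]"])
  qed
  then have "(\<lambda>m. reflect J m p) ` ?M \<subseteq> {act J ns p |ns. set ns \<subseteq> N \<and> norm (act J ns p) \<le> b'}" by blast
  then have "finite ((\<lambda>m. reflect J m p) ` ?M)" using orbit_finite[OF p_X] finite_subset by blast
  moreover have "inj_on (\<lambda>m. reflect J m p) ?M" by (rule inj_onI) (auto intro: reflect_p_inj)
  ultimately show ?thesis using finite_imageD by blast
qed

section \<open>The chamber of the base point and its walls\<close>

definition D where "D = {x \<in> X. \<forall>n\<in>N. n \<bullet> x \<ge> 0}"

definition D0 where "D0 = {x \<in> X. \<forall>n\<in>N. n \<bullet> x > 0}"

text \<open>Infinitely many open half-spaces need not have an open intersection. By
  \<open>finite_near\<close>, all but finitely many functionals are positive at all points of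
  \<open>X\<close> within distance \<open>1\<close> of \<open>x\<close>.\<close>

lemma open_D0: "\<exists>U. open U \<and> D0 = X \<inter> U"
proof -
  have "openin (top_of_set X) D0"
  proof (subst openin_subopen, intro ballI)
    fix x assume x: "x \<in> D0"
    define M where "M = {m \<in> N. \<exists>y\<in>X. norm y \<le> norm x + 1 \<and> m \<bullet> y \<le> 0}"
    have M: "finite M" unfolding M_def by (rule finite_near)
    let ?U = "ball x 1 \<inter> (\<Inter>m\<in>M. {y. m \<bullet> y > 0})"
    have "open ?U" using M by (intro open_Int open_INT ballI open_halfspace_gt open_ball) auto
    moreover have "x \<in> ?U" using x by (auto simp: D0_def M_def)
    moreover have "X \<inter> ?U \<subseteq> D0"
    proof
      fix y assume y: "y \<in> X \<inter> ?U"
      have "norm y \<le> norm x + dist x y" by (metis dist_commute dist_norm norm_triangle_sub add.commute)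
      then have "norm y \<le> norm x + 1" using y by (auto simp: less_imp_le)
      then have "n \<bullet> y > 0" if "n \<in> N" for n
        using that y by (cases "n \<in> M") (auto simp: M_def not_le)
      then show "y \<in> D0" using y by (auto simp: D0_def)
    qed
    ultimately show "\<exists>T. openin (top_of_set X) T \<and> x \<in> T \<and> T \<subseteq> D0"
      using x by (intro exI[of _ "X \<inter> ?U"]) (auto simp: openin_open D0_def)
  qed
  then show ?thesis by (auto simp: openin_open)
qed

text \<open>Radial projection carries \<open>open_D0\<close> to the cone; this gives room to perturb
  \<open>p\<close> in every direction of the ambient space.\<close>

lemma open_cone_D0: "open {z \<in> E. \<forall>n\<in>N. n \<bullet> z > 0}"
proof -
  obtain U where U: "open U" "D0 = X \<inter> U" using open_D0 by blast
  have "{z \<in> E. \<forall>n\<in>N. n \<bullet> z > 0} = E \<inter> (\<lambda>z. (1 / nrm z) *\<^sub>R z) -` U" (is "?L = ?R")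
  proof (rule Set.set_eqI)
    fix z
    show "z \<in> ?L \<longleftrightarrow> z \<in> ?R"
    proof (cases "z \<in> E")
      case True
      have "z \<in> ?L \<longleftrightarrow> (1 / nrm z) *\<^sub>R z \<in> D0"
        using True nrm_X nrm_pos[OF True] by (auto simp: D0_def zero_less_divide_iff)
      then show ?thesis using U(2) nrm_X True by auto
    qed auto
  qed
  moreover have "open (E \<inter> (\<lambda>z. (1 / nrm z) *\<^sub>R z) -` U)"
    using E_open U(1) nrm_cont nrm_pos
    by (intro continuous_open_preimage continuous_intros) force+
  ultimately show ?thesis by simp
qed

text \<open>The simple reflections of the chamber: passing from \<open>p\<close> to its image under
  the reflection changes the sign of no functional other than \<open>m\<close>, so nothing but the
  mirror of \<open>m\<close> lies between the two points.\<close>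

definition S where "S = {m \<in> N. \<forall>n\<in>N. n \<noteq> m \<longrightarrow> n \<bullet> reflect J m p > 0}"

lemma S_N: "S \<subseteq> N" by (auto simp: S_def)

text \<open>
  The mirror crossed first on the way from a generic point near \<open>p\<close> to \<open>y\<close> is crossed alone,
  hence is a wall of the chamber of \<open>p\<close>.
\<close>

lemma wall_separates:
  assumes y: "y \<in> X" "\<And>n. n \<in> N \<Longrightarrow> n \<bullet> y \<noteq> 0" and a: "a \<in> N" "a \<bullet> y < 0"
  obtains m where "m \<in> S" "m \<bullet> y < 0"
proof -
  define M where "M = {m \<in> N. m \<bullet> y < 0}"
  have "finite M" unfolding M_def
    by (rule finite_subset[OF _ finite_near[of "norm y"]]) (use y in force)
  \<comment> \<open>For \<open>m\<close> and \<open>m'\<close> in \<open>M\<close>,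
    \<open>l (m, m')\<close> vanishes at \<open>p'\<close> exactly when the ray
    \<open>p' + t y\<close> meets both mirrors at the same parameter. Avoiding these finitely many
    functionals is what generic means here.\<close>
  define l where "l = (\<lambda>(m, m'). (m \<bullet> y) *\<^sub>R m' - (m' \<bullet> y) *\<^sub>R m)"
  define L where "L = l ` {(m, m'). m \<in> M \<and> m' \<in> M \<and> m \<noteq> m'}"
  have finL: "finite L" unfolding L_def
    by (intro finite_imageI finite_subset[OF _ finite_cartesian_product[OF \<open>finite M\<close> \<open>finite M\<close>]]) auto
  have L0: "0 \<notin> L"
  proof
    assume "0 \<in> L"
    then obtain m m' where m: "m \<in> M" "m' \<in> M" "m \<noteq> m'" "(m \<bullet> y) *\<^sub>R m' = (m' \<bullet> y) *\<^sub>R m"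
      by (auto simp: L_def l_def)
    then have "(1 / (m \<bullet> y)) *\<^sub>R ((m \<bullet> y) *\<^sub>R m') = (1 / (m \<bullet> y)) *\<^sub>R ((m' \<bullet> y) *\<^sub>R m)" by simp
    moreover have "m \<bullet> y \<noteq> 0" using m by (simp add: M_def)
    ultimately have "m' = ((m' \<bullet> y) / (m \<bullet> y)) *\<^sub>R m" by simp
    from N_proportional[OF _ _ this] have "m' = m" using m by (simp add: M_def)
    then show False using m by simp
  qed
  have ne: "{z \<in> E. \<forall>n\<in>N. n \<bullet> z > 0} \<noteq> {}" using p_X X_E N_p by blast
  obtain p' where p'E: "p' \<in> {z \<in> E. \<forall>n\<in>N. n \<bullet> z > 0}" and p'L: "\<And>l. l \<in> L \<Longrightarrow> l \<bullet> p' \<noteq> 0"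
    by (rule open_avoid_hyperplanes[OF open_cone_D0 ne finL L0], rule that)
  then have p': "\<And>n. n \<in> N \<Longrightarrow> n \<bullet> p' > 0" by blast
  \<comment> \<open>The parameter at which \<open>p' + t y\<close> reaches the mirror of
    \<open>m\<close>. The sign of a functional is invariant under positive scaling, so this ray can
    replace the geodesic from \<open>p'\<close> to \<open>y\<close>.\<close>
  define t where "t = (\<lambda>m. (m \<bullet> p') / - (m \<bullet> y))"
  have "M \<noteq> {}" using a by (auto simp: M_def)
  then obtain m where m: "m \<in> M" "\<And>n. n \<in> M \<Longrightarrow> t m \<le> t n"
    using \<open>finite M\<close> ex_is_arg_min_if_finite[of M t] by (metis is_arg_min_linorder)
  define z where "z = p' + t m *\<^sub>R y"
  have my: "m \<in> N" "m \<bullet> y < 0" using m by (auto simp: M_def)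
  have t_pos: "t m > 0" using my p'[of m] by (simp add: t_def divide_pos_neg)
  have mz: "m \<bullet> z = 0" using my by (simp add: z_def t_def inner_add_right inner_diff_right)
  have nz: "n \<bullet> z > 0" if n: "n \<in> N" "n \<noteq> m" for n
  proof (cases "n \<in> M")
    case True
    have "l (m, n) \<in> L" using True m n by (auto simp: L_def)
    then have "(m \<bullet> y) * (n \<bullet> p') \<noteq> (n \<bullet> y) * (m \<bullet> p')"
      using p'L[of "l (m, n)"] by (simp add: l_def inner_diff_left)
    then have "t m \<noteq> t n" using True my by (auto simp: t_def M_def field_simps)
    then have "t m < t n" using m(2)[OF True] by simp
    then have "t m * (n \<bullet> y) > t n * (n \<bullet> y)" using True by (simp add: M_def)
    moreover have "t n * (n \<bullet> y) = - (n \<bullet> p')" using True by (simp add: t_def M_def)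
    ultimately show ?thesis by (simp add: z_def inner_add_right)
  next
    case False
    then have "n \<bullet> y > 0" using n y(2)[of n] by (auto simp: M_def)
    then show ?thesis using t_pos p'[OF n(1)] by (simp add: z_def inner_add_right add_pos_pos)
  qed
  \<comment> \<open>\<open>z\<close> lies on the mirror of \<open>m\<close> alone and is fixed by
    its reflection. At \<open>z\<close>, \<open>n\<close> is positive and the pulled-back functional
    \<open>k\<close> is not negative, which forces \<sigma> to be \<open>1\<close>; at
    \<open>p\<close> this is the claim.\<close>
  have "n \<bullet> reflect J m p > 0" if n: "n \<in> N" "n \<noteq> m" for n
  proof -
    obtain k \<sigma> where k: "k \<in> N" "\<sigma> = 1 \<or> \<sigma> = -1" "\<And>z. k \<bullet> z = \<sigma> * (n \<bullet> reflect J m z)"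
      using pullback_reflect[OF my(1) n(1)] by metis
    have "k \<bullet> z = \<sigma> * (n \<bullet> z)" by (simp add: k mz)
    moreover have "k \<bullet> z \<ge> 0" using mz nz[of k] k(1) by (cases "k = m") auto
    ultimately have "\<sigma> = 1" using nz[OF n] k(2) by auto
    then show ?thesis using k(3)[of p] N_p[OF k(1)] by simp
  qed
  then have "m \<in> S" using my by (auto simp: S_def)
  then show thesis using my that by blast
qed

lemma act_off_mirrors:
  assumes "set ns \<subseteq> N" "n \<in> N" "y \<in> X" "\<And>k. k \<in> N \<Longrightarrow> k \<bullet> y \<noteq> 0"
  shows "n \<bullet> act J ns y \<noteq> 0"
proof -
  obtain k \<sigma> where "k \<in> N" "\<sigma> = 1 \<or> \<sigma> = -1" "\<And>z. k \<bullet> z = \<sigma> * (n \<bullet> act J ns z)"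
    using pullback[OF assms(1,2)] by metis
  then show ?thesis using assms(4)[of k] by auto
qed

text \<open>
  A counterexample \<open>n\<close> with the least displacement of \<open>p\<close> would become, conjugated by a wall that
  separates \<open>p\<close> from its image, a counterexample with a smaller displacement.
\<close>

lemma reflect_word_S:
  assumes "n \<in> N"
  obtains ns where "set ns \<subseteq> S" "\<And>z. reflect J n z = act J ns z"
proof (rule ccontr)
  assume nthesis: "\<not> thesis"
  define B where "B = {n \<in> N. \<not> (\<exists>ns. set ns \<subseteq> S \<and> (\<forall>z. reflect J n z = act J ns z))}"
  have "n \<in> B" using assms nthesis that by (auto simp: B_def)
  let ?O = "(\<lambda>n. reflect J n p) ` B"
  obtain b where b: "\<And>z. z \<in> X \<Longrightarrow> q p z \<le> q p (reflect J n p) \<Longrightarrow> norm z \<le> b"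
    using q_bdd[of "norm p" "q p (reflect J n p)"] p_X by blast
  have B_N: "B \<subseteq> N" by (auto simp: B_def)
  have "{z \<in> ?O. q p z \<le> q p (reflect J n p)} \<subseteq> {act J ns p |ns. set ns \<subseteq> N \<and> norm (act J ns p) \<le> b}"
  proof
    fix z assume z: "z \<in> {z \<in> ?O. q p z \<le> q p (reflect J n p)}"
    then obtain m where m: "m \<in> N" "z = act J [m] p" using B_N by auto
    moreover have "norm z \<le> b" using z m p_X by (intro b) (auto intro: reflect_X)
    ultimately show "z \<in> {act J ns p |ns. set ns \<subseteq> N \<and> norm (act J ns p) \<le> b}"
      by (intro CollectI exI[of _ "[m]"]) auto
  qed
  then have fin: "finite {z \<in> ?O. q p z \<le> q p (reflect J n p)}"
    using orbit_finite[of p b] p_X finite_subset by blast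
  from finite_arg_min[of "reflect J n p" ?O "q p", OF _ fin] \<open>n \<in> B\<close>
  obtain z where z: "z \<in> ?O" "\<And>w. w \<in> ?O \<Longrightarrow> q p z \<le> q p w" by blast
  then obtain a where a: "a \<in> B" "z = reflect J a p" by blast
  then have aN: "a \<in> N" using B_N by blast
  have nz: "k \<bullet> z \<noteq> 0" if "k \<in> N" for k
    using act_off_mirrors[of "[a]" k p] that aN N_p p_X a(2) by force
  have "a \<bullet> z < 0" using a aN N_p by simp
  then obtain m where m: "m \<in> S" "m \<bullet> z < 0"
    using wall_separates[of z a] a aN nz p_X reflect_X by blast
  have mN: "m \<in> N" using m S_N by blast
  show False
  proof (cases "m = a")
    case True
    then have "set [a] \<subseteq> S" "\<forall>z. reflect J a z = act J [a] z" using m by auto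
    then show False using a unfolding B_def by blast
  next
    case False
    obtain k \<sigma> where k: "k \<in> N" "\<sigma> = 1 \<or> \<sigma> = -1" "\<And>z. k \<bullet> z = \<sigma> * (a \<bullet> reflect J m z)"
      "\<And>z. reflect J m (reflect J k z) = reflect J a (reflect J m z)"
      using pullback_reflect[OF mN aN] by metis
    have "a \<bullet> reflect J m p > 0" using m False aN by (auto simp: S_def)
    then have "\<sigma> = 1" using k(2) k(3)[of p] N_p[OF k(1)] by auto
    then have kp: "k \<bullet> p = a \<bullet> p - 2 * (m \<bullet> p) * (a \<bullet> J m)"
      by (simp add: k(3) reflect_def inner_diff_right)
    \<comment> \<open>The mirror of \<open>m\<close> separates \<open>p\<close> from
      \<open>z\<close>, which makes the pairing of \<open>a\<close> and \<open>m\<close> positive.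
      Hence \<open>k\<close> is smaller than \<open>a\<close> at \<open>p\<close>, and by
      \<open>q_reflect\<close> the displacement of \<open>p\<close> increases with this
      value.\<close>
    have "m \<bullet> p - 2 * (a \<bullet> p) * (m \<bullet> J a) < 0"
      using m(2) a(2) by (simp add: reflect_def inner_diff_right)
    then have "(a \<bullet> p) * (m \<bullet> J a) > 0" using N_p[OF mN] by linarith
    then have "a \<bullet> J m > 0" using N_p[OF aN] N_sym[OF mN aN] zero_less_mult_pos by force
    then have "k \<bullet> p < a \<bullet> p" using kp N_p[OF mN] by simp
    then have "(k \<bullet> p) * (k \<bullet> p) < (a \<bullet> p) * (a \<bullet> p)"
      using N_p[OF k(1)] by (intro mult_strict_mono) auto
    then have "q p (reflect J k p) < q p z" using a(2) by (simp add: q_reflect p_X k(1) aN)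
    then have "k \<notin> B" using z(2) by force
    then obtain ns where ns: "set ns \<subseteq> S" "\<And>z. reflect J k z = act J ns z"
      using k(1) by (auto simp: B_def)
    have "reflect J a z = act J (m # ns @ [m]) z" for z
      using k(4)[of "reflect J m z"] mN ns(2) by simp
    moreover have "set (m # ns @ [m]) \<subseteq> S" using ns m by auto
    ultimately show False using a unfolding B_def by blast
  qed
qed

lemma word_S:
  assumes "set ns \<subseteq> N"
  obtains us where "set us \<subseteq> S" "\<And>z. act J ns z = act J us z"
  using assms
proof (induction ns arbitrary: thesis)
  case Nil
  then show ?case by (auto intro: Nil(1)[of "[]"])
next
  case (Cons a ns)
  obtain us where us: "set us \<subseteq> S" "\<And>z. act J ns z = act J us z" using Cons by auto
  obtain as where as: "set as \<subseteq> S" "\<And>z. reflect J a z = act J as z"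
    using reflect_word_S[of a] Cons.prems by auto
  show ?case by (rule Cons.prems(1)[of "as @ us"]) (use us as in auto)
qed

text \<open>
  Exchange argument: if the gallery of a nonempty word returns to the chamber of \<open>p\<close>, it crosses
  its first mirror a second time, and both crossings may be deleted from the word.
\<close>

lemma word_S_trivial:
  assumes "set ns \<subseteq> S" "\<And>k. k \<in> N \<Longrightarrow> k \<bullet> act J ns p > 0"
  shows "act J ns z = z"
  using assms
proof (induction "length ns" arbitrary: ns z rule: less_induct)
  case less
  show ?case
  proof (cases ns)
    case (Cons a r)
    have aN: "a \<in> N" using less.prems(1) S_N Cons by auto
    \<comment> \<open>The sign of \<open>f i\<close> tells on which side of the mirror of the first
      letter \<open>a\<close> the gallery is after \<open>i\<close> letters: negative after one,
      positive at the end. \<open>j\<close> is the first return.\<close>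
    define f where "f = (\<lambda>i. a \<bullet> act J (take i ns) p)"
    have f1: "f (Suc 0) < 0" using Cons aN N_p by (simp add: f_def)
    have fl: "f (length ns) > 0" using less.prems(2)[OF aN] by (simp add: f_def)
    define j where "j = (LEAST j. j \<ge> 1 \<and> f j > 0)"
    have j0: "length ns \<ge> 1 \<and> f (length ns) > 0" using Cons fl by simp
    have j: "j \<ge> 1 \<and> f j > 0" unfolding j_def by (rule LeastI[of "\<lambda>j. j \<ge> 1 \<and> f j > 0", OF j0])
    have jl: "j \<le> length ns" unfolding j_def by (rule Least_le[of "\<lambda>j. j \<ge> 1 \<and> f j > 0", OF j0])
    have "j \<noteq> 1" using j f1 by auto
    \<comment> \<open>The letter at position \<open>j - 1\<close>, counted from \<open>0\<close>,
      makes the second crossing. The prefix \<open>v\<close> before it has length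
      \<open>j - 1 = Suc i\<close> and so still contains the leading \<open>a\<close>.\<close>
    define i where "i = j - 2"
    have ji: "j = Suc (Suc i)" using j \<open>j \<noteq> 1\<close> unfolding i_def by linarith
    have fi: "f (Suc i) \<le> 0"
      using not_less_Least[of "Suc i" "\<lambda>j. j \<ge> 1 \<and> f j > 0"] ji unfolding j_def[symmetric] by auto
    define v s where "v = take (Suc i) ns" and "s = ns ! Suc i"
    have tj: "take j ns = v @ [s]" using jl ji by (simp add: v_def s_def take_Suc_conv_app_nth)
    have v: "v = a # take i r" using Cons by (simp add: v_def)
    have vN: "set v \<subseteq> N" unfolding v_def using less.prems(1) S_N set_take_subset by fastforce
    have sS: "s \<in> S" unfolding s_def using less.prems(1) jl ji by (auto simp: Suc_le_eq)
    obtain m \<sigma> where m: "m \<in> N" "\<sigma> = 1 \<or> \<sigma> = -1" "\<And>z. m \<bullet> z = \<sigma> * (a \<bullet> act J v z)"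
      "\<And>z. act J v (reflect J m z) = reflect J a (act J v z)"
      using pullback[OF vN aN] by metis
    \<comment> \<open>Pulling \<open>a\<close> back along \<open>v\<close> turns the second crossing
      into one between \<open>p\<close> and its image under \<open>s\<close>. A wall is crossed
      alone, so the pulled-back mirror \<open>m\<close> is that of \<open>s\<close>.\<close>
    have "\<sigma> = -1" using m(2) m(3)[of p] N_p[OF m(1)] fi by (auto simp: f_def v_def)
    then have "m \<bullet> reflect J s p < 0"
      using m(3)[of "reflect J s p"] j tj by (simp add: f_def)
    then have "m = s" using sS m(1) by (force simp: S_def)
    \<comment> \<open>Now \<open>v\<close> followed by \<open>s\<close> acts as \<open>a\<close>
      followed by \<open>v\<close>, and \<open>v\<close> starts with \<open>a\<close>: the two
      copies of \<open>a\<close> cancel, which removes the letters at positions \<open>0\<close> and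
      \<open>j - 1\<close>.\<close>
    define us where "us = take i r @ drop j ns"
    have "act J ns z = act J us z" for z
    proof -
      have "act J ns z = act J (take j ns) (act J (drop j ns) z)"
        by (simp flip: act_append)
      also have "\<dots> = reflect J a (act J v (act J (drop j ns) z))"
        using m(4) \<open>m = s\<close> by (simp add: tj)
      also have "\<dots> = act J us z" using aN by (simp add: v us_def)
      finally show ?thesis .
    qed
    moreover have "act J us z = z" for z
    proof (rule less.hyps)
      show "length us < length ns" using jl ji Cons by (simp add: us_def)
      show "set us \<subseteq> S" using less.prems(1) Cons set_take_subset[of i r] set_drop_subset[of j ns]
        by (auto simp: us_def)
      show "k \<bullet> act J us p > 0" if "k \<in> N" for k
        using less.prems(2)[OF that] calculation by simp
    qed
    ultimately show ?thesis by simp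
  qed simp
qed

text \<open>If one point of the open chamber returns to it, all signs \<sigma> of the word are
  \<open>1\<close>, so \<open>p\<close> returns as well and \<open>word_S_trivial\<close>
  applies.\<close>

lemma word_trivial:
  assumes "set ns \<subseteq> N" "y \<in> D0" "act J ns y \<in> D0"
  shows "act J ns z = z"
proof -
  obtain us where us: "set us \<subseteq> S" "\<And>z. act J ns z = act J us z" using word_S[OF assms(1)] by blast
  have "k \<bullet> act J us p > 0" if k: "k \<in> N" for k
  proof -
    obtain m \<sigma> where m: "m \<in> N" "\<sigma> = 1 \<or> \<sigma> = -1" "\<And>z. m \<bullet> z = \<sigma> * (k \<bullet> act J ns z)"
      using pullback[OF assms(1) k] by metis
    have "m \<bullet> y > 0" "k \<bullet> act J ns y > 0" using assms m(1) k by (auto simp: D0_def)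
    then have "\<sigma> = 1" using m(2) m(3)[of y] by auto
    then show ?thesis using m(3)[of p] N_p[OF m(1)] us by simp
  qed
  then show ?thesis using word_S_trivial[OF us(1)] us(2) by simp
qed

text \<open>The orbit point closest to \<open>x\<close> works: a mirror that separated it from
  \<open>x\<close> could be used to reflect it closer, by \<open>q_reflect\<close>.\<close>

lemma orbit_meets_D:
  assumes "x \<in> D0" "y \<in> X"
  obtains us where "set us \<subseteq> N" "act J us y \<in> D"
    "\<And>vs. set vs \<subseteq> N \<Longrightarrow> q x (act J us y) \<le> q x (act J vs y)"
proof -
  have x: "x \<in> X" using assms by (simp add: D0_def)
  obtain us where us: "set us \<subseteq> N" "\<And>vs. set vs \<subseteq> N \<Longrightarrow> q x (act J us y) \<le> q x (act J vs y)"
    using q_min[OF subset_refl x assms(2)] by blast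
  have "n \<bullet> act J us y \<ge> 0" if n: "n \<in> N" for n
  proof (rule ccontr)
    assume "\<not> ?thesis"
    then have "(n \<bullet> x) * (n \<bullet> act J us y) < 0" using assms n by (auto simp: D0_def mult_pos_neg)
    then have "q x (act J (n # us) y) < q x (act J us y)"
      using n x us(1) assms(2) by (simp add: q_reflect act_X mult.assoc)
    then show False using us(2)[of "n # us"] us(1) n by force
  qed
  then have "act J us y \<in> D" using us(1) assms(2) by (auto simp: D_def act_X)
  then show thesis using that us by blast
qed

text \<open>The orbit of \<open>y\<close> avoids all mirrors, so its point closest to
  \<open>x\<close> lies in the open chamber and, by \<open>word_trivial\<close>, is reached by a
  trivial word only. Thus \<open>y\<close> itself is closest, and any word attaining the minimum is
  trivial.\<close>

theorem q_strict:
  assumes "x \<in> D0" "y \<in> D0" "set us \<subseteq> N" "act J us z \<noteq> z"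
  shows "q x (act J us y) > q x y"
proof -
  have xy: "x \<in> X" "y \<in> X" using assms by (auto simp: D0_def)
  have *: "act J vs w = w" if vs: "set vs \<subseteq> N" "\<And>ws. set ws \<subseteq> N \<Longrightarrow> q x (act J vs y) \<le> q x (act J ws y)"
    for vs w
  proof -
    have "n \<bullet> act J vs y > 0" if n: "n \<in> N" for n
    proof (rule ccontr)
      assume "\<not> ?thesis"
      moreover have "n \<bullet> act J vs y \<noteq> 0"
        using act_off_mirrors[OF vs(1) n xy(2)] assms(2) by (force simp: D0_def)
      ultimately have "(n \<bullet> x) * (n \<bullet> act J vs y) < 0" using assms n by (auto simp: D0_def mult_pos_neg)
      then have "q x (act J (n # vs) y) < q x (act J vs y)"
        using n xy vs(1) by (simp add: q_reflect act_X mult.assoc)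
      then show False using vs(2)[of "n # vs"] vs(1) n by force
    qed
    then have "act J vs y \<in> D0" using xy vs(1) by (simp add: D0_def act_X)
    then show ?thesis using word_trivial[OF vs(1) assms(2)] by simp
  qed
  obtain vs where vs: "set vs \<subseteq> N" "\<And>ws. set ws \<subseteq> N \<Longrightarrow> q x (act J vs y) \<le> q x (act J ws y)"
    using orbit_meets_D[OF assms(1) xy(2)] by metis
  have le: "q x y \<le> q x (act J ws y)" if "set ws \<subseteq> N" for ws
    using vs(2)[OF that] *[OF vs] by simp
  have "q x (act J us y) \<noteq> q x y"
  proof
    assume "q x (act J us y) = q x y"
    then have "act J us z = z" using *[OF assms(3)] le by simp
    then show False using assms by simp
  qed
  then show ?thesis using le[OF assms(3)] by simp
qed

section \<open>Folding onto the closed chamber\<close>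

lemma D_limit:
  assumes "x \<in> D"
  obtains f where "\<And>k. f k \<in> D0" "f \<longlonglongrightarrow> x"
proof -
  have x: "x \<in> X" "x \<in> E" using assms X_E by (auto simp: D_def)
  let ?v = "\<lambda>k. x + (1 / real (Suc k)) *\<^sub>R p"
  have E: "?v k \<in> E" for k using x p_X X_E by (intro E_cone) auto
  show thesis
  proof (rule that)
    show "(1 / nrm (?v k)) *\<^sub>R ?v k \<in> D0" for k
    proof -
      have "n \<bullet> ?v k > 0" if "n \<in> N" for n
        using assms that N_p[OF that] by (simp add: D_def inner_add_right add_nonneg_pos)
      then show ?thesis using nrm_X[OF E] nrm_pos[OF E] by (auto simp: D0_def)
    qed
    show "(\<lambda>k. (1 / nrm (?v k)) *\<^sub>R ?v k) \<longlonglongrightarrow> x"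
      by (rule normalised_tendsto[OF E_open x(2) nrm_cont nrm_1[OF x(1)]])
  qed
qed

lemma q_tendsto:
  assumes "f \<longlonglongrightarrow> x" "g \<longlonglongrightarrow> y" "\<And>k. f k \<in> X" "\<And>k. g k \<in> X" "x \<in> X" "y \<in> X"
  shows "(\<lambda>k. q (f k) (g k)) \<longlonglongrightarrow> q x y"
proof -
  have "(\<lambda>k. (f k, g k)) \<longlonglongrightarrow> (x, y)" using assms by (intro tendsto_intros)
  from continuous_on_tendsto_compose[OF q_cont this]
  have "(\<lambda>k. (\<lambda>z. q (fst z) (snd z)) (f k, g k)) \<longlonglongrightarrow> (\<lambda>z. q (fst z) (snd z)) (x, y)"
    using assms by simp
  then show ?thesis by simp
qed

text \<open>Boundary points are limits of interior ones, for which \<open>q_strict\<close> holds;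
  only strictness is lost in the limit.\<close>

theorem q_fold_le:
  assumes "x \<in> D" "y \<in> D" "set us \<subseteq> N"
  shows "q x y \<le> q x (act J us y)"
proof (cases "\<forall>z. act J us z = z")
  case False
  then obtain z where z: "act J us z \<noteq> z" by blast
  obtain f where f: "\<And>k. f k \<in> D0" "f \<longlonglongrightarrow> x" using D_limit[OF assms(1)] by blast
  obtain g where g: "\<And>k. g k \<in> D0" "g \<longlonglongrightarrow> y" using D_limit[OF assms(2)] by blast
  have X: "f k \<in> X" "g k \<in> X" "x \<in> X" "y \<in> X" for k using f g assms by (auto simp: D0_def D_def)
  have 1: "(\<lambda>k. q (f k) (g k)) \<longlonglongrightarrow> q x y" using f g X by (intro q_tendsto)
  have "(\<lambda>k. act J us (g k)) \<longlonglongrightarrow> act J us y"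
    by (rule bounded_linear.tendsto[OF _ g(2)]) (use linear_act linear_conv_bounded_linear in blast)
  then have 2: "(\<lambda>k. q (f k) (act J us (g k))) \<longlonglongrightarrow> q x (act J us y)"
    using f X assms(3) by (intro q_tendsto act_X)
  show ?thesis
    by (rule LIMSEQ_le[OF 1 2]) (use q_strict[OF f(1) g(1) assms(3) z] less_imp_le in blast)
qed simp

definition fold_map where
  "fold_map y = (SOME z. z \<in> D \<and> (\<exists>us. set us \<subseteq> N \<and> z = act J us y))"

lemma fold_map:
  assumes "y \<in> X"
  shows "fold_map y \<in> D" "\<exists>us. set us \<subseteq> N \<and> fold_map y = act J us y"
proof -
  have "p \<in> D0" using p_X N_p by (simp add: D0_def)
  then have "\<exists>z. z \<in> D \<and> (\<exists>us. set us \<subseteq> N \<and> z = act J us y)"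
    using orbit_meets_D[of p y] assms by metis
  from someI_ex[OF this] show "fold_map y \<in> D" "\<exists>us. set us \<subseteq> N \<and> fold_map y = act J us y"
    by (auto simp: fold_map_def)
qed

text \<open>The two points may be folded by different words. \<open>q_fold_le\<close> allows the
  second folded point to be exchanged for the image of \<open>z\<close> under the word of
  \<open>y\<close>, and a single word preserves \<open>q\<close>.\<close>

lemma q_fold_map:
  assumes "y \<in> X" "z \<in> X"
  shows "q (fold_map y) (fold_map z) \<le> q y z"
proof -
  obtain us where us: "set us \<subseteq> N" "fold_map y = act J us y" using fold_map[OF assms(1)] by blast
  obtain vs where vs: "set vs \<subseteq> N" "fold_map z = act J vs z" using fold_map[OF assms(2)] by blast
  have "q (fold_map y) (fold_map z) \<le> q (fold_map y) (act J (us @ rev vs) (fold_map z))"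
    using us(1) vs(1) fold_map(1)[OF assms(1)] fold_map(1)[OF assms(2)] by (intro q_fold_le) auto
  also have "\<dots> = q (act J us y) (act J us z)" using us vs act_rev'[OF vs(1)] by simp
  also have "\<dots> = q y z" using us assms by (intro q_act)
  finally show ?thesis .
qed

text \<open>Links \<open>q\<close> to the topology: away from a ball around \<open>x\<close>,
  \<open>q x\<close> either exceeds \<open>1\<close> or is bounded below by its positive minimum on
  a compact set.\<close>

lemma q_small_dist:
  assumes "x \<in> X" "e > 0"
  obtains d where "d > 0" "\<And>z. z \<in> X \<Longrightarrow> q x z < d \<Longrightarrow> dist x z < e"
proof -
  obtain b where b: "\<And>z. z \<in> X \<Longrightarrow> q x z \<le> 1 \<Longrightarrow> norm z \<le> b"
    using q_bdd[of "norm x" 1] assms(1) by blast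
  let ?K = "X \<inter> cball 0 b - ball x e"
  have K: "compact ?K" using X_closed by (intro compact_diff closed_Int_compact) auto
  have c: "continuous_on ?K (q x)"
  proof -
    have "continuous_on ?K ((\<lambda>z. q (fst z) (snd z)) \<circ> (\<lambda>y. (x, y)))"
      using assms by (intro continuous_on_compose continuous_intros continuous_on_subset[OF q_cont]) auto
    then show ?thesis by (simp add: o_def)
  qed
  show thesis
  proof (cases "?K = {}")
    case True
    show thesis
    proof (rule that[of 1])
      fix z assume "z \<in> X" "q x z < 1"
      then show "dist x z < e" using b[of z] True by force
    qed simp
  next
    case False
    obtain w where w: "w \<in> ?K" "\<And>z. z \<in> ?K \<Longrightarrow> q x w \<le> q x z"
      using continuous_attains_inf[OF K False c] by blast
    have "w \<noteq> x" "w \<in> X" using w assms by auto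
    then have pos: "q x w > 0" using q_nonneg[of x w] q_eq0[of x w] assms by fastforce
    show thesis
    proof (rule that[of "min 1 (q x w)"])
      fix z assume "z \<in> X" "q x z < min 1 (q x w)"
      then show "dist x z < e" using b[of z] w(2)[of z] by force
    qed (use pos in simp)
  qed
qed

lemma fold_map_cont: "continuous_on X fold_map"
  unfolding continuous_on_iff
proof (intro ballI allI impI)
  fix x and e :: real assume x: "x \<in> X" and "e > 0"
  have fX: "fold_map z \<in> X" if "z \<in> X" for z using fold_map[OF that] by (simp add: D_def)
  obtain d where d: "d > 0" "\<And>z. z \<in> X \<Longrightarrow> q (fold_map x) z < d \<Longrightarrow> dist (fold_map x) z < e"
    using q_small_dist[OF fX[OF x] \<open>e > 0\<close>] by blast
  have "continuous_on X ((\<lambda>z. q (fst z) (snd z)) \<circ> (\<lambda>y. (x, y)))"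
    using x by (intro continuous_on_compose continuous_intros continuous_on_subset[OF q_cont]) auto
  then have "continuous_on X (q x)" by (simp add: o_def)
  then obtain d' where d': "d' > 0" "\<And>z. z \<in> X \<Longrightarrow> dist z x < d' \<Longrightarrow> dist (q x z) (q x x) < d"
    using x d(1) unfolding continuous_on_iff by blast
  have "dist (fold_map z) (fold_map x) < e" if z: "z \<in> X" "dist z x < d'" for z
  proof -
    have "q x z < d" using d'(2)[OF z] q_eq0[OF x x] by (simp add: dist_real_def)
    then have "q (fold_map x) (fold_map z) < d" using q_fold_map[OF x z(1)] by simp
    then show ?thesis using d(2)[OF fX[OF z(1)]] by (simp add: dist_commute)
  qed
  then show "\<exists>d>0. \<forall>x'\<in>X. dist x' x < d \<longrightarrow> dist (fold_map x') (fold_map x) < e"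
    using d'(1) by blast
qed

end

section \<open>Linear mirror systems\<close>

text \<open>\<open>A\<close> transports the standard inner product to one in which, by
  \<open>AJ\<close>, the vector \<open>J n\<close> represents the functional \<open>n\<close>. The
  reflections are orthogonal for it even though \<open>J\<close> may be degenerate or
  indefinite.\<close>

lemma linear_mirror_system:
  fixes J A :: "'v::euclidean_space \<Rightarrow> 'v"
  assumes J: "linear J" and A: "linear A" "inj A"
    and unit: "\<And>n. n \<in> N \<Longrightarrow> n \<bullet> J n = 1"
    and AJ: "\<And>n z. n \<in> N \<Longrightarrow> A (J n) \<bullet> A z = n \<bullet> z"
    and closed: "\<And>m n. m \<in> N \<Longrightarrow> n \<in> N \<Longrightarrow>
          n - (2 * (n \<bullet> J m)) *\<^sub>R m \<in> N \<or> - (n - (2 * (n \<bullet> J m)) *\<^sub>R m) \<in> N"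
    and pos: "\<And>n. n \<in> N \<Longrightarrow> n \<bullet> p > 0"
    and fin: "\<And>y. finite {act J ns y |ns. set ns \<subseteq> N}"
  shows "mirror_system J UNIV UNIV (\<lambda>_. 1) (\<lambda>z w. (norm (A (z - w)))\<^sup>2) N p"
proof (rule mirror_system.intro; ((rule J closed; assumption?) | simp add: unit pos)?)
  fix m n assume "m \<in> N" "n \<in> N"
  then show "m \<bullet> J n = n \<bullet> J m" using AJ[of m "J n"] AJ[of n "J m"] by (simp add: inner_commute)
next
  fix x y show "norm (A (x - y)) = norm (A (y - x))"
    by (simp add: linear_diff[OF A(1)] norm_minus_commute)
next
  fix x y
  show "A (x - y) = 0 \<longleftrightarrow> x = y" using A(2) by (auto simp: linear_diff[OF A(1)] inj_eq)
next
  fix n x y assume n: "n \<in> N"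
  have "A (x - reflect J n y) = A (x - y) + (2 * (n \<bullet> y)) *\<^sub>R A (J n)"
    by (simp add: reflect_def linear_diff[OF A(1)] linear_add[OF A(1)] linear_scale[OF A(1)])
  then have "(norm (A (x - reflect J n y)))\<^sup>2
      = (norm (A (x - y)))\<^sup>2 + 4 * (n \<bullet> y) * (A (J n) \<bullet> A (x - y)) + 4 * (n \<bullet> y)\<^sup>2 * (A (J n) \<bullet> A (J n))"
    by (simp add: power2_norm_eq_inner inner_add_left inner_add_right inner_commute)
      (simp add: power2_eq_square)
  also have "\<dots> = (norm (A (x - y)))\<^sup>2 + 4 * (n \<bullet> x) * (n \<bullet> y)"
    using unit[OF n] by (simp add: AJ[OF n] inner_diff_right power2_eq_square algebra_simps)
  finally show "(norm (A (x - reflect J n y)))\<^sup>2 = (norm (A (x - y)))\<^sup>2 + 4 * (n \<bullet> x) * (n \<bullet> y)" .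
next
  show "continuous_on UNIV (\<lambda>z. (norm (A (fst z - snd z)))\<^sup>2)"
    by (intro continuous_intros linear_continuous_on_compose[OF _ A(1)])
next
  fix b c :: real
  obtain B where B: "B > 0" "\<And>x. B * norm x \<le> norm (A x)"
    using linear_inj_bounded_below_pos[OF A] by blast
  show "\<exists>b'. \<forall>y. norm y \<le> b \<longrightarrow> (\<forall>z. (norm (A (y - z)))\<^sup>2 \<le> c \<longrightarrow> norm z \<le> b')"
  proof (intro exI allI impI)
    fix y z assume y: "norm y \<le> b" and "(norm (A (y - z)))\<^sup>2 \<le> c"
    then have "norm (A (y - z)) \<le> sqrt c" using real_le_rsqrt by blast
    then have "B * norm (y - z) \<le> sqrt c" using B(2)[of "y - z"] by linarith
    then have "norm (y - z) \<le> sqrt c / B" using B(1) by (simp add: field_simps)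
    then show "norm z \<le> b + sqrt c / B" using y norm_triangle_sub[of z y] by (simp add: norm_minus_commute)
  qed
next
  fix y and b :: real
  show "finite {act J ns y |ns. set ns \<subseteq> N \<and> norm (act J ns y) \<le> b}"
    by (rule finite_subset[OF _ fin[of y]]) blast
qed

text \<open>
  The fixed vector obtained from Brouwer's theorem may lie on mirrors.  These mirrors form a smaller
  system, to which the induction hypothesis applies on the orthogonal complement of the vector, and
  its fixed vector there tells in which direction to move into the interior of the chamber.
\<close>

theorem linear_fixed_vector:
  fixes J A :: "'v::euclidean_space \<Rightarrow> 'v"
  assumes J: "linear J" and A: "linear A" "inj A"
    and unit: "\<And>n. n \<in> N \<Longrightarrow> n \<bullet> J n = 1"
    and AJ: "\<And>n z. n \<in> N \<Longrightarrow> A (J n) \<bullet> A z = n \<bullet> z"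
    and closed: "\<And>m n. m \<in> N \<Longrightarrow> n \<in> N \<Longrightarrow>
          n - (2 * (n \<bullet> J m)) *\<^sub>R m \<in> N \<or> - (n - (2 * (n \<bullet> J m)) *\<^sub>R m) \<in> N"
    and pos: "\<And>n. n \<in> N \<Longrightarrow> n \<bullet> p > 0"
    and fin: "\<And>y. finite {act J ns y |ns. set ns \<subseteq> N}"
    and N0: "N \<noteq> {}"
    and P: "subspace P" "\<And>n. n \<in> N \<Longrightarrow> J n \<in> P"
    and h: "linear h" "\<And>z. norm (A (h z)) = norm (A z)" "\<And>z. z \<in> P \<Longrightarrow> h z \<in> P"
  shows "\<exists>ns v. set ns \<subseteq> N \<and> v \<in> P \<and> (\<forall>n\<in>N. n \<bullet> v > 0) \<and> act J ns (h v) = v"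
  using unit AJ closed pos fin N0 P h
proof (induction "dim P" arbitrary: P N h p rule: less_induct)
  case less
  note unit = less.prems(1) and AJ = less.prems(2) and closed = less.prems(3) and pos = less.prems(4)
    and fin = less.prems(5) and N0 = less.prems(6) and P = less.prems(7,8) and h = less.prems(9-11)
  let ?q = "\<lambda>z w. (norm (A (z - w)))\<^sup>2"
  interpret mirror_system J UNIV UNIV "\<lambda>_. 1" ?q N p
    by (rule linear_mirror_system) (use J A unit AJ closed pos fin in auto)
  have finN: "finite N"
    by (rule finite_subset[OF _ finite_near[of 0]]) auto
  have refl_P: "reflect J n z \<in> P" if "n \<in> N" "z \<in> P" for n z
    unfolding reflect_def using that P by (intro subspace_diff subspace_scale)
  have act_P: "act J ns z \<in> P" if "set ns \<subseteq> N" "z \<in> P" for ns z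
    using that by (induction ns) (auto intro: refl_P)
  have norm_reflect: "norm (A (reflect J n z)) = norm (A z)" if "n \<in> N" for n z
  proof -
    have "reflect J n 0 = 0" by simp
    then show ?thesis using q_reflect_reflect[OF that, of z 0] by simp
  qed
  have norm_act: "norm (A (act J ns z)) = norm (A z)" if "set ns \<subseteq> N" for ns z
    using that by (induction ns) (auto simp: norm_reflect)
  \<comment> \<open>\<open>p\<close> need not lie in \<open>P\<close>. Its orthogonal projection to
    \<open>P\<close> in the transported inner product does, with unchanged values of all
    \<open>n\<close>, because every \<open>J n\<close> is in \<open>P\<close>.\<close>
  have AP: "subspace (A ` P)" using P(1) A(1) linear_subspace_image by blast
  obtain y z where yz: "y \<in> span (A ` P)" "\<And>w. w \<in> span (A ` P) \<Longrightarrow> orthogonal z w" "A p = y + z"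
    using orthogonal_subspace_decomp_exists[of "A ` P" "A p"] by blast
  then obtain p1 where p1: "p1 \<in> P" "A p1 = y" using AP by (metis imageE span_eq_iff)
  have p1_pos: "n \<bullet> p1 > 0" if n: "n \<in> N" for n
  proof -
    have "A (J n) \<in> span (A ` P)" using P(2)[OF n] by (simp add: span_base)
    then have "A (J n) \<bullet> z = 0" using yz(2) by (metis inner_commute orthogonal_def)
    then have "n \<bullet> p1 = n \<bullet> p"
      using AJ[OF n, of p1] AJ[OF n, of p] p1(2) yz(3) by (simp add: inner_add_right)
    then show ?thesis using pos[OF n] by simp
  qed
  obtain m where m: "m \<in> N" using N0 by blast
  have "p1 \<noteq> 0" using p1_pos[OF m] by auto
  then have Ap1: "norm (A p1) > 0" using A linear_injective_0 by fastforce
  define c where "c = (1 / norm (A p1)) *\<^sub>R p1"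
  have c: "c \<in> P" "norm (A c) = 1" "\<And>n. n \<in> N \<Longrightarrow> n \<bullet> c > 0"
    using p1 P(1) Ap1 p1_pos by (auto simp: c_def subspace_scale linear_scale[OF A(1)])
  \<comment> \<open>The unit vectors of the chamber do not form a convex set, so Brouwer's theorem is applied to a
    convex set \<open>K\<close> containing their translates \<open>x + c\<close> instead.  As \<open>s y\<close> is the reflection of \<open>c\<close> in the line through \<open>y\<close>,
    \<open>s (x + c) = x\<close> for every unit vector \<open>x\<close>.\<close>
  define K where "K = {y \<in> P. (\<forall>n\<in>N. n \<bullet> y \<ge> 0) \<and> m \<bullet> y \<ge> m \<bullet> c \<and> norm (A y) \<le> 2}"
  define s where "s = (\<lambda>y. (2 * (A y \<bullet> A c) / (A y \<bullet> A y)) *\<^sub>R y - c)"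
  define F where "F = (\<lambda>y. c + fold_map (h (s y)))"
  \<comment> \<open>The condition \<open>m \<bullet> y \<ge> m \<bullet> c\<close> in
    \<open>K\<close> keeps away the origin, where \<open>s\<close> is singular; the radius
    \<open>2\<close> there bounds a sum of two unit vectors.\<close>
  have K_nz: "A y \<bullet> A y \<noteq> 0" if "y \<in> K" for y
  proof -
    have "y \<noteq> 0" using that c(3)[OF m] by (auto simp: K_def)
    then show ?thesis using A linear_injective_0 by auto
  qed
  have s_P: "s y \<in> P" if "y \<in> K" for y
    unfolding s_def using that c(1) P(1) by (intro subspace_diff subspace_scale) (auto simp: K_def)
  have s_norm: "norm (A (s y)) = 1" if "y \<in> K" for y
  proof -
    have "A (s y) = (2 * (A y \<bullet> A c) / (A y \<bullet> A y)) *\<^sub>R A y - A c"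
      by (simp add: s_def linear_diff[OF A(1)] linear_scale[OF A(1)])
    moreover have "A c \<bullet> A c = 1" using c(2) by (simp add: norm_eq_1)
    ultimately have "A (s y) \<bullet> A (s y) = 1" using K_nz[OF that]
      by (simp add: inner_diff_left inner_diff_right inner_commute[of "A c" "A y"])
    then show ?thesis by (simp add: norm_eq_1)
  qed
  have fold_P: "fold_map z \<in> P" if "z \<in> P" for z
    using fold_map(2)[of z] act_P that by force
  have fold_norm: "norm (A (fold_map z)) = norm (A z)" for z
    using fold_map(2)[of z] norm_act by force
  have fold_D: "n \<bullet> fold_map z \<ge> 0" if "n \<in> N" for n z
    using fold_map(1)[of z] that by (simp add: D_def)
  have "K = P \<inter> (\<Inter>n\<in>N. {y. n \<bullet> y \<ge> 0}) \<inter> {y. m \<bullet> y \<ge> m \<bullet> c} \<inter> A -` cball 0 2"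
    by (auto simp: K_def)
  moreover have "closed (A -` cball 0 2)" "convex (A -` cball 0 2)"
    using A(1) by (auto intro!: continuous_closed_vimage convex_linear_vimage linear_continuous_at
        simp: linear_conv_bounded_linear)
  moreover have "closed P" "convex P"
    using P(1) by (auto intro: closed_subspace subspace_imp_convex)
  ultimately have "closed K" "convex K"
    by (auto intro!: closed_Int closed_INT convex_Int convex_INT closed_halfspace_ge convex_halfspace_ge)
  obtain B where B: "B > 0" "\<And>x. B * norm x \<le> norm (A x)"
    using linear_inj_bounded_below_pos[OF A] by blast
  have "norm y \<le> 2 / B" if "y \<in> K" for y
    using B(2)[of y] that B(1) by (simp add: K_def field_simps)
  then have "bounded K" using bounded_iff by blast
  with \<open>closed K\<close> have "compact K" by (simp add: compact_eq_bounded_closed)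
  moreover note \<open>convex K\<close>
  moreover have "K \<noteq> {}"
  proof -
    have "c \<in> K" using c m by (auto simp: K_def intro: less_imp_le)
    then show ?thesis by blast
  qed
  moreover have "continuous_on K F"
  proof -
    have "continuous_on K A" "continuous_on UNIV h"
      using A(1) h(1) by (auto intro: linear_continuous_on simp: linear_conv_bounded_linear)
    then have "continuous_on K s" unfolding s_def
      using K_nz by (intro continuous_intros) auto
    with \<open>continuous_on UNIV h\<close> have "continuous_on K (h \<circ> s)"
      by (meson continuous_on_compose continuous_on_subset subset_UNIV)
    then have "continuous_on K (fold_map \<circ> (h \<circ> s))"
      by (meson continuous_on_compose continuous_on_subset subset_UNIV fold_map_cont)
    then have "continuous_on K (\<lambda>y. fold_map (h (s y)))" by (simp add: o_def)
    then show ?thesis unfolding F_def by (intro continuous_intros)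
  qed
  moreover have "F \<in> K \<rightarrow> K"
  proof
    fix y assume y: "y \<in> K"
    have "norm (A (F y)) \<le> norm (A c) + norm (A (fold_map (h (s y))))"
      unfolding F_def linear_add[OF A(1)] by (rule norm_triangle_ineq)
    then have "norm (A (F y)) \<le> 2" using c(2) s_norm[OF y] by (simp add: fold_norm h(2))
    then show "F y \<in> K" unfolding K_def using c fold_D m s_P[OF y] P(1) h(3) fold_P
      by (auto simp: F_def inner_add_right less_imp_le add_nonneg_nonneg intro!: subspace_add)
  qed
  ultimately obtain y where y: "y \<in> K" "F y = y" using brouwer[of K F] by blast
  define x where "x = fold_map (h (s y))"
  have yx: "y = x + c" using y(2) by (metis F_def x_def add.commute)
  have x: "x \<in> P" "norm (A x) = 1" "\<And>n. n \<in> N \<Longrightarrow> n \<bullet> x \<ge> 0"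
    using fold_P h(3) s_P[OF y(1)] fold_D s_norm[OF y(1)] by (auto simp: x_def fold_norm h(2))
  have sy: "s y = x"
  proof -
    have "A x \<bullet> A x = 1" "A c \<bullet> A c = 1" using x(2) c(2) by (simp_all add: norm_eq_1)
    then have "A y \<bullet> A y = 2 * (A y \<bullet> A c)"
      by (simp add: yx linear_add[OF A(1)] inner_add_left inner_add_right inner_commute)
    then have "2 * (A y \<bullet> A c) / (A y \<bullet> A y) = 1" using K_nz[OF y(1)] by (metis divide_self)
    then have "s y = 1 *\<^sub>R y - c" unfolding s_def by (simp only:)
    then show ?thesis by (simp add: yx)
  qed
  have "x = fold_map (h x)" using x_def unfolding sy .
  then obtain us where us: "set us \<subseteq> N" "act J us (h x) = x"
    using fold_map(2)[of "h x"] by auto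
  define h' where "h' = act J us \<circ> h"
  have h'x: "h' x = x" using us by (simp add: h'_def)
  have h': "linear h'" "\<And>z. norm (A (h' z)) = norm (A z)" "\<And>z. z \<in> P \<Longrightarrow> h' z \<in> P"
    using h linear_compose[OF h(1) linear_act] us(1) by (auto simp: h'_def norm_act act_P)
  \<comment> \<open>Polarisation: \<open>h'\<close> preserves the transported norm and fixes
    \<open>x\<close>, so it also preserves the orthogonal complement of \<open>x\<close>, on which
    the induction continues.\<close>
  have h'_inner: "A x \<bullet> A (h' z) = A x \<bullet> A z" for z
  proof -
    have "norm (A (h' (x + z))) = norm (A (x + z))" by (rule h'(2))
    then have "(norm (A x + A (h' z)))\<^sup>2 = (norm (A x + A z))\<^sup>2"
      by (simp add: linear_add[OF h'(1)] linear_add[OF A(1)] h'x)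
    moreover have "(norm (A (h' z)))\<^sup>2 = (norm (A z))\<^sup>2" by (simp add: h'(2))
    ultimately show ?thesis
      by (simp add: power2_norm_eq_inner inner_add_left inner_add_right inner_commute)
  qed
  define N' where "N' = {n \<in> N. n \<bullet> x = 0}"
  show ?case
  proof (cases "N' = {}")
    case True
    then have "\<forall>n\<in>N. n \<bullet> x > 0" using x(3) by (force simp: N'_def)
    then show ?thesis using us x by blast
  next
    case False
    define P' where "P' = {z \<in> P. A x \<bullet> A z = 0}"
    have subP': "subspace P'"
      using P(1) unfolding P'_def subspace_def
      by (auto simp: linear_add[OF A(1)] linear_scale[OF A(1)] linear_0[OF A(1)] inner_add_right)
    have "x \<notin> P'" using x(2) by (auto simp: P'_def norm_eq_1)
    moreover have "P' \<subseteq> P" by (auto simp: P'_def)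
    ultimately have "P' \<subset> P" using x(1) by blast
    then have dimP': "dim P' < dim P"
      using dim_psubset[of P' P] subP' P(1) by (simp add: span_eq_iff[THEN iffD2])
    \<comment> \<open>For a mirror through \<open>x\<close>, \<open>AJ\<close> makes
      \<open>J n\<close> orthogonal to \<open>x\<close> in the transported inner product, so these
      reflections act within \<open>P'\<close>.\<close>
    have "\<exists>ns v. set ns \<subseteq> N' \<and> v \<in> P' \<and> (\<forall>n\<in>N'. n \<bullet> v > 0) \<and> act J ns (h' v) = v"
    proof (rule less.hyps[OF dimP', where p = p])
      fix n assume n: "n \<in> N'"
      then show "n \<bullet> J n = 1" "n \<bullet> p > 0" "J n \<in> P'" "A (J n) \<bullet> A z = n \<bullet> z" for z
        using unit pos P(2) AJ[of n x] AJ by (auto simp: N'_def P'_def inner_commute)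
      fix k assume k: "k \<in> N'"
      have "(n - (2 * (n \<bullet> J k)) *\<^sub>R k) \<bullet> x = 0" using n k by (simp add: N'_def inner_diff_left)
      then show "n - (2 * (n \<bullet> J k)) *\<^sub>R k \<in> N' \<or> - (n - (2 * (n \<bullet> J k)) *\<^sub>R k) \<in> N'"
        using closed[of k n] n k by (auto simp: N'_def inner_diff_left)
    next
      show "finite {act J ns y |ns. set ns \<subseteq> N'}" for y
        by (rule finite_subset[OF _ fin[of y]]) (auto simp: N'_def)
    next
      show "h' z \<in> P'" if "z \<in> P'" for z using that h'(3) h'_inner by (auto simp: P'_def)
    qed (use False subP' h' in auto)
    then obtain ns v where v: "set ns \<subseteq> N'" "v \<in> P'" "\<And>n. n \<in> N' \<Longrightarrow> n \<bullet> v > 0" "act J ns (h' v) = v"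
      by blast
    \<comment> \<open>A short step along \<open>v\<close> does not spoil the finitely many
      functionals that are positive at \<open>x\<close>, and for those vanishing at \<open>x\<close>
      the sign is that of their value at \<open>v\<close>.\<close>
    have "\<exists>e>0. \<forall>n\<in>N. n \<bullet> (x + e *\<^sub>R v) > 0"
    proof -
      have "open (\<Inter>n\<in>N - N'. {z. n \<bullet> z > 0})"
        using finN by (intro open_INT) (auto intro: open_halfspace_gt)
      moreover have "x \<in> (\<Inter>n\<in>N - N'. {z. n \<bullet> z > 0})"
        using x(3) by (force simp: N'_def)
      ultimately obtain d where d: "d > 0" "ball x d \<subseteq> (\<Inter>n\<in>N - N'. {z. n \<bullet> z > 0})"
        using open_contains_ball by blast
      define e where "e = d / (norm v + 1)"
      have e: "e > 0" using d(1) by (simp add: e_def add_nonneg_pos)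
      have "e * norm v < e * (norm v + 1)" using e by simp
      also have "\<dots> = d" by (simp add: e_def add_nonneg_eq_0_iff)
      finally have "x + e *\<^sub>R v \<in> ball x d" using e by (simp add: dist_norm)
      then have "n \<bullet> (x + e *\<^sub>R v) > 0" if "n \<in> N - N'" for n using d(2) that by blast
      moreover have "n \<bullet> (x + e *\<^sub>R v) > 0" if "n \<in> N'" for n
        using that v(3)[OF that] e by (simp add: N'_def inner_add_right)
      ultimately show ?thesis using e by blast
    qed
    then obtain e where e: "\<And>n. n \<in> N \<Longrightarrow> n \<bullet> (x + e *\<^sub>R v) > 0" by blast
    have "act J (ns @ us) (h (x + e *\<^sub>R v)) = act J ns (h' (x + e *\<^sub>R v))" by (simp add: h'_def)
    also have "\<dots> = act J ns (h' x) + e *\<^sub>R act J ns (h' v)"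
      by (simp add: linear_add[OF h'(1)] linear_scale[OF h'(1)] linear_add[OF linear_act] linear_scale[OF linear_act])
    also have "act J ns (h' x) = x" unfolding h'x using v(1) by (intro act_fix) (auto simp: N'_def)
    finally have "act J (ns @ us) (h (x + e *\<^sub>R v)) = x + e *\<^sub>R v" using v(4) by simp
    moreover have "x + e *\<^sub>R v \<in> P" using x(1) v(2) P(1) by (auto simp: P'_def intro!: subspace_add subspace_scale)
    moreover have "set (ns @ us) \<subseteq> N" using v(1) us(1) by (auto simp: N'_def)
    ultimately show ?thesis using e by blast
  qed
qed

section \<open>The three geometries\<close>

fun eps :: "geometry \<Rightarrow> real" where
  "eps Spherical = 1"
| "eps Euclidean = 0"
| "eps Hyperbolic = -1"

definition Jm :: "geometry \<Rightarrow> real \<times> 'a::euclidean_space \<Rightarrow> real \<times> 'a" where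
  "Jm K z = (eps K * fst z, snd z)"

text \<open>
  On each of the three spaces, the distance is a strictly increasing function of \<open>qd\<close>.
\<close>

definition qd :: "geometry \<Rightarrow> real \<times> 'a::euclidean_space \<Rightarrow> real \<times> 'a \<Rightarrow> real" where
  "qd K x y = (x - y) \<bullet> Jm K (x - y)"

text \<open>The positive multiples of the points of the space: all nonzero vectors, an open
  half-space, the interior of the future light cone. On it \<open>nrm\<close> is the homogeneous
  gauge that equals \<open>1\<close> on the space.\<close>

fun cone :: "geometry \<Rightarrow> (real \<times> 'a::euclidean_space) set" where
  "cone Spherical = - {0}"
| "cone Euclidean = {z. fst z > 0}"
| "cone Hyperbolic = {z. fst z > norm (snd z)}"

fun nrm :: "geometry \<Rightarrow> real \<times> 'a::euclidean_space \<Rightarrow> real" where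
  "nrm Spherical z = norm z"
| "nrm Euclidean z = fst z"
| "nrm Hyperbolic z = sqrt ((fst z)\<^sup>2 - (norm (snd z))\<^sup>2)"

section \<open>The quadratic form and the distances\<close>

lemma norm_mult_norm: "norm x * norm x = x \<bullet> x" for x :: "'v::real_inner"
  by (metis power2_norm_eq_inner power2_eq_square)

lemma Jm_Spherical [simp]: "Jm Spherical z = z"
  by (simp add: Jm_def)

lemma linear_Jm: "linear (Jm K)"
  by (rule linearI) (auto simp: Jm_def algebra_simps)

lemma Jm_sym: "a \<bullet> Jm K b = b \<bullet> Jm K a"
  by (simp add: Jm_def inner_prod_def inner_commute)

text \<open>The entry \<open>eps K\<close> occurs cubed on the left, and each of \<open>1\<close>,
  \<open>0\<close>, \<open>-1\<close> is its own cube.\<close>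

lemma Jm_Jm: "Jm K a \<bullet> Jm K (Jm K a) = a \<bullet> Jm K a"
  by (cases K) (simp_all add: Jm_def inner_prod_def)

lemma qd_alt: "qd K x y = eps K * (fst x - fst y)\<^sup>2 + (norm (snd x - snd y))\<^sup>2"
  by (simp add: qd_def Jm_def inner_prod_def norm_mult_norm power2_eq_square)

lemma qd_sym: "qd K x y = qd K y x"
  by (simp add: qd_alt power2_commute norm_minus_commute)

lemma qd_self [simp]: "qd K x x = 0"
  by (simp add: qd_alt)

lemma hyp_iff: "x \<in> cc_space Hyperbolic \<longleftrightarrow> fst x > 0 \<and> (fst x)\<^sup>2 = 1 + (norm (snd x))\<^sup>2"
  by (auto simp: minkowski_def norm_mult_norm power2_eq_square)

lemma qd_minkowski:
  assumes "x \<in> cc_space Hyperbolic" "y \<in> cc_space Hyperbolic"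
  shows "qd Hyperbolic x y = - 2 - 2 * minkowski x y"
  using assms by (simp add: qd_alt minkowski_def norm_mult_norm power2_eq_square
      inner_diff_left inner_diff_right inner_commute algebra_simps)

lemma qd_sphere:
  assumes "x \<in> cc_space Spherical" "y \<in> cc_space Spherical"
  shows "qd Spherical x y = 2 - 2 * (x \<bullet> y)"
proof -
  have "x \<bullet> x = 1" "y \<bullet> y = 1" using assms by (simp_all add: norm_eq_1)
  then show ?thesis
    by (simp add: qd_def inner_diff_left inner_diff_right inner_commute[of y x])
qed

lemma qd_euclidean:
  assumes "x \<in> cc_space Euclidean" "y \<in> cc_space Euclidean"
  shows "qd Euclidean x y = (dist x y)\<^sup>2"
  using assms by (cases x, cases y) (simp add: qd_alt dist_norm)

text \<open>Reversed Cauchy-Schwarz inequality, from \<open>(1 + a\<^sup>2) (1 + b\<^sup>2) = (1 + a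
  b)\<^sup>2 + (a - b)\<^sup>2\<close>. The first part keeps the defect, which settles the case of
  equality in \<open>qd_eq0\<close>; its alternative sets aside a negative
  \<open>1 + snd x \<bullet> snd y\<close>, where comparing squares may fail.\<close>

lemma minkowski_le:
  assumes "x \<in> cc_space Hyperbolic" "y \<in> cc_space Hyperbolic"
  shows "(norm (snd x) - norm (snd y))\<^sup>2 \<le> (fst x * fst y)\<^sup>2 - (1 + snd x \<bullet> snd y)\<^sup>2 \<or> snd x \<bullet> snd y < -1"
    and "- minkowski x y \<ge> 1"
proof -
  have x: "fst x > 0" "(fst x)\<^sup>2 = 1 + (norm (snd x))\<^sup>2" and y: "fst y > 0" "(fst y)\<^sup>2 = 1 + (norm (snd y))\<^sup>2"
    using assms by (simp_all only: hyp_iff)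
  have e: "(fst x * fst y)\<^sup>2 = (1 + norm (snd x) * norm (snd y))\<^sup>2 + (norm (snd x) - norm (snd y))\<^sup>2"
    by (simp add: power_mult_distrib x y) (simp add: power2_eq_square algebra_simps)
  have cs: "snd x \<bullet> snd y \<le> norm (snd x) * norm (snd y)" by (rule norm_cauchy_schwarz)
  show "(norm (snd x) - norm (snd y))\<^sup>2 \<le> (fst x * fst y)\<^sup>2 - (1 + snd x \<bullet> snd y)\<^sup>2 \<or> snd x \<bullet> snd y < -1"
  proof (cases "snd x \<bullet> snd y < -1")
    case False
    then have "(1 + snd x \<bullet> snd y)\<^sup>2 \<le> (1 + norm (snd x) * norm (snd y))\<^sup>2"
      using cs by (intro power_mono) auto
    then show ?thesis using e by simp
  qed simp
  have "(1 + norm (snd x) * norm (snd y))\<^sup>2 \<le> (fst x * fst y)\<^sup>2" using e by simp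
  then have "1 + norm (snd x) * norm (snd y) \<le> fst x * fst y"
    by (rule power2_le_imp_le) (use x(1) y(1) in simp)
  then show "- minkowski x y \<ge> 1" using cs by (simp add: minkowski_def)
qed

lemma qd_nonneg:
  assumes "x \<in> cc_space K" "y \<in> cc_space K"
  shows "qd K x y \<ge> 0"
proof (cases K)
  case Hyperbolic
  then show ?thesis using minkowski_le(2)[of x y] qd_minkowski[of x y] assms by simp
qed (simp_all add: qd_alt)

lemma qd_eq0:
  assumes "x \<in> cc_space K" "y \<in> cc_space K"
  shows "qd K x y = 0 \<longleftrightarrow> x = y"
proof
  assume 0: "qd K x y = 0"
  show "x = y"
  proof (cases K)
    case Spherical
    then have "(x - y) \<bullet> (x - y) = 0" using 0 by (simp add: qd_def)
    then show ?thesis by simp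
  next
    case Euclidean
    then show ?thesis using 0 assms by (cases x, cases y) (simp add: qd_alt)
  next
    case Hyperbolic
    have xy: "x \<in> cc_space Hyperbolic" "y \<in> cc_space Hyperbolic" using assms Hyperbolic by auto
    have "minkowski x y = -1" using 0 qd_minkowski[OF xy] Hyperbolic by simp
    then have eq: "fst x * fst y = 1 + snd x \<bullet> snd y" by (simp add: minkowski_def)
    have pos: "fst x > 0" "fst y > 0" using xy by (simp_all only: hyp_iff)
    then have "fst x * fst y > 0" by simp
    then have "\<not> snd x \<bullet> snd y < -1" using eq by linarith
    then have "(norm (snd x) - norm (snd y))\<^sup>2 \<le> 0" using minkowski_le(1)[OF xy] eq by simp
    then have n: "norm (snd x) = norm (snd y)" by simp
    then have "(fst x)\<^sup>2 = (fst y)\<^sup>2" using xy by (simp only: hyp_iff)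
    then have f: "fst x = fst y" using pos by (simp add: power2_eq_iff_nonneg)
    then have "(norm (snd x - snd y))\<^sup>2 = 0" using 0 Hyperbolic by (simp add: qd_alt)
    then show ?thesis using f by (simp add: prod_eq_iff)
  qed
qed simp

lemma cc_dist_qd:
  assumes "x \<in> cc_space K" "y \<in> cc_space K" "x' \<in> cc_space K" "y' \<in> cc_space K"
    and "cc_dist K x y = cc_dist K x' y'"
  shows "qd K x y = qd K x' y'"
proof (cases K)
  case Spherical
  have "norm x = 1" "norm y = 1" "norm x' = 1" "norm y' = 1" using assms Spherical by simp_all
  then have "\<bar>x \<bullet> y\<bar> \<le> 1" "\<bar>x' \<bullet> y'\<bar> \<le> 1"
    using Cauchy_Schwarz_ineq2[of x y] Cauchy_Schwarz_ineq2[of x' y'] by simp_all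
  then have "x \<bullet> y = x' \<bullet> y'" using assms(5) Spherical arccos_eq_iff by simp
  then show ?thesis using qd_sphere assms Spherical by metis
next
  case Euclidean
  then show ?thesis using assms qd_euclidean[of x y] qd_euclidean[of x' y'] by simp
next
  case Hyperbolic
  have "- minkowski x y \<ge> 1" "- minkowski x' y' \<ge> 1"
    using minkowski_le(2) assms Hyperbolic by blast+
  moreover have "arcosh (- minkowski x y) = arcosh (- minkowski x' y')"
    using assms(5) Hyperbolic by simp
  ultimately have "- minkowski x y = - minkowski x' y'" by (metis cosh_arcosh_real)
  then have "minkowski x y = minkowski x' y'" by simp
  then show ?thesis using qd_minkowski assms Hyperbolic by metis
qed

text \<open>The expansion needs \<open>J (J n)\<close> to agree with \<open>n\<close> on
  \<open>x - y\<close>. Where \<open>J\<close> is an involution this is automatic; in the Euclidean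
  case it holds because both points have first coordinate \<open>1\<close>.\<close>

lemma qd_reflect:
  assumes "n \<bullet> Jm K n = 1" "K \<noteq> Euclidean \<or> x \<in> cc_space K \<and> y \<in> cc_space K"
  shows "qd K x (reflect (Jm K) n y) = qd K x y + 4 * (n \<bullet> x) * (n \<bullet> y)"
proof -
  define t where "t = 2 * (n \<bullet> y)"
  have J: "Jm K (Jm K n) \<bullet> (x - y) = n \<bullet> (x - y)"
    using assms(2) by (cases K) (auto simp: Jm_def inner_prod_def)
  have eq: "x - reflect (Jm K) n y = (x - y) + t *\<^sub>R Jm K n"
    by (simp add: reflect_def t_def)
  have "qd K x (reflect (Jm K) n y)
      = (x - y) \<bullet> Jm K (x - y) + t * (Jm K n \<bullet> Jm K (x - y)) + t * ((x - y) \<bullet> Jm K (Jm K n))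
        + t * t * (Jm K n \<bullet> Jm K (Jm K n))"
    unfolding qd_def eq
    by (simp add: linear_add[OF linear_Jm] linear_scale[OF linear_Jm] inner_add_left inner_add_right
        distrib_left)
  also have "\<dots> = qd K x y + 2 * t * (n \<bullet> (x - y)) + t * t"
    using J Jm_sym[of "Jm K n" K "x - y"] by (simp add: Jm_Jm assms(1) qd_def inner_commute)
  also have "\<dots> = qd K x y + 4 * (n \<bullet> x) * (n \<bullet> y)"
    by (simp add: t_def inner_diff_right algebra_simps)
  finally show ?thesis .
qed

lemma reflect_cc_space:
  assumes n: "n \<bullet> Jm K n = 1" and x: "x \<in> cc_space K"
  shows "reflect (Jm K) n x \<in> cc_space K"
proof (cases K)
  case Spherical
  have "n \<bullet> n = 1" "x \<bullet> x = 1" using n x Spherical by (simp_all add: Jm_def norm_eq_1)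
  then have "reflect (Jm K) n x \<bullet> reflect (Jm K) n x = 1"
    using Spherical by (simp add: reflect_def Jm_def inner_diff_left inner_diff_right inner_commute)
  then show ?thesis using Spherical by (simp add: norm_eq_1)
next
  case Euclidean
  then show ?thesis using x by (simp add: reflect_def Jm_def)
next
  case Hyperbolic
  define y where "y = reflect (Jm K) n x"
  have qy: "qd K 0 y = qd K 0 x" unfolding y_def using qd_reflect[OF n, of 0 x] Hyperbolic by simp
  have qx: "qd K 0 x = -1" using x Hyperbolic by (simp add: qd_alt minkowski_def norm_mult_norm power2_eq_square)
  have m: "(fst y)\<^sup>2 = 1 + (norm (snd y))\<^sup>2" using qy qx Hyperbolic by (simp add: qd_alt)
  have x': "fst x > 0" "(fst x)\<^sup>2 = 1 + (norm (snd x))\<^sup>2" using x Hyperbolic by (simp_all only: hyp_iff)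
  \<comment> \<open>The form is preserved, so only a jump to the other sheet of the hyperboloid is
    to be excluded. There \<open>qd K x y\<close> would be negative, yet a reflection displaces
    \<open>x\<close> by \<open>4 (n \<bullet> x)\<^sup>2\<close>.\<close>
  have "fst y > 0"
  proof (rule ccontr)
    assume "\<not> fst y > 0"
    then have "-y \<in> cc_space Hyperbolic" unfolding hyp_iff using m
      by (metis add_nonneg_eq_0_iff fst_uminus linorder_neqE_linordered_idom neg_0_less_iff_less
          norm_minus_cancel power2_minus snd_uminus zero_le_one zero_le_power2 zero_neq_one zero_power2)
    then have "minkowski x (-y) \<le> -1" using minkowski_le(2)[of x "-y"] x Hyperbolic by simp
    then have "minkowski x y \<ge> 1" by (simp add: minkowski_def)
    moreover have "qd K x y = - 2 - 2 * minkowski x y" using m x'(2) Hyperbolic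
      by (simp add: qd_alt minkowski_def norm_mult_norm power2_eq_square
      inner_diff_left inner_diff_right inner_commute algebra_simps)
    moreover have "qd K x y \<ge> 0" unfolding y_def using qd_reflect[OF n, of x x] Hyperbolic by simp
    ultimately show False by linarith
  qed
  then show ?thesis using m Hyperbolic unfolding y_def by (metis hyp_iff)
qed

lemma qd_continuous: "continuous_on UNIV (\<lambda>z. qd K (fst z) (snd z))"
  unfolding qd_alt by (intro continuous_intros)

lemma closed_cc_space: "closed (cc_space K)"
proof (cases K)
  case Euclidean
  have "closed {x :: real \<times> 'a. fst x = 1}" by (intro closed_Collect_eq continuous_intros)
  then show ?thesis using Euclidean by simp
next
  case Hyperbolic
  have "cc_space Hyperbolic = {x :: real \<times> 'a. fst x \<ge> 0} \<inter> {x. (fst x)\<^sup>2 = 1 + (norm (snd x))\<^sup>2}"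
    unfolding set_eq_iff hyp_iff
    by (auto simp: order_le_less add_nonneg_eq_0_iff)
  moreover have "closed {x :: real \<times> 'a. fst x \<ge> 0}" by (intro closed_Collect_le continuous_intros)
  moreover have "closed {x :: real \<times> 'a. (fst x)\<^sup>2 = 1 + (norm (snd x))\<^sup>2}"
    by (intro closed_Collect_eq continuous_intros)
  ultimately show ?thesis using Hyperbolic by (simp only: closed_Int)
qed simp

lemma hyp_norm:
  assumes "x \<in> cc_space Hyperbolic"
  shows "norm (snd x) < fst x" "fst x \<le> norm x" "norm x \<le> 2 * fst x"
proof -
  have x: "fst x > 0" "(fst x)\<^sup>2 = 1 + (norm (snd x))\<^sup>2" using assms by (simp_all only: hyp_iff)
  then show 1: "norm (snd x) < fst x" using power2_less_imp_less[of "norm (snd x)" "fst x"] by linarith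
  show "fst x \<le> norm x" using norm_fst_le[of "fst x" "snd x"] x(1) by simp
  have "norm x \<le> norm (fst x) + norm (snd x)" by (metis norm_Pair_le prod.collapse)
  then show "norm x \<le> 2 * fst x" using 1 x(1) by simp
qed

lemma qd_bdd:
  "\<exists>b'. \<forall>y\<in>cc_space K. \<forall>z\<in>cc_space K. norm y \<le> b \<longrightarrow> qd K y z \<le> c \<longrightarrow> norm z \<le> b'"
proof (cases K)
  case Spherical
  then show ?thesis by (intro exI[of _ 1]) simp
next
  case Euclidean
  have "norm z \<le> b + sqrt c" if "y \<in> cc_space K" "z \<in> cc_space K" "norm y \<le> b" "qd K y z \<le> c" for y z :: "real \<times> 'a"
  proof -
    have "(dist y z)\<^sup>2 \<le> c" using qd_euclidean[of y z] that Euclidean by simp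
    then have "dist y z \<le> sqrt c" using real_le_rsqrt by blast
    then show ?thesis using that(3) norm_triangle_sub[of z y] by (simp add: dist_norm norm_minus_commute)
  qed
  then show ?thesis by blast
next
  case Hyperbolic
  have "norm z \<le> 2 * (2 * b * (1 + c / 2))"
    if "y \<in> cc_space K" "z \<in> cc_space K" "norm y \<le> b" "qd K y z \<le> c" for y z :: "real \<times> 'a"
  proof -
    have yz: "y \<in> cc_space Hyperbolic" "z \<in> cc_space Hyperbolic" using that Hyperbolic by auto
    note hy = hyp_norm[OF yz(1)] and hz = hyp_norm[OF yz(2)]
    have y: "fst y > 0" "(fst y)\<^sup>2 = 1 + (norm (snd y))\<^sup>2" using yz(1) by (simp_all only: hyp_iff)
    have z: "fst z > 0" using yz(2) by (simp only: hyp_iff)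
    have "- minkowski y z \<le> 1 + c / 2" using qd_minkowski[OF yz] that(4) Hyperbolic by simp
    moreover have "snd y \<bullet> snd z \<le> norm (snd y) * fst z"
      using norm_cauchy_schwarz[of "snd y" "snd z"] hz(1) mult_left_mono[of "norm (snd z)" "fst z" "norm (snd y)"]
      by simp
    ultimately have 1: "fst z * (fst y - norm (snd y)) \<le> 1 + c / 2"
      by (simp add: minkowski_def algebra_simps)
    \<comment> \<open>The inverse of \<open>fst y - norm (snd y)\<close> is
      \<open>fst y + norm (snd y)\<close>, which is at most \<open>2 * b\<close>. This turns the
      preceding estimate into a bound on \<open>fst z\<close> in terms of \<open>b\<close> and
      \<open>c\<close>.\<close>
    have "(fst y - norm (snd y)) * (fst y + norm (snd y)) = 1"
      using y(2) by (simp add: power2_eq_square algebra_simps)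
    then have "fst z = fst z * (fst y - norm (snd y)) * (fst y + norm (snd y))" by (simp add: mult.assoc)
    also have "\<dots> \<le> (1 + c / 2) * (fst y + norm (snd y))"
      using 1 y(1) by (intro mult_right_mono) (auto intro: add_nonneg_nonneg)
    also have "\<dots> \<le> (1 + c / 2) * (2 * b)"
    proof (rule mult_left_mono)
      show "fst y + norm (snd y) \<le> 2 * b" using hy that(3) by simp
      have "qd K y z \<ge> 0" using that by (intro qd_nonneg)
      then show "0 \<le> 1 + c / 2" using that(4) by simp
    qed
    finally have "fst z \<le> 2 * b * (1 + c / 2)" by (simp add: mult.commute)
    then show ?thesis using hz(3) by linarith
  qed
  then show ?thesis by blast
qed

section \<open>Cones over the spaces and radial projection\<close>

lemma open_cone: "open (cone K)"
proof (cases K)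
  case Euclidean
  have "open {z :: real \<times> 'a. fst z > 0}" by (intro open_Collect_less continuous_intros)
  then show ?thesis using Euclidean by simp
next
  case Hyperbolic
  have "open {z :: real \<times> 'a. fst z > norm (snd z)}" by (intro open_Collect_less continuous_intros)
  then show ?thesis using Hyperbolic by simp
qed (simp add: open_Compl)

lemma cc_space_cone: "x \<in> cc_space K \<Longrightarrow> x \<in> cone K"
proof (cases K)
  case Hyperbolic
  then show "x \<in> cc_space K \<Longrightarrow> x \<in> cone K" using hyp_norm(1)[of x] by simp
qed auto

lemma cone_add:
  assumes "K \<noteq> Spherical" "x \<in> cone K" "y \<in> cone K" "b > 0"
  shows "x + b *\<^sub>R y \<in> cone K"
proof (cases K)
  case Hyperbolic
  have "norm (snd x + b *\<^sub>R snd y) \<le> norm (snd x) + b * norm (snd y)"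
    using norm_triangle_ineq[of "snd x" "b *\<^sub>R snd y"] assms by simp
  also have "\<dots> < fst x + b * fst y" using assms Hyperbolic by (intro add_strict_mono) auto
  finally show ?thesis using Hyperbolic by simp
qed (use assms in \<open>auto intro: add_pos_pos\<close>)

lemma cone_scale: "z \<in> cone K \<Longrightarrow> c > 0 \<Longrightarrow> c *\<^sub>R z \<in> cone K"
  by (cases K) auto

lemma nrm_pos: "z \<in> cone K \<Longrightarrow> nrm K z > 0"
  by (cases K) (auto simp: power_strict_mono)

lemma nrm_cc_space: "z \<in> cone K \<Longrightarrow> (1 / nrm K z) *\<^sub>R z \<in> cc_space K"
proof (cases K)
  case Hyperbolic
  assume z: "z \<in> cone K"
  have n: "nrm K z > 0" by (rule nrm_pos[OF z])
  have "norm (snd z) < fst z" using z Hyperbolic by simp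
  then have fz: "fst z > 0" by (meson le_less_trans norm_ge_zero)
  have "(nrm K z)\<^sup>2 = (fst z)\<^sup>2 - (norm (snd z))\<^sup>2"
    using z Hyperbolic by (simp add: power_mono)
  then have "(fst z / nrm K z)\<^sup>2 = 1 + (norm (snd z) / nrm K z)\<^sup>2"
    using n by (simp add: power_divide field_simps)
  then have "(1 / nrm K z) *\<^sub>R z \<in> cc_space Hyperbolic"
    unfolding hyp_iff using n fz by (simp add: power_divide)
  then show ?thesis using Hyperbolic by simp
qed auto

lemma nrm_1: "x \<in> cc_space K \<Longrightarrow> nrm K x = 1"
  by (cases K) (auto simp: minkowski_def norm_mult_norm power2_eq_square)

lemma nrm_continuous: "continuous_on (cone K) (nrm K)"
proof (cases K)
  case Spherical
  have "continuous_on (cone K) (\<lambda>z :: real \<times> 'a. norm z)" by (intro continuous_intros)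
  then show ?thesis using Spherical by (simp add: nrm.simps[abs_def])
next
  case Euclidean
  have "continuous_on (cone K) (\<lambda>z :: real \<times> 'a. fst z)" by (intro continuous_intros)
  then show ?thesis using Euclidean by (simp add: nrm.simps[abs_def])
next
  case Hyperbolic
  have "continuous_on (cone K) (\<lambda>z :: real \<times> 'a. sqrt ((fst z)\<^sup>2 - (norm (snd z))\<^sup>2))"
    by (intro continuous_intros)
  then show ?thesis using Hyperbolic by (simp add: nrm.simps[abs_def])
qed

text \<open>In \<open>qd K y z - qd K y w\<close> the terms quadratic in \<open>y\<close> cancel, so
  on the space the difference is given by a linear functional, which \<open>J\<close> sends to
  \<open>2 (w - z)\<close>. In the Euclidean case its first coordinate carries the constant
  term.\<close>

lemma bisector:
  assumes z: "z \<in> cc_space K" and w: "w \<in> cc_space K" and "z \<noteq> w"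
  obtains n c where "n \<bullet> Jm K n = 1" "c > 0" "\<And>y. y \<in> cc_space K \<Longrightarrow> qd K y z - qd K y w = c * (n \<bullet> y)"
    "reflect (Jm K) n z = w"
proof -
  have "\<exists>m. Jm K m = 2 *\<^sub>R (w - z) \<and> (\<forall>y\<in>cc_space K. m \<bullet> y = qd K y z - qd K y w)"
  proof (cases K)
    case Spherical
    have "(2 *\<^sub>R (w - z)) \<bullet> y = qd K y z - qd K y w" if "y \<in> cc_space K" for y
    proof -
      have "qd K y z = 2 - 2 * (y \<bullet> z)" "qd K y w = 2 - 2 * (y \<bullet> w)"
        using qd_sphere[of y z] qd_sphere[of y w] that z w Spherical by simp_all
      then show ?thesis by (simp add: inner_diff_right inner_diff_left inner_commute)
    qed
    then show ?thesis using Spherical by (intro exI[of _ "2 *\<^sub>R (w - z)"]) simp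
  next
    case Euclidean
    then show ?thesis using z w
      by (intro exI[of _ "((norm (snd z))\<^sup>2 - (norm (snd w))\<^sup>2, 2 *\<^sub>R (snd w - snd z))"])
        (auto simp: Jm_def qd_alt prod_eq_iff inner_prod_def power2_norm_eq_inner inner_diff_left
          inner_diff_right inner_commute algebra_simps)
  next
    case Hyperbolic
    have "Jm K (2 *\<^sub>R (w - z)) \<bullet> y = qd K y z - qd K y w" if "y \<in> cc_space K" for y
    proof -
      have "qd K y z = - 2 - 2 * minkowski y z" "qd K y w = - 2 - 2 * minkowski y w"
        using qd_minkowski[of y z] qd_minkowski[of y w] that z w Hyperbolic by simp_all
      then show ?thesis using Hyperbolic
        by (simp add: Jm_def minkowski_def inner_prod_def inner_diff_left inner_commute algebra_simps)
    qed
    then show ?thesis using Hyperbolic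
      by (intro exI[of _ "Jm K (2 *\<^sub>R (w - z))"]) (simp add: Jm_def prod_eq_iff)
  qed
  then obtain m where m: "Jm K m = 2 *\<^sub>R (w - z)" "\<And>y. y \<in> cc_space K \<Longrightarrow> m \<bullet> y = qd K y z - qd K y w"
    by blast
  define q where "q = qd K z w"
  have q: "q > 0" unfolding q_def using qd_nonneg[OF z w] qd_eq0[OF z w] assms(3) by simp
  have mz: "m \<bullet> z = - q" "m \<bullet> w = q" using m(2) z w by (simp_all add: q_def qd_sym)
  have mm: "m \<bullet> Jm K m = 4 * q" using mz by (simp add: m(1) inner_diff_right)
  define c where "c = sqrt (4 * q)"
  have c: "c > 0" "c * c = 4 * q" using q by (simp_all add: c_def)
  define n where "n = (1 / c) *\<^sub>R m"
  show thesis
  proof (rule that[of n c])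
    show "n \<bullet> Jm K n = 1" using c q by (simp add: n_def linear_scale[OF linear_Jm] mm)
    show "qd K y z - qd K y w = c * (n \<bullet> y)" if "y \<in> cc_space K" for y
      using m(2)[OF that] c by (simp add: n_def)
    have "reflect (Jm K) n z = z - (2 * (m \<bullet> z) / (c * c)) *\<^sub>R Jm K m"
      by (simp add: reflect_def n_def linear_scale[OF linear_Jm])
    also have "\<dots> = z + (1 / 2) *\<^sub>R Jm K m" using q by (simp add: c mz)
    also have "\<dots> = w" by (simp add: m(1))
    finally show "reflect (Jm K) n z = w" .
  qed (use c in auto)
qed

lemma hyperplane_functional:
  assumes "H \<in> hyperplanes K"
  obtains n where "n \<noteq> 0" "H = {x \<in> cc_space K. n \<bullet> x = 0}" "H \<noteq> {}"
proof -
  obtain V where V: "subspace V" "dim V = DIM('a)" "H = V \<inter> cc_space K" "H \<noteq> {}"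
    using assms by (auto simp: hyperplanes_def)
  have "dim V = DIM(real \<times> 'a) - 1" using V by simp
  then obtain a where a: "a \<noteq> 0" "span V = {x. a \<bullet> x = 0}" using dim_eq_hyperplane by blast
  then have "V = {x. a \<bullet> x = 0}" using V(1) span_eq_iff by blast
  then show thesis using that[of a] a V by blast
qed

text \<open>The section spans the hyperplane: from its point \<open>y\<close>, every direction
  \<open>v\<close> of the hyperplane can be followed a little within the open cone and projected
  back to the space.\<close>

lemma vanish_on_hyperplane:
  assumes y: "y \<in> cc_space K" "n \<bullet> y = 0" and "n \<noteq> 0"
    and m: "\<And>x. x \<in> cc_space K \<Longrightarrow> n \<bullet> x = 0 \<Longrightarrow> m \<bullet> x = 0"
  obtains c where "m = c *\<^sub>R n"
proof -
  have *: "m \<bullet> v = 0" if v: "n \<bullet> v = 0" for v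
  proof -
    obtain d where d: "d > 0" "ball y d \<subseteq> cone K"
      using open_cone cc_space_cone[OF y(1)] open_contains_ball by blast
    define e where "e = d / (norm v + 1)"
    have e: "e > 0" using d(1) by (simp add: e_def add_nonneg_pos)
    have "e * norm v < e * (norm v + 1)" using e by simp
    also have "\<dots> = d" by (simp add: e_def add_nonneg_eq_0_iff)
    finally have "y + e *\<^sub>R v \<in> ball y d" using e by (simp add: dist_norm)
    then have c: "y + e *\<^sub>R v \<in> cone K" using d by blast
    have "m \<bullet> ((1 / nrm K (y + e *\<^sub>R v)) *\<^sub>R (y + e *\<^sub>R v)) = 0"
      using y v by (intro m nrm_cc_space c) (simp add: inner_add_right)
    then have "m \<bullet> (y + e *\<^sub>R v) = 0" using nrm_pos[OF c] by simp
    then show ?thesis using m[OF y] e by (simp add: inner_add_right)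
  qed
  define c where "c = (m \<bullet> n) / (n \<bullet> n)"
  define v where "v = m - c *\<^sub>R n"
  have "n \<bullet> v = 0" using \<open>n \<noteq> 0\<close> by (simp add: v_def c_def inner_diff_right inner_commute)
  then have "v \<bullet> v = 0" using *[of v] by (simp add: v_def inner_diff_left)
  then have "m = c *\<^sub>R n" by (simp add: v_def)
  then show thesis using that by blast
qed

section \<open>Isometries and reflections\<close>

lemma isom_Bij: "g \<in> carrier (isom_group K) \<Longrightarrow> g \<in> Bij (cc_space K)"
  by (simp add: isom_group_def)

lemma isom_mem: "g \<in> carrier (isom_group K) \<Longrightarrow> x \<in> cc_space K \<Longrightarrow> g x \<in> cc_space K"
  using isom_Bij Bij_imp_funcset by blast

lemma isom_surj: "g \<in> carrier (isom_group K) \<Longrightarrow> g ` cc_space K = cc_space K"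
  using isom_Bij unfolding Bij_def bij_betw_def by blast

lemma isom_mult:
  assumes "g \<in> carrier (isom_group K)" "h \<in> carrier (isom_group K)" "x \<in> cc_space K"
  shows "(g \<otimes>\<^bsub>isom_group K\<^esub> h) x = g (h x)"
  using isom_Bij[OF assms(1)] isom_Bij[OF assms(2)] assms(3)
  by (simp add: isom_group_def BijGroup_def compose_eq)

lemma isom_one: "\<one>\<^bsub>isom_group K\<^esub> = (\<lambda>x\<in>cc_space K. x)"
  by (simp add: isom_group_def BijGroup_def)

lemma isom_eqI:
  assumes "g \<in> carrier (isom_group K)" "h \<in> carrier (isom_group K)"
    "\<And>x. x \<in> cc_space K \<Longrightarrow> g x = h x"
  shows "g = h"
  using assms isom_Bij Bij_imp_extensional extensionalityI by metis

lemma isom_inv: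
  assumes "g \<in> carrier (isom_group K)" "x \<in> cc_space K"
  shows "(inv\<^bsub>isom_group K\<^esub> g) (g x) = x" "g ((inv\<^bsub>isom_group K\<^esub> g) x) = x"
proof -
  interpret group "isom_group K" by (rule group_isom_group)
  have i: "inv\<^bsub>isom_group K\<^esub> g \<in> carrier (isom_group K)" using assms by simp
  show "(inv\<^bsub>isom_group K\<^esub> g) (g x) = x"
    using isom_mult[OF i assms(1,2)] l_inv[OF assms(1)] assms(2) by (simp add: isom_one)
  show "g ((inv\<^bsub>isom_group K\<^esub> g) x) = x"
    using isom_mult[OF assms(1) i assms(2)] r_inv[OF assms(1)] assms(2) by (simp add: isom_one)
qed

lemma isom_qd:
  assumes "g \<in> carrier (isom_group K)" "x \<in> cc_space K" "y \<in> cc_space K"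
  shows "qd K (g x) (g y) = qd K x y"
proof (rule cc_dist_qd)
  show "cc_dist K (g x) (g y) = cc_dist K x y" using assms by (simp add: isom_group_def)
qed (auto intro: assms isom_mem[OF assms(1)])

text \<open>If \<open>r\<close> moves \<open>z\<close>, every fixed point of \<open>r\<close> is
  equidistant from \<open>z\<close> and \<open>r z\<close>, so the hyperplane lies in their
  bisector. Its normalised functional is thus determined up to sign, whichever moved point is
  used.\<close>

lemma reflection_form:
  fixes r :: "real \<times> 'a::euclidean_space \<Rightarrow> real \<times> 'a"
  assumes "is_reflection K H r"
  obtains n where "n \<bullet> Jm K n = 1" "H = {x \<in> cc_space K. n \<bullet> x = 0}" "H \<noteq> {}"
    "\<And>x. x \<in> cc_space K \<Longrightarrow> r x = reflect (Jm K) n x"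
proof -
  have r: "r \<in> carrier (isom_group K)" "r \<noteq> \<one>\<^bsub>isom_group K\<^esub>" "\<And>x. x \<in> H \<Longrightarrow> r x = x"
    and H: "H \<in> hyperplanes K"
    using assms by (auto simp: is_reflection_def)
  obtain n0 where n0: "n0 \<noteq> 0" "H = {x \<in> cc_space K. n0 \<bullet> x = 0}" "H \<noteq> {}"
    using hyperplane_functional[OF H] by blast
  then obtain y where y: "y \<in> cc_space K" "n0 \<bullet> y = 0" by blast
  interpret group "isom_group K" by (rule group_isom_group)
  obtain z1 where z1: "z1 \<in> cc_space K" "r z1 \<noteq> z1"
    using isom_eqI[OF r(1) one_closed] r(2) by (auto simp: isom_one)
  have vanish: "qd K x z = qd K x (r z)" if "x \<in> H" "z \<in> cc_space K" for x z
    using isom_qd[OF r(1), of x z] r(3)[OF that(1)] that n0 by simp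
  have bis: "\<exists>n c. n \<bullet> Jm K n = 1 \<and> n = c *\<^sub>R n0 \<and> reflect (Jm K) n z = r z \<and>
      (\<forall>x\<in>cc_space K. n \<bullet> x = 0 \<longleftrightarrow> qd K x z = qd K x (r z))"
    if z: "z \<in> cc_space K" "r z \<noteq> z" for z
  proof -
    obtain n c where n: "n \<bullet> Jm K n = 1" "c > 0"
      "\<And>x. x \<in> cc_space K \<Longrightarrow> qd K x z - qd K x (r z) = c * (n \<bullet> x)" "reflect (Jm K) n z = r z"
      using bisector[OF z(1) isom_mem[OF r(1) z(1)]] z(2) by metis
    have "n \<bullet> x = 0" if "x \<in> cc_space K" "n0 \<bullet> x = 0" for x
      using n(3)[OF that(1)] vanish[of x z] n0(2) that z n(2) by simp
    then obtain d where "n = d *\<^sub>R n0" using vanish_on_hyperplane[OF y n0(1)] by metis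
    moreover have "n \<bullet> x = 0 \<longleftrightarrow> qd K x z = qd K x (r z)" if "x \<in> cc_space K" for x
      using n(3)[OF that] n(2) by (metis eq_iff_diff_eq_0 mult_eq_0_iff less_irrefl)
    ultimately show ?thesis using n by blast
  qed
  obtain n c where n: "n \<bullet> Jm K n = 1" "n = c *\<^sub>R n0" "reflect (Jm K) n z1 = r z1"
    "\<And>x. x \<in> cc_space K \<Longrightarrow> n \<bullet> x = 0 \<longleftrightarrow> qd K x z1 = qd K x (r z1)"
    using bis[OF z1] by blast
  have "c \<noteq> 0" using n(1,2) by auto
  then have Hn: "H = {x \<in> cc_space K. n \<bullet> x = 0}" using n0(2) n(2) by auto
  show thesis
  proof (rule that[of n])
    fix x :: "real \<times> 'a" assume x: "x \<in> cc_space K"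
    show "r x = reflect (Jm K) n x"
    proof (cases "n \<bullet> x = 0")
      case True
      then show ?thesis using r(3) x Hn by simp
    next
      case False
      \<comment> \<open>Off the hyperplane \<open>r\<close> moves every point, since a fixed point
        is equidistant from \<open>z1\<close> and \<open>r z1\<close> and hence a zero of
        \<open>n\<close>.\<close>
      then have "qd K x z1 \<noteq> qd K x (r z1)" using n(4)[OF x] by simp
      then have "r x \<noteq> x" using isom_qd[OF r(1) x z1(1)] by auto
      then obtain m d where m: "m \<bullet> Jm K m = 1" "m = d *\<^sub>R n0" "reflect (Jm K) m x = r x"
        using bis[OF x] by blast
      have "c * c * (n0 \<bullet> Jm K n0) = 1" "d * d * (n0 \<bullet> Jm K n0) = 1"
        using n(1,2) m(1,2) by (simp_all add: linear_scale[OF linear_Jm])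
      then have "c * c = d * d" by (metis mult_cancel_right mult_zero_right zero_neq_one)
      then have "m = n \<or> m = - n" using n(2) m(2) by (metis scaleR_minus_left square_eq_iff)
      then show ?thesis using m(3) reflect_uminus[OF linear_Jm, of K n] by metis
    qed
  qed (use n(1) Hn n0(3) in auto)
qed

text \<open>A basic neighbourhood of the identity constrains the images of finitely many points
  only. Elements that keep \<open>y\<close> in a bounded region map these points into compact balls.
  Once the balls are cut into finitely many small cells, two elements with images in the same cells
  differ by an element of the neighbourhood, hence coincide.\<close>

lemma finite_bounded_elements:
  fixes W :: "(real \<times> 'a::euclidean_space \<Rightarrow> real \<times> 'a) set"
  assumes W: "subgroup W (isom_group K)" and "discrete W" and y: "y \<in> cc_space K"
  shows "finite {w \<in> W. norm (w y) \<le> b}"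
proof -
  let ?X = "cc_space K :: (real \<times> 'a) set" and ?e = "\<one>\<^bsub>isom_group K\<^esub>"
  interpret group "isom_group K" by (rule group_isom_group)
  interpret W: subgroup W "isom_group K" by (rule W)
  have "?e isolated_in W" using assms(2) W.one_closed unfolding discrete_def by blast
  then obtain U where U: "open U" "U \<inter> W = {?e}" unfolding isolated_in_def by blast
  then have "openin (product_topology (\<lambda>i. euclidean) UNIV) U" "?e \<in> U" by (auto simp: open_fun_def)
  from product_topology_open_contains_basis[OF this]
  obtain B where B: "?e \<in> PiE UNIV B" "\<And>i. open (B i)" "finite {i. B i \<noteq> UNIV}" "PiE UNIV B \<subseteq> U"
    by auto
  define F where "F = {i \<in> ?X. B i \<noteq> UNIV}"
  have finF: "finite F" unfolding F_def by (rule finite_subset[OF _ B(3)]) auto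
  have FX: "F \<subseteq> ?X" by (auto simp: F_def)
  \<comment> \<open>Outside the space all elements of \<open>W\<close>, the identity included, are
    \<open>undefined\<close>, so the coordinates there are met trivially.\<close>
  have triv: "w = ?e" if w: "w \<in> W" "\<And>i. i \<in> F \<Longrightarrow> w i \<in> B i" for w
  proof -
    have "w i \<in> B i" for i
    proof (cases "i \<in> ?X")
      case True
      then show ?thesis using w(2)[of i] by (cases "B i = UNIV") (auto simp: F_def)
    next
      case False
      have "w i = ?e i"
        using extensional_arb[OF Bij_imp_extensional[OF isom_Bij[OF W.mem_carrier[OF w(1)]]] False] False
        by (simp add: isom_one)
      then show ?thesis using B(1) by auto
    qed
    then have "w \<in> U" using B(4) by (auto simp: PiE_def)
    then show ?thesis using U w by blast
  qed
  \<comment> \<open>Neighbourhoods are rephrased through \<open>qd\<close>, which isometries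
    preserve, so that the test for triviality can be translated by a group element.\<close>
  have "\<exists>d>0. \<forall>z\<in>?X. qd K i z < d \<longrightarrow> z \<in> B i" if i: "i \<in> F" for i
  proof -
    have iX: "i \<in> ?X" using i FX by blast
    have "?e i = i" using iX by (simp add: isom_one)
    then have "i \<in> B i" using B(1) by (metis PiE_mem UNIV_I)
    obtain b' where b': "\<And>z. z \<in> ?X \<Longrightarrow> qd K i z \<le> 1 \<Longrightarrow> norm z \<le> b'"
      using qd_bdd[of K "norm i" 1] iX by blast
    let ?C = "?X \<inter> cball 0 b' - B i"
    have C: "compact ?C" using closed_cc_space B(2) by (intro compact_diff closed_Int_compact) auto
    have c: "continuous_on ?C (qd K i)" unfolding qd_alt by (intro continuous_intros)
    show ?thesis
    proof (cases "?C = {}")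
      case True
      have "z \<in> B i" if "z \<in> ?X" "qd K i z < 1" for z using True b'[of z] that by auto
      then show ?thesis using zero_less_one by blast
    next
      case False
      obtain w where w: "w \<in> ?C" "\<And>z. z \<in> ?C \<Longrightarrow> qd K i w \<le> qd K i z"
        using continuous_attains_inf[OF C False c] by blast
      have "w \<noteq> i" using w(1) \<open>i \<in> B i\<close> by auto
      then have "qd K i w > 0" using qd_nonneg[of i K w] qd_eq0[of i K w] iX w(1) by force
      moreover have "z \<in> B i" if "z \<in> ?X" "qd K i z < min 1 (qd K i w)" for z
        using b'[of z] w(2)[of z] that by force
      ultimately show ?thesis by (intro exI[of _ "min 1 (qd K i w)"]) auto
    qed
  qed
  then obtain d where d: "\<And>i. i \<in> F \<Longrightarrow> d i > 0" "\<And>i z. i \<in> F \<Longrightarrow> z \<in> ?X \<Longrightarrow> qd K i z < d i \<Longrightarrow> z \<in> B i"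
    by metis
  have eq: "w = w'" if w: "w \<in> W" "w' \<in> W" "\<And>i. i \<in> F \<Longrightarrow> qd K (w' i) (w i) < d i" for w w'
  proof -
    let ?i = "inv\<^bsub>isom_group K\<^esub> w'"
    have c: "w \<in> carrier (isom_group K)" "w' \<in> carrier (isom_group K)" "?i \<in> carrier (isom_group K)"
      using w W.mem_carrier by auto
    have "?i \<otimes>\<^bsub>isom_group K\<^esub> w = ?e"
    proof (rule triv)
      show "?i \<otimes>\<^bsub>isom_group K\<^esub> w \<in> W" using w by simp
      fix i assume i: "i \<in> F"
      have iX: "i \<in> ?X" using i FX by blast
      have "qd K i ((?i \<otimes>\<^bsub>isom_group K\<^esub> w) i) = qd K (?i (w' i)) (?i (w i))"
        using c iX by (simp add: isom_mult isom_inv)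
      also have "\<dots> = qd K (w' i) (w i)" using c iX by (simp add: isom_qd isom_mem)
      finally have "qd K i ((?i \<otimes>\<^bsub>isom_group K\<^esub> w) i) < d i" using w(3)[OF i] by simp
      then show "(?i \<otimes>\<^bsub>isom_group K\<^esub> w) i \<in> B i"
        using c iX i by (intro d(2)) (auto simp: isom_mult isom_mem)
    qed
    then show ?thesis using c by (metis inv_equality inv_inv)
  qed
  have "\<forall>i\<in>F. \<exists>P. finite P \<and> (\<forall>w\<in>{w \<in> W. norm (w y) \<le> b}. \<exists>C\<in>P. w i \<in> C) \<and>
      (\<forall>C\<in>P. \<forall>z\<in>C. \<forall>z'\<in>C. qd K z z' < d i)"
  proof
    fix i assume i: "i \<in> F"
    have iX: "i \<in> ?X" using i FX by blast
    obtain b' where b': "\<And>x z. x \<in> ?X \<Longrightarrow> z \<in> ?X \<Longrightarrow> norm x \<le> b \<Longrightarrow> qd K x z \<le> qd K y i \<Longrightarrow> norm z \<le> b'"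
      using qd_bdd[of K b "qd K y i"] by blast
    have "uniformly_continuous_on (cball (0 :: real \<times> 'a) b' \<times> cball 0 b') (\<lambda>z. qd K (fst z) (snd z))"
      by (intro compact_uniformly_continuous continuous_on_subset[OF qd_continuous] compact_Times) auto
    then obtain \<eta> where \<eta>: "\<eta> > 0" "\<And>z z'. z \<in> cball (0 :: real \<times> 'a) b' \<times> cball 0 b' \<Longrightarrow> z' \<in> cball 0 b' \<times> cball 0 b' \<Longrightarrow>
        dist z' z < \<eta> \<Longrightarrow> dist (qd K (fst z') (snd z')) (qd K (fst z) (snd z)) < d i"
      using d(1)[OF i] unfolding uniformly_continuous_on_def by metis
    have "\<exists>k. finite k \<and> cball (0 :: real \<times> 'a) b' \<subseteq> (\<Union>x\<in>k. ball x (\<eta> / 2))"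
      using compact_eq_totally_bounded[of "cball (0 :: real \<times> 'a) b'"] \<eta>(1) compact_cball half_gt_zero
      by blast
    then obtain k where k: "finite k" "cball (0 :: real \<times> 'a) b' \<subseteq> (\<Union>x\<in>k. ball x (\<eta> / 2))"
      by blast
    have "qd K z z' < d i" if z: "z \<in> cball 0 b' \<inter> ball x (\<eta> / 2)" "z' \<in> cball 0 b' \<inter> ball x (\<eta> / 2)" for x z z' :: "real \<times> 'a"
    proof -
      have "dist z z' < \<eta>"
        by (rule dist_triangle_half_r[of x]) (use z in auto)
      then have "dist (z, z') (z, z) < \<eta>" by (simp add: dist_Pair_Pair dist_commute)
      then have "dist (qd K z z') (qd K z z) < d i" using \<eta>(2)[of "(z, z)" "(z, z')"] z by simp
      then show ?thesis by (simp add: dist_real_def)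
    qed
    moreover have "\<exists>C\<in>(\<lambda>x. cball 0 b' \<inter> ball x (\<eta> / 2)) ` k. w i \<in> C" if w: "w \<in> W" "norm (w y) \<le> b" for w
    proof -
      have c: "w \<in> carrier (isom_group K)" using w W.mem_carrier by auto
      have "norm (w i) \<le> b'"
        using w(2) isom_qd[OF c y iX] by (intro b'[of "w y"]) (auto intro: isom_mem c y iX)
      then have "w i \<in> cball 0 b'" by simp
      then have "w i \<in> (\<Union>x\<in>k. ball x (\<eta> / 2))" using k(2) by (rule subsetD[rotated])
      then obtain x where "x \<in> k" "w i \<in> ball x (\<eta> / 2)" by (rule UN_E)
      then show ?thesis using \<open>w i \<in> cball 0 b'\<close> by (intro bexI[of _ "cball 0 b' \<inter> ball x (\<eta> / 2)"]) auto
    qed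
    ultimately show "\<exists>P. finite P \<and> (\<forall>w\<in>{w \<in> W. norm (w y) \<le> b}. \<exists>C\<in>P. w i \<in> C) \<and>
      (\<forall>C\<in>P. \<forall>z\<in>C. \<forall>z'\<in>C. qd K z z' < d i)"
      using k(1) by (intro exI[of _ "(\<lambda>x. cball 0 b' \<inter> ball x (\<eta> / 2)) ` k"]) auto
  qed
  from bchoice[OF this] obtain P where P': "\<forall>i\<in>F. finite (P i) \<and>
      (\<forall>w\<in>{w \<in> W. norm (w y) \<le> b}. \<exists>C\<in>P i. w i \<in> C) \<and> (\<forall>C\<in>P i. \<forall>z\<in>C. \<forall>z'\<in>C. qd K z z' < d i)"
    by (rule exE)
  then have P: "\<And>i. i \<in> F \<Longrightarrow> finite (P i)"
    "\<And>i w. i \<in> F \<Longrightarrow> w \<in> {w \<in> W. norm (w y) \<le> b} \<Longrightarrow> \<exists>C\<in>P i. w i \<in> C"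
    "\<And>i C z z'. i \<in> F \<Longrightarrow> C \<in> P i \<Longrightarrow> z \<in> C \<Longrightarrow> z' \<in> C \<Longrightarrow> qd K z z' < d i"
    by auto
  \<comment> \<open>Records for each point of \<open>F\<close> a cell that contains its image; only
    finitely many records exist.\<close>
  define \<Phi> where "\<Phi> = (\<lambda>w. \<lambda>i\<in>F. SOME C. C \<in> P i \<and> w i \<in> C)"
  have \<Phi>: "\<Phi> w i \<in> P i \<and> w i \<in> \<Phi> w i" if "i \<in> F" "w \<in> {w \<in> W. norm (w y) \<le> b}" for w i
  proof -
    have "\<exists>C. C \<in> P i \<and> w i \<in> C" using P(2)[OF that] by blast
    from someI_ex[OF this] show ?thesis using that by (simp add: \<Phi>_def)
  qed
  have "\<Phi> ` {w \<in> W. norm (w y) \<le> b} \<subseteq> PiE F P"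
    by (intro image_subsetI PiE_I) (use \<Phi> in blast, simp add: \<Phi>_def)
  then have "finite (\<Phi> ` {w \<in> W. norm (w y) \<le> b})"
    by (rule finite_subset) (rule finite_PiE[OF finF P(1)])
  moreover have "inj_on \<Phi> {w \<in> W. norm (w y) \<le> b}"
  proof (rule inj_onI)
    fix w w' assume w: "w \<in> {w \<in> W. norm (w y) \<le> b}" "w' \<in> {w \<in> W. norm (w y) \<le> b}" "\<Phi> w = \<Phi> w'"
    have "qd K (w' i) (w i) < d i" if "i \<in> F" for i
      using \<Phi>[OF that w(1)] \<Phi>[OF that w(2)] w(3) by (intro P(3)[OF that, of "\<Phi> w i"]) auto
    then show "w = w'" using w by (intro eq) auto
  qed
  ultimately show ?thesis by (rule finite_imageD)
qed

text \<open>Makes an isometry composable with words. In the hyperbolic case the extension is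
  prescribed on a basis taken from the space. At any other point \<open>x\<close>,
  \<open>g x - h x\<close> is Minkowski-orthogonal to the image of \<open>g\<close>, which is the
  whole space, and no nonzero vector is.\<close>

lemma isom_linear:
  fixes g :: "real \<times> 'a::euclidean_space \<Rightarrow> real \<times> 'a"
  assumes g: "g \<in> carrier (isom_group K)"
  obtains h where "linear h" "\<And>x. x \<in> cc_space K \<Longrightarrow> h x = g x"
proof (cases K)
  case Spherical
  have "\<exists>h. orthogonal_transformation h \<and> (\<forall>x. norm x = 1 \<longrightarrow> h x = g x)"
  proof (rule isometry_sphere_extend)
    show "norm (g x) = 1" if "norm x = 1" for x using isom_mem[OF g, of x] that Spherical by simp
    show "dist (g x) (g y) = dist x y" if "norm x = 1" "norm y = 1" for x y
      using isom_qd[OF g, of x y] that Spherical by (simp add: qd_def dist_norm norm_eq)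
  qed
  then show thesis using that Spherical orthogonal_transformation_linear by auto
next
  case Euclidean
  define f where "f = (\<lambda>v. snd (g (1, v)))"
  have g1: "g (1, v) = (1, f v)" for v
    using isom_mem[OF g, of "(1, v)"] Euclidean by (simp add: f_def prod_eq_iff)
  have "dist (f v) (f w) = dist v w" for v w
  proof -
    have "(norm (f v - f w))\<^sup>2 = (norm (v - w))\<^sup>2"
      using isom_qd[OF g, of "(1, v)" "(1, w)"] Euclidean by (simp add: qd_alt g1)
    then show ?thesis by (simp add: dist_norm)
  qed
  then have "orthogonal_transformation (\<lambda>v. f v - f 0)"
    by (simp add: orthogonal_transformation_isometry dist_norm)
  then have l: "linear (\<lambda>v. f v - f 0)" by (rule orthogonal_transformation_linear)
  show thesis
  proof (rule that)
    show "linear (\<lambda>z. (fst z, fst z *\<^sub>R f 0 + (\<lambda>v. f v - f 0) (snd z)))"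
      by (rule linearI) (use linear_add[OF l] linear_scale[OF l] in \<open>auto simp: algebra_simps\<close>)
    fix x :: "real \<times> 'a" assume "x \<in> cc_space K"
    then have 1: "fst x = 1" using Euclidean by simp
    then have "x = (1, snd x)" by (simp add: prod_eq_iff)
    then have "g x = (1, f (snd x))" using g1[of "snd x"] by metis
    then show "(fst x, fst x *\<^sub>R f 0 + (\<lambda>v. f v - f 0) (snd x)) = g x" using 1 by simp
  qed
next
  case Hyperbolic
  let ?X = "cc_space K :: (real \<times> 'a) set"
  obtain B where B: "B \<subseteq> ?X" "independent B" "?X \<subseteq> span B"
    by (rule maximal_independent_subset)
  obtain h where h: "linear h" "\<And>b. b \<in> B \<Longrightarrow> h b = g b"
    using linear_independent_extend[OF B(2), of g] by blast
  have mink: "minkowski (g x) (g y) = minkowski x y" if "x \<in> ?X" "y \<in> ?X" for x y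
    using isom_qd[OF g that] qd_minkowski[of x y] qd_minkowski[of "g x" "g y"] that Hyperbolic
      isom_mem[OF g] by simp
  have ml: "linear (\<lambda>v. minkowski (f v) y)" if "linear f" for f :: "real \<times> 'a \<Rightarrow> real \<times> 'a" and y
    by (rule linearI)
      (auto simp: minkowski_def linear_add[OF that] linear_scale[OF that] inner_add_left algebra_simps)
  have "h x = g x" if x: "x \<in> ?X" for x
  proof -
    define d where "d = g x - h x"
    have hx: "minkowski (h x) (g y) = minkowski x y" if y: "y \<in> ?X" for y
    proof (rule linear_eq_on_span[OF ml[OF h(1)] ml[OF linear_id, unfolded id_apply]])
      show "x \<in> span B" using x B by blast
      show "minkowski (h b) (g y) = minkowski b y" if "b \<in> B" for b
        using h(2)[OF that] mink[of b y] that B(1) y by auto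
    qed
    have "minkowski d (g y) = 0" if "y \<in> ?X" for y
    proof -
      have "minkowski d (g y) = minkowski (g x) (g y) - minkowski (h x) (g y)"
        by (simp add: d_def minkowski_def inner_diff_left algebra_simps)
      then show ?thesis using that mink[OF x that] hx by simp
    qed
    then have md: "minkowski d y = 0" if "y \<in> ?X" for y
      using isom_surj[OF g] that by (metis imageE)
    have Jd: "Jm K d \<bullet> y = 0" if "y \<in> ?X" for y
      using md[OF that] Hyperbolic by (simp add: minkowski_def Jm_def inner_prod_def)
    have "Jm K d = 0"
    proof (rule ccontr)
      assume "Jm K d \<noteq> 0"
      moreover have "cone K \<noteq> ({} :: (real \<times> 'a) set)" using x cc_space_cone by blast
      ultimately obtain z where z: "z \<in> cone K" "Jm K d \<bullet> z \<noteq> 0"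
        using open_avoid_hyperplanes[OF open_cone[of K], of "{Jm K d}"] by auto
      then show False using Jd[OF nrm_cc_space[OF z(1)]] nrm_pos[OF z(1)] by simp
    qed
    then show ?thesis using Hyperbolic by (simp add: Jm_def d_def prod_eq_iff)
  qed
  then show thesis using that h(1) by blast
qed

section \<open>Discrete reflection groups\<close>

lemma nrm_scale: "c > 0 \<Longrightarrow> nrm K (c *\<^sub>R z) = c * nrm K z"
  by (cases K) (auto simp: power_mult_distrib real_sqrt_mult simp flip: right_diff_distrib)

lemma convex_cone:
  assumes "K \<noteq> Spherical"
  shows "convex (cone K)"
proof (rule convexI)
  fix x y :: "real \<times> 'a" and u v :: real
  assume xy: "x \<in> cone K" "y \<in> cone K" and uv: "0 \<le> u" "0 \<le> v" "u + v = 1"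
  show "u *\<^sub>R x + v *\<^sub>R y \<in> cone K"
  proof (cases "u = 0 \<or> v = 0")
    case True
    then show ?thesis using xy uv by auto
  next
    case False
    then show ?thesis using xy uv assms by (intro cone_add cone_scale) auto
  qed
qed

text \<open>Supplies a positive definite inner product in which reflections fixing \<open>x\<close>
  are orthogonal. Euclidean: \<open>A\<close> translates \<open>x\<close> to \<open>(1, 0)\<close>
  on the slice. Hyperbolic: \<open>A\<close> is a Lorentz map taking \<open>x\<close> to
  \<open>(1, 0)\<close>. On the space \<open>norm (A y)\<close> depends on \<open>qd K x y\<close>
  only, so isometries fixing \<open>x\<close> preserve it.\<close>

lemma tangent_form:
  fixes x :: "real \<times> 'a::euclidean_space"
  assumes K: "K \<noteq> Spherical" and x: "x \<in> cc_space K"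
  shows "\<exists>A. linear A \<and> inj A \<and> (\<forall>n z. n \<bullet> x = 0 \<longrightarrow> A (Jm K n) \<bullet> A z = n \<bullet> z) \<and>
    (\<forall>y\<in>cc_space K. \<forall>y'\<in>cc_space K. qd K x y = qd K x y' \<longrightarrow>
       norm (A y) = norm (A y') \<and> A x \<bullet> A y = A x \<bullet> (A y' :: real \<times> 'a))"
proof (cases K)
  case Euclidean
  define A where "A = (\<lambda>z :: real \<times> 'a. (fst z, snd z - fst z *\<^sub>R snd x))"
  have fx: "fst x = 1" using x Euclidean by simp
  show ?thesis
  proof (intro exI[of _ A] conjI allI ballI impI)
    show l: "linear A" by (rule linearI) (auto simp: A_def algebra_simps)
    show "inj A" by (subst linear_injective_0[OF l]) (auto simp: A_def prod_eq_iff)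
    show "A (Jm K n) \<bullet> A z = n \<bullet> z" if "n \<bullet> x = 0" for n z
    proof -
      have "fst n = - (snd n \<bullet> snd x)" using that fx by (simp add: inner_prod_def)
      then show ?thesis using Euclidean
        by (simp add: A_def Jm_def inner_prod_def inner_diff_left inner_diff_right)
    qed
    fix y y' assume y: "y \<in> cc_space K" "y' \<in> cc_space K" "qd K x y = qd K x y'"
    have "(norm (snd x - snd y))\<^sup>2 = (norm (snd x - snd y'))\<^sup>2" using y Euclidean by (simp add: qd_alt)
    then have "norm (snd y - snd x) = norm (snd y' - snd x)" by (simp add: norm_minus_commute)
    then show "norm (A y) = norm (A y')" using y Euclidean by (simp add: A_def norm_prod_def)
    show "A x \<bullet> A y = A x \<bullet> A y'" using y fx Euclidean by (simp add: A_def inner_prod_def)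
  qed
next
  case Hyperbolic
  define e0 :: "real \<times> 'a" where "e0 = (1, 0)"
  have JJ: "Jm K (Jm K z) = z" for z :: "real \<times> 'a" using Hyperbolic by (simp add: Jm_def)
  have e0: "e0 \<in> cc_space K" using Hyperbolic by (simp add: e0_def minkowski_def)
  have "\<exists>A. linear A \<and> (\<forall>z. A (A z) = z) \<and> A x = e0 \<and> (\<forall>z w. A z \<bullet> Jm K (A w) = z \<bullet> Jm K w)"
  proof (cases "x = e0")
    case True
    then show ?thesis by (intro exI[of _ id]) (auto simp: linear_id)
  next
    case False
    obtain n c where n: "n \<bullet> Jm K n = 1" "reflect (Jm K) n x = e0"
      using bisector[OF x e0 False] by metis
    have "reflect (Jm K) n z \<bullet> Jm K (reflect (Jm K) n w) = z \<bullet> Jm K w" for z w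
      using n(1) Jm_sym[of n K w] Jm_sym[of "Jm K n" K w]
      by (simp add: reflect_def linear_diff[OF linear_Jm] linear_scale[OF linear_Jm] JJ
          inner_diff_left inner_diff_right inner_commute algebra_simps)
    then show ?thesis using n linear_reflect[of "Jm K" n] reflect_reflect[where J = "Jm K", OF n(1)]
      by (intro exI[of _ "reflect (Jm K) n"]) auto
  qed
  then obtain A where A: "linear A" "\<And>z. A (A z) = z" "A x = e0" "\<And>z w. A z \<bullet> Jm K (A w) = z \<bullet> Jm K w"
    by blast
  have fA: "fst (A z) = - (x \<bullet> Jm K z)" for z
    using A(4)[of x z] Hyperbolic by (simp add: A(3) e0_def Jm_def inner_prod_def)
  \<comment> \<open>The time coordinate of \<open>A z\<close> is
    \<open>- (x \<bullet> Jm K z)\<close>; adding twice the product of the time coordinates turns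
    the Lorentz form into the standard inner product.\<close>
  have inner_A: "A z \<bullet> A w = z \<bullet> Jm K w + 2 * (x \<bullet> Jm K z) * (x \<bullet> Jm K w)" for z w
  proof -
    have "A z \<bullet> A w = A z \<bullet> Jm K (A w) + 2 * fst (A z) * fst (A w)"
      using Hyperbolic by (simp add: Jm_def inner_prod_def)
    then show ?thesis by (simp add: A(4) fA)
  qed
  show ?thesis
  proof (intro exI[of _ A] conjI allI ballI impI)
    show "linear A" by fact
    show "inj A" by (rule inj_on_inverseI[of _ A]) (rule A(2))
    show "A (Jm K n) \<bullet> A z = n \<bullet> z" if "n \<bullet> x = 0" for n z
      using that Jm_sym[of "Jm K n" K z] by (simp add: inner_A JJ inner_commute)
    fix y y' assume y: "y \<in> cc_space K" "y' \<in> cc_space K" "qd K x y = qd K x y'"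
    have "minkowski x y = minkowski x y'"
      using y qd_minkowski[of x y] qd_minkowski[of x y'] x Hyperbolic by simp
    then have 1: "x \<bullet> Jm K y = x \<bullet> Jm K y'"
      using Hyperbolic by (simp add: Jm_def inner_prod_def minkowski_def)
    have "y \<bullet> Jm K y = -1" "y' \<bullet> Jm K y' = -1"
      using y Hyperbolic by (simp_all add: Jm_def inner_prod_def minkowski_def)
    then show "norm (A y) = norm (A y')" by (simp add: norm_eq inner_A 1)
    show "A x \<bullet> A y = A x \<bullet> A y'" by (simp add: inner_A 1)
  qed
qed (use K in simp)

text \<open>Expresses an arbitrary vector through \<open>x\<close> and one more point of the space,
  so that facts about linear maps fixing \<open>x\<close> pass from the space to all
  vectors.\<close>

lemma cone_decomposition:
  fixes x z :: "real \<times> 'a::euclidean_space"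
  assumes x: "x \<in> cc_space K"
  obtains e t y where "e > 0" "t > 0" "y \<in> cc_space K" "z = (1 / e) *\<^sub>R (t *\<^sub>R y - x)"
proof -
  obtain d where d: "d > 0" "ball x d \<subseteq> cone K"
    using open_cone cc_space_cone[OF x] open_contains_ball by blast
  define e where "e = d / (norm z + 1)"
  have e: "e > 0" using d(1) by (simp add: e_def add_nonneg_pos)
  have "e * norm z < e * (norm z + 1)" using e by simp
  also have "\<dots> = d" by (simp add: e_def add_nonneg_eq_0_iff)
  finally have "x + e *\<^sub>R z \<in> ball x d" using e by (simp add: dist_norm)
  then have c: "x + e *\<^sub>R z \<in> cone K" using d by blast
  define t where "t = nrm K (x + e *\<^sub>R z)"
  have t: "t > 0" unfolding t_def by (rule nrm_pos[OF c])
  define y where "y = (1 / t) *\<^sub>R (x + e *\<^sub>R z)"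
  have "y \<in> cc_space K" unfolding y_def t_def by (rule nrm_cc_space[OF c])
  moreover have "z = (1 / e) *\<^sub>R (t *\<^sub>R y - x)" using e t by (simp add: y_def)
  ultimately show thesis using that e t by blast
qed

text \<open>The base point \<open>p\<close> singles out a chamber. For the trivial group on the
  sphere the chamber is the whole sphere, on which the antipodal map has no fixed point;
  \<open>nontrivial\<close> excludes this.\<close>

locale reflection_group =
  fixes K :: geometry and W :: "(real \<times> 'a::euclidean_space \<Rightarrow> real \<times> 'a) set" and p :: "real \<times> 'a"
  assumes W: "discrete_reflection_group K W"
    and p: "p \<in> cc_space K" "p \<notin> \<Union>(mirrors K W)"
    and nontrivial: "K = Spherical \<Longrightarrow> W \<noteq> {\<one>\<^bsub>isom_group K\<^esub>}"
begin

abbreviation X where "X \<equiv> cc_space K :: (real \<times> 'a) set"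

abbreviation J where "J \<equiv> Jm K :: real \<times> 'a \<Rightarrow> real \<times> 'a"

definition N where
  "N = {n. n \<bullet> J n = 1 \<and> n \<bullet> p > 0 \<and> (\<exists>x\<in>X. n \<bullet> x = 0) \<and> restrict (reflect J n) X \<in> W}"

definition C where "C = {x \<in> X. \<forall>n\<in>N. n \<bullet> x > 0}"

lemma N_unit: "n \<in> N \<Longrightarrow> n \<bullet> J n = 1"
  and N_pos: "n \<in> N \<Longrightarrow> n \<bullet> p > 0"
  by (auto simp: N_def)

lemma W_generate: "\<exists>R \<subseteq> {r. \<exists>H. is_reflection K H r}. W = generate (isom_group K) R"
  and W_discrete: "discrete W"
  using W by (auto simp: discrete_reflection_group_def)

lemma W_subgroup: "subgroup W (isom_group K)"
proof -
  obtain R where R: "R \<subseteq> {r. \<exists>H. is_reflection K H r}" "W = generate (isom_group K) R"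
    using W_generate by blast
  have "R \<subseteq> carrier (isom_group K)" using R(1) by (auto simp: is_reflection_def)
  then show ?thesis using group.generate_is_subgroup[OF group_isom_group] R(2) by metis
qed

lemma W_carrier: "w \<in> W \<Longrightarrow> w \<in> carrier (isom_group K)"
  by (rule subgroup.mem_carrier[OF W_subgroup])

lemma word_X: "set ns \<subseteq> N \<Longrightarrow> x \<in> X \<Longrightarrow> act J ns x \<in> X"
proof (induction ns)
  case (Cons n ns)
  then have "n \<in> N" "act J ns x \<in> X" by auto
  then have "reflect J n (act J ns x) \<in> X" using reflect_cc_space[OF N_unit] by blast
  then show ?case by (simp only: act.simps)
qed (simp only: act.simps)

lemma word_W:
  assumes "set ns \<subseteq> N"
  shows "restrict (act J ns) X \<in> W"
  using assms
proof (induction ns)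
  case Nil
  have "restrict (act J []) X = \<one>\<^bsub>isom_group K\<^esub>" by (auto simp: isom_one)
  then show ?case using subgroup.one_closed[OF W_subgroup] by (simp only:)
next
  case (Cons n ns)
  have n: "restrict (reflect J n) X \<in> W" using Cons.prems by (auto simp: N_def)
  have ns: "restrict (act J ns) X \<in> W" by (rule Cons.IH) (use Cons.prems in simp)
  have m: "restrict (reflect J n) X \<otimes>\<^bsub>isom_group K\<^esub> restrict (act J ns) X \<in> W"
    using subgroup.m_closed[OF W_subgroup n ns] .
  have "restrict (act J (n # ns)) X = restrict (reflect J n) X \<otimes>\<^bsub>isom_group K\<^esub> restrict (act J ns) X"
  proof
    fix x
    show "restrict (act J (n # ns)) X x = (restrict (reflect J n) X \<otimes>\<^bsub>isom_group K\<^esub> restrict (act J ns) X) x"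
    proof (cases "x \<in> X")
      case True
      then show ?thesis
        using isom_mult[OF W_carrier[OF n] W_carrier[OF ns] True] word_X[of ns x] Cons.prems by simp
    next
      case False
      then show ?thesis
        using extensional_arb[OF Bij_imp_extensional[OF isom_Bij[OF W_carrier[OF m]]] False] by simp
    qed
  qed
  then show ?case using m by (simp only:)
qed

lemma reflection_N:
  assumes "r \<in> W" "is_reflection K H r"
  obtains n where "n \<in> N" "H = {x \<in> X. n \<bullet> x = 0}" "\<And>x. x \<in> X \<Longrightarrow> r x = reflect J n x"
proof -
  obtain n where n: "n \<bullet> J n = 1" "H = {x \<in> X. n \<bullet> x = 0}" "H \<noteq> {}"
    "\<And>x. x \<in> X \<Longrightarrow> r x = reflect J n x"
    by (rule reflection_form[OF assms(2)], rule that)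
  have "p \<notin> H" using p(2) assms by (auto simp: mirrors_def)
  then have np: "n \<bullet> p \<noteq> 0" using n(2) p(1) by blast
  have r: "restrict (reflect J n) X = r"
  proof
    fix x show "restrict (reflect J n) X x = r x"
      using n(4)[of x] extensional_arb[OF Bij_imp_extensional[OF isom_Bij[OF W_carrier[OF assms(1)]]], of x]
      by (cases "x \<in> X") auto
  qed
  show thesis
  proof (cases "n \<bullet> p > 0")
    case True
    moreover have "\<exists>x\<in>X. n \<bullet> x = 0" using n(2,3) by blast
    ultimately have "n \<in> N" using n(1) r assms(1) by (simp add: N_def)
    then show thesis using that n by blast
  next
    case False
    moreover have "\<exists>x\<in>X. n \<bullet> x = 0" using n(2,3) by blast
    ultimately have "- n \<in> N"
      using n(1) r assms(1) np by (simp add: N_def linear_neg[OF linear_Jm] reflect_uminus[OF linear_Jm])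
    moreover have "H = {x \<in> X. - n \<bullet> x = 0}" using n(2) by simp
    ultimately show thesis using that[of "- n"] n(4) by (simp add: reflect_uminus[OF linear_Jm])
  qed
qed

text \<open>Converse to \<open>reflection_N\<close>. The reflection is not the identity because the
  open cone over the space contains a point where \<open>n\<close> does not vanish.\<close>

lemma mirrorI:
  assumes n: "n \<bullet> J n = 1" "\<exists>x\<in>X. n \<bullet> x = 0" "restrict (reflect J n) X \<in> W"
  shows "{x \<in> X. n \<bullet> x = 0} \<in> mirrors K W"
proof -
  let ?r = "restrict (reflect J n) X"
  have n0: "n \<noteq> 0" using n(1) by auto
  have "{x \<in> X. n \<bullet> x = 0} = {x. n \<bullet> x = 0} \<inter> X" by auto
  moreover have "dim {x. n \<bullet> x = 0} = DIM('a)" using dim_hyperplane[OF n0] by simp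
  ultimately have "{x \<in> X. n \<bullet> x = 0} \<in> hyperplanes K"
    unfolding hyperplanes_def using n(2) subspace_hyperplane[of n] by blast
  moreover have "?r \<noteq> \<one>\<^bsub>isom_group K\<^esub>"
  proof
    assume r: "?r = \<one>\<^bsub>isom_group K\<^esub>"
    have "cone K \<noteq> ({} :: (real \<times> 'a) set)" using p(1) cc_space_cone by blast
    then obtain z where z: "z \<in> cone K" "n \<bullet> z \<noteq> 0"
      using open_avoid_hyperplanes[OF open_cone[of K], of "{n}"] n0 by auto
    define y where "y = (1 / nrm K z) *\<^sub>R z"
    have y: "y \<in> X" unfolding y_def by (rule nrm_cc_space[OF z(1)])
    have ny: "n \<bullet> y \<noteq> 0" using z(2) nrm_pos[OF z(1)] by (simp add: y_def)
    have "?r y = y" using r y by (simp add: isom_one)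
    then have "reflect J n y = y" using y by simp
    then have "n \<bullet> y = - (n \<bullet> y)" using inner_reflect_self[where J = J, OF n(1), of y] by simp
    then show False using ny by simp
  qed
  ultimately have "is_reflection K {x \<in> X. n \<bullet> x = 0} ?r"
    using W_carrier[OF n(3)] by (simp add: is_reflection_def)
  then show ?thesis using n(3) by (auto simp: mirrors_def)
qed

lemma Union_mirrors: "\<Union>(mirrors K W) = {x \<in> X. \<exists>n\<in>N. n \<bullet> x = 0}"
proof
  show "\<Union>(mirrors K W) \<subseteq> {x \<in> X. \<exists>n\<in>N. n \<bullet> x = 0}"
  proof
    fix x assume "x \<in> \<Union>(mirrors K W)"
    then obtain H r where H: "x \<in> H" "r \<in> W" "is_reflection K H r" by (auto simp: mirrors_def)
    then show "x \<in> {x \<in> X. \<exists>n\<in>N. n \<bullet> x = 0}" using reflection_N[OF H(2,3)] by blast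
  qed
  show "{x \<in> X. \<exists>n\<in>N. n \<bullet> x = 0} \<subseteq> \<Union>(mirrors K W)" using mirrorI unfolding N_def by blast
qed

lemma W_word:
  assumes "w \<in> W"
  obtains ns where "set ns \<subseteq> N" "\<And>x. x \<in> X \<Longrightarrow> w x = act J ns x"
proof -
  obtain R where R: "R \<subseteq> {r. \<exists>H. is_reflection K H r}" "W = generate (isom_group K) R"
    using W_generate by blast
  have inR: "\<exists>n\<in>N. \<forall>x\<in>X. r x = reflect J n x" if r: "r \<in> R" for r
  proof -
    obtain H where H: "is_reflection K H r" using R(1) r by blast
    have "r \<in> W" unfolding R(2) using r by (rule generate.incl)
    then show ?thesis using reflection_N[OF _ H] by metis
  qed
  have "w \<in> generate (isom_group K) R" using assms R(2) by simp
  then have "\<exists>ns. set ns \<subseteq> N \<and> (\<forall>x\<in>X. w x = act J ns x)"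
  proof induction
    case one
    show ?case by (intro exI[of _ "[]"]) (simp add: isom_one)
  next
    case (incl r)
    then obtain n where "n \<in> N" "\<forall>x\<in>X. r x = reflect J n x" using inR by blast
    then show ?case by (intro exI[of _ "[n]"]) simp
  next
    case (inv r)
    then obtain n where n: "n \<in> N" "\<forall>x\<in>X. r x = reflect J n x" using inR by blast
    have "r \<in> W" unfolding R(2) using inv by (rule generate.incl)
    then have rc: "r \<in> carrier (isom_group K)" by (rule W_carrier)
    have "(inv\<^bsub>isom_group K\<^esub> r) x = reflect J n x" if x: "x \<in> X" for x
    proof -
      have y: "reflect J n x \<in> X" using reflect_cc_space[OF N_unit[OF n(1)] x] .
      have "r (reflect J n x) = x" using n(2) y reflect_reflect[where J = J, OF N_unit[OF n(1)]] by simp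
      then show ?thesis using isom_inv(1)[OF rc y] by simp
    qed
    then show ?case using n(1) by (intro exI[of _ "[n]"]) simp
  next
    case (eng w1 w2)
    then obtain u v where uv: "set u \<subseteq> N" "\<forall>x\<in>X. w1 x = act J u x" "set v \<subseteq> N" "\<forall>x\<in>X. w2 x = act J v x"
      by blast
    have "w1 \<in> carrier (isom_group K)" "w2 \<in> carrier (isom_group K)"
      using eng R(2) W_carrier by auto
    then show ?case using uv by (intro exI[of _ "u @ v"]) (simp add: isom_mult word_X)
  qed
  then show thesis using that by blast
qed

text \<open>A conjugate of a reflection in \<open>W\<close> is again one, and \<open>p\<close>,
  being off all mirrors, decides which of the two normals belongs to \<open>N\<close>.\<close>

lemma N_closed:
  assumes m: "m \<in> N" and n: "n \<in> N"
  shows "n - (2 * (n \<bullet> J m)) *\<^sub>R m \<in> N \<or> - (n - (2 * (n \<bullet> J m)) *\<^sub>R m) \<in> N"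
proof -
  define k where "k = n - (2 * (n \<bullet> J m)) *\<^sub>R m"
  have mm: "m \<bullet> J m = 1" using N_unit[OF m] .
  have c1: "k \<bullet> z = n \<bullet> reflect J m z" and c2: "reflect J m (reflect J k z) = reflect J n (reflect J m z)" for z
    using reflect_conj[OF linear_Jm mm Jm_sym k_def] by blast+
  have k1: "k \<bullet> J k = 1"
    using N_unit[OF n] mm Jm_sym[of m K n]
    by (simp add: k_def linear_diff[OF linear_Jm] linear_scale[OF linear_Jm] inner_diff_left inner_diff_right
        algebra_simps)
  have rk: "reflect J k z = act J [m, n, m] z" for z
    using c2[of z] reflect_reflect[where J = J, OF mm] by (metis act.simps)
  obtain x where x: "x \<in> X" "n \<bullet> x = 0" using n by (auto simp: N_def)
  have x': "reflect J m x \<in> X" "k \<bullet> reflect J m x = 0"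
    using reflect_cc_space[OF mm x(1)] c1 reflect_reflect[where J = J, OF mm] x(2) by auto
  have kW: "restrict (reflect J k) X \<in> W"
    using word_W[of "[m, n, m]"] m n by (simp add: rk[abs_def] cong: restrict_cong)
  have "{y \<in> X. k \<bullet> y = 0} \<in> mirrors K W" using mirrorI[OF k1 _ kW] x' by blast
  then have "k \<bullet> p \<noteq> 0" using p by blast
  moreover have "\<exists>x\<in>X. k \<bullet> x = 0" using x' by blast
  ultimately have "k \<in> N \<or> - k \<in> N"
    using k1 kW by (simp add: N_def linear_neg[OF linear_Jm] reflect_uminus[OF linear_Jm]) linarith
  then show ?thesis by (simp add: k_def)
qed

lemma word_qd:
  assumes "set ns \<subseteq> N" "x \<in> X" "y \<in> X"
  shows "qd K (act J ns x) (act J ns y) = qd K x y"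
  using isom_qd[OF W_carrier[OF word_W[OF assms(1)]] assms(2,3)] assms(2,3) by simp

lemma orbit_finite:
  assumes "y \<in> X"
  shows "finite {act J ns y |ns. set ns \<subseteq> N \<and> norm (act J ns y) \<le> b}"
proof (rule finite_subset)
  show "{act J ns y |ns. set ns \<subseteq> N \<and> norm (act J ns y) \<le> b} \<subseteq> (\<lambda>w. w y) ` {w \<in> W. norm (w y) \<le> b}"
  proof
    fix z assume "z \<in> {act J ns y |ns. set ns \<subseteq> N \<and> norm (act J ns y) \<le> b}"
    then obtain ns where "z = act J ns y" "set ns \<subseteq> N" "norm (act J ns y) \<le> b" by blast
    then show "z \<in> (\<lambda>w. w y) ` {w \<in> W. norm (w y) \<le> b}"
      using assms word_W by (intro image_eqI[of _ _ "restrict (act J ns) X"]) auto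
  qed
  show "finite ((\<lambda>w. w y) ` {w \<in> W. norm (w y) \<le> b})"
    using finite_bounded_elements[OF W_subgroup W_discrete assms] by simp
qed

section \<open>The group as a mirror system\<close>

lemma mirror_system_X:
  assumes "K \<noteq> Spherical"
  shows "mirror_system J X (cone K) (nrm K) (qd K) N p"
proof (rule mirror_system.intro)
  show "linear J" by (rule linear_Jm)
  show "n \<bullet> J n = 1" "n \<bullet> p > 0" if "n \<in> N" for n using that by (rule N_unit N_pos)+
  show "m \<bullet> J n = n \<bullet> J m" for m n by (rule Jm_sym)
  show "n - (2 * (n \<bullet> J m)) *\<^sub>R m \<in> N \<or> - (n - (2 * (n \<bullet> J m)) *\<^sub>R m) \<in> N"
    if "m \<in> N" "n \<in> N" for m n
    using that by (rule N_closed)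
  show "p \<in> X" by (rule p(1))
  show "closed X" by (rule closed_cc_space)
  show "reflect J n x \<in> X" if "n \<in> N" "x \<in> X" for n x
    using reflect_cc_space[OF N_unit] that .
  show "qd K x y = qd K y x" for x y :: "real \<times> 'a" by (rule qd_sym)
  show "qd K x y \<ge> 0" "qd K x y = 0 \<longleftrightarrow> x = y" if "x \<in> X" "y \<in> X" for x y
    using that by (rule qd_nonneg qd_eq0)+
  show "qd K x (reflect J n y) = qd K x y + 4 * (n \<bullet> x) * (n \<bullet> y)"
    if "n \<in> N" "x \<in> X" "y \<in> X" for n x y
    using qd_reflect[OF N_unit[OF that(1)]] that by blast
  show "continuous_on (X \<times> X) (\<lambda>z. qd K (fst z) (snd z))"
    by (rule continuous_on_subset[OF qd_continuous]) simp
  show "\<exists>b'. \<forall>y\<in>X. \<forall>z\<in>X. norm y \<le> b \<longrightarrow> qd K y z \<le> c \<longrightarrow> norm z \<le> b'" for b c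
    by (rule qd_bdd)
  show "finite {act J ns y |ns. set ns \<subseteq> N \<and> norm (act J ns y) \<le> b}" if "y \<in> X" for y b
    using that by (rule orbit_finite)
  show "open (cone K)" by (rule open_cone)
  show "X \<subseteq> cone K" using cc_space_cone by blast
  show "x + b *\<^sub>R y \<in> cone K" if "x \<in> cone K" "y \<in> cone K" "b > 0" for x y :: "real \<times> 'a" and b
    using cone_add[OF assms that] .
  show "nrm K z > 0" "(1 / nrm K z) *\<^sub>R z \<in> X" if "z \<in> cone K" for z
    using that by (rule nrm_pos nrm_cc_space)+
  show "nrm K x = 1" if "x \<in> X" for x using that by (rule nrm_1)
  show "continuous_on (cone K) (nrm K)" by (rule nrm_continuous)
qed

lemma mirror_orbit_finite:
  assumes K: "K = Spherical"
  shows "finite {act J ns y |ns. set ns \<subseteq> N}"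
proof (cases "y = 0")
  case True
  then have "{act J ns y |ns. set ns \<subseteq> N} \<subseteq> {0}"
    using linear_0[OF linear_act] by auto
  then show ?thesis by (rule finite_subset) simp
next
  case False
  define u where "u = (1 / norm y) *\<^sub>R y"
  have u: "u \<in> X" "y = norm y *\<^sub>R u" using False K by (simp_all add: u_def)
  have "norm (act J ns u) \<le> 1" if "set ns \<subseteq> N" for ns
    using word_X[OF that u(1)] K by simp
  then have "{act J ns y |ns. set ns \<subseteq> N}
      \<subseteq> (\<lambda>z. norm y *\<^sub>R z) ` {act J ns u |ns. set ns \<subseteq> N \<and> norm (act J ns u) \<le> 1}"
    using u(2) linear_scale[OF linear_act, of J _ "norm y" u] by force
  then show ?thesis using orbit_finite[OF u(1)] finite_subset finite_imageI by blast
qed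

text \<open>With the sphere as \<open>X\<close>, \<open>E_cone\<close> would fail for antipodal
  points, whose sum is \<open>0\<close>. The vector space satisfies it, and the chamber becomes a
  convex cone.\<close>

lemma mirror_system_sphere:
  assumes K: "K = Spherical"
  shows "mirror_system J UNIV UNIV (\<lambda>_. 1) (\<lambda>z w. (norm (id (z - w)))\<^sup>2) N p"
proof (rule linear_mirror_system)
  show "linear J" by (rule linear_Jm)
  show "linear id" "inj id" by (simp_all add: linear_id[unfolded id_def] id_def)
  show "n \<bullet> J n = 1" "n \<bullet> p > 0" if "n \<in> N" for n using that by (rule N_unit N_pos)+
  show "id (J n) \<bullet> id z = n \<bullet> z" for n z using K by simp
  show "n - (2 * (n \<bullet> J m)) *\<^sub>R m \<in> N \<or> - (n - (2 * (n \<bullet> J m)) *\<^sub>R m) \<in> N"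
    if "m \<in> N" "n \<in> N" for m n
    using that by (rule N_closed)
  show "finite {act J ns y |ns. set ns \<subseteq> N}" for y by (rule mirror_orbit_finite[OF K])
qed

lemma N_nonempty:
  assumes "K = Spherical"
  shows "N \<noteq> {}"
proof
  assume "N = {}"
  have "w = \<one>\<^bsub>isom_group K\<^esub>" if w: "w \<in> W" for w
  proof (rule isom_eqI[OF W_carrier[OF w] W_carrier[OF subgroup.one_closed[OF W_subgroup]]])
    obtain ns where ns: "set ns \<subseteq> N" "\<And>x. x \<in> X \<Longrightarrow> w x = act J ns x"
      by (rule W_word[OF w], rule that)
    then have "ns = []" using \<open>N = {}\<close> by simp
    then show "w x = \<one>\<^bsub>isom_group K\<^esub> x" if "x \<in> X" for x
      using ns(2)[OF that] that by (simp add: isom_one)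
  qed
  then show False using nontrivial[OF assms] subgroup.one_closed[OF W_subgroup] by blast
qed

lemma qd_strict:
  assumes "x \<in> C" "y \<in> C" "set us \<subseteq> N" "act J us z \<noteq> z"
  shows "qd K x (act J us y) > qd K x y"
proof (cases "K = Spherical")
  case True
  interpret mirror_system J UNIV UNIV "\<lambda>_. 1" "\<lambda>z w. (norm (id (z - w)))\<^sup>2" N p
    by (rule mirror_system_sphere[OF True])
  have "x \<in> D0" "y \<in> D0" using assms by (auto simp: C_def D0_def)
  from q_strict[OF this assms(3,4)] show ?thesis
    using True by (simp add: qd_def power2_norm_eq_inner)
next
  case False
  interpret mirror_system J X "cone K" "nrm K" "qd K" N p
    by (rule mirror_system_X[OF False])
  have "x \<in> D0" "y \<in> D0" using assms by (auto simp: C_def D0_def)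
  from q_strict[OF this assms(3,4)] show ?thesis .
qed

section \<open>The chamber as a connected component\<close>

lemma C_open: "\<exists>U. open U \<and> C = X \<inter> U"
proof (cases "K = Spherical")
  case True
  interpret mirror_system J UNIV UNIV "\<lambda>_. 1" "\<lambda>z w. (norm (id (z - w)))\<^sup>2" N p
    by (rule mirror_system_sphere[OF True])
  obtain U where "open U" "D0 = UNIV \<inter> U" using open_D0 by blast
  moreover have "C = X \<inter> D0" by (auto simp: C_def D0_def)
  ultimately show ?thesis by auto
next
  case False
  interpret mirror_system J X "cone K" "nrm K" "qd K" N p
    by (rule mirror_system_X[OF False])
  have "C = D0" by (auto simp: C_def D0_def)
  then show ?thesis using open_D0 by simp
qed

lemma translate_cone:
  assumes x: "x \<in> X" "\<And>n. n \<in> N \<Longrightarrow> n \<bullet> x \<ge> 0" and "e > 0"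
  shows "x + e *\<^sub>R p \<in> cone K" "n \<in> N \<Longrightarrow> n \<bullet> (x + e *\<^sub>R p) > 0"
proof -
  show pos: "n \<bullet> (x + e *\<^sub>R p) > 0" if "n \<in> N" for n
    using x(2)[OF that] N_pos[OF that] assms(3) by (simp add: inner_add_right add_nonneg_pos)
  show "x + e *\<^sub>R p \<in> cone K"
  proof (cases "K = Spherical")
    case True
    \<comment> \<open>On the sphere \<open>x\<close> might be antipodal to \<open>p\<close>; a
      functional that is positive at the sum shows that the sum does not vanish.\<close>
    then obtain m where "m \<in> N" using N_nonempty by blast
    then have "x + e *\<^sub>R p \<noteq> 0" using pos[of m] by force
    then show ?thesis using True by simp
  next
    case False
    then show ?thesis using x(1) p(1) assms(3) by (intro cone_add cc_space_cone) auto
  qed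
qed

lemma C_limit:
  assumes x: "x \<in> X" "\<And>n. n \<in> N \<Longrightarrow> n \<bullet> x \<ge> 0"
  obtains f where "\<And>k. f k \<in> C" "f \<longlonglongrightarrow> x"
proof -
  let ?v = "\<lambda>k. x + (1 / real (Suc k)) *\<^sub>R p"
  have E: "?v k \<in> cone K" "\<And>n. n \<in> N \<Longrightarrow> n \<bullet> ?v k > 0" for k
    using translate_cone[of x "1 / real (Suc k)"] x by auto
  show thesis
  proof (rule that)
    show "(1 / nrm K (?v k)) *\<^sub>R ?v k \<in> C" for k
    proof -
      have "n \<bullet> ((1 / nrm K (?v k)) *\<^sub>R ?v k) > 0" if "n \<in> N" for n
      proof -
        have "n \<bullet> ((1 / nrm K (?v k)) *\<^sub>R ?v k) = (1 / nrm K (?v k)) * (n \<bullet> ?v k)"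
          by (rule inner_scaleR_right)
        moreover have "1 / nrm K (?v k) > 0" using nrm_pos[OF E(1)] by simp
        ultimately show ?thesis using E(2)[OF that] mult_pos_pos by metis
      qed
      then show ?thesis using nrm_cc_space[OF E(1)] by (simp add: C_def)
    qed
    show "(\<lambda>k. (1 / nrm K (?v k)) *\<^sub>R ?v k) \<longlonglongrightarrow> x"
      by (rule normalised_tendsto[OF open_cone cc_space_cone[OF x(1)] nrm_continuous nrm_1[OF x(1)]])
  qed
qed

lemma p_C: "p \<in> C"
  using p(1) N_pos by (simp add: C_def)

lemma connected_C: "connected C"
proof -
  let ?Z = "{z \<in> cone K. \<forall>n\<in>N. n \<bullet> z > 0}"
  \<comment> \<open>The spherical cone omits \<open>0\<close> and may fail to be convex. As
    \<open>N\<close> is nonempty, the half-spaces exclude \<open>0\<close> anyway, so the whole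
    space can take its place.\<close>
  have "?Z = (if K = Spherical then UNIV else cone K) \<inter> (\<Inter>n\<in>N. {z. n \<bullet> z > 0})"
    using N_nonempty by auto
  moreover have "convex ((if K = Spherical then UNIV else cone K) \<inter> (\<Inter>n\<in>N. {z. n \<bullet> z > 0}))"
    using convex_cone by (intro convex_Int convex_INT convex_halfspace_gt) auto
  ultimately have "connected ?Z" by (simp add: convex_connected)
  moreover have "continuous_on ?Z (\<lambda>z. (1 / nrm K z) *\<^sub>R z)"
    using nrm_pos by (intro continuous_intros continuous_on_subset[OF nrm_continuous]) force+
  ultimately have "connected ((\<lambda>z. (1 / nrm K z) *\<^sub>R z) ` ?Z)" by (rule connected_continuous_image[rotated])
  moreover have "(\<lambda>z. (1 / nrm K z) *\<^sub>R z) ` ?Z = C"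
  proof
    show "(\<lambda>z. (1 / nrm K z) *\<^sub>R z) ` ?Z \<subseteq> C"
    proof (intro image_subsetI)
      fix z assume z: "z \<in> ?Z"
      then have c: "z \<in> cone K" by simp
      have "n \<bullet> ((1 / nrm K z) *\<^sub>R z) > 0" if "n \<in> N" for n
        using that z nrm_pos[OF c] by simp
      then show "(1 / nrm K z) *\<^sub>R z \<in> C" using nrm_cc_space[OF c] by (simp add: C_def)
    qed
    show "C \<subseteq> (\<lambda>z. (1 / nrm K z) *\<^sub>R z) ` ?Z"
    proof
      fix x assume x: "x \<in> C"
      then have "x \<in> X" by (simp add: C_def)
      then have "x = (1 / nrm K x) *\<^sub>R x" "x \<in> cone K" by (simp_all add: nrm_1 cc_space_cone)
      then show "x \<in> (\<lambda>z. (1 / nrm K z) *\<^sub>R z) ` ?Z"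
        using x by (intro image_eqI[of _ _ x]) (auto simp: C_def)
    qed
  qed
  ultimately show ?thesis by simp
qed

text \<open>A connected set containing \<open>p\<close> cannot leave the chamber unless a functional
  vanishes somewhere on it, that is, unless it meets a mirror.\<close>

lemma component_C:
  assumes Q: "Q \<in> components (X - \<Union>(mirrors K W))" "p \<in> Q"
  shows "Q = C"
proof
  have "C \<subseteq> X - \<Union>(mirrors K W)" unfolding Union_mirrors by (auto simp: C_def)
  moreover have "C \<inter> Q \<noteq> {}" using p_C Q(2) by blast
  ultimately show "C \<subseteq> Q" using components_maximal[OF Q(1) connected_C] by (simp add: Int_commute)
  show "Q \<subseteq> C"
  proof
    fix x assume x: "x \<in> Q"
    have QX: "Q \<subseteq> X - \<Union>(mirrors K W)" using in_components_subset[OF Q(1)] .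
    have "n \<bullet> x > 0" if n: "n \<in> N" for n
    proof (rule ccontr)
      assume "\<not> n \<bullet> x > 0"
      then have "\<exists>z\<in>Q. n \<bullet> z = 0"
        using connected_ivt_hyperplane[OF in_components_connected[OF Q(1)] x Q(2), of n 0] N_pos[OF n] by auto
      then show False using QX n unfolding Union_mirrors by blast
    qed
    then show "x \<in> C" using x QX by (auto simp: C_def)
  qed
qed

lemma closure_C: "top_of_set X closure_of C = {x \<in> X. \<forall>n\<in>N. n \<bullet> x \<ge> 0}"
proof -
  have "C \<subseteq> X" by (auto simp: C_def)
  then have "top_of_set X closure_of C = X \<inter> closure C"
    by (simp add: closure_of_subtopology inf.absorb2)
  also have "\<dots> = {x \<in> X. \<forall>n\<in>N. n \<bullet> x \<ge> 0}"
  proof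
    have "closed (\<Inter>n\<in>N. {x. n \<bullet> x \<ge> 0})" by (intro closed_INT ballI closed_halfspace_ge)
    moreover have "C \<subseteq> (\<Inter>n\<in>N. {x. n \<bullet> x \<ge> 0})" by (auto simp: C_def intro: less_imp_le)
    ultimately have "closure C \<subseteq> (\<Inter>n\<in>N. {x. n \<bullet> x \<ge> 0})" by (rule closure_minimal[rotated])
    then show "X \<inter> closure C \<subseteq> {x \<in> X. \<forall>n\<in>N. n \<bullet> x \<ge> 0}" by blast
    show "{x \<in> X. \<forall>n\<in>N. n \<bullet> x \<ge> 0} \<subseteq> X \<inter> closure C"
    proof
      fix x assume "x \<in> {x \<in> X. \<forall>n\<in>N. n \<bullet> x \<ge> 0}"
      then have x: "x \<in> X" "\<And>n. n \<in> N \<Longrightarrow> n \<bullet> x \<ge> 0" by auto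
      obtain f where "\<And>k. f k \<in> C" "f \<longlonglongrightarrow> x" by (rule C_limit[OF x], assumption, rule that)
      then show "x \<in> X \<inter> closure C" using x(1) closure_sequential by blast
    qed
  qed
  finally show ?thesis .
qed

lemma interior_closure_C: "top_of_set X interior_of (top_of_set X closure_of C) = C"
proof
  obtain U where U: "open U" "C = X \<inter> U" using C_open by blast
  have "openin (top_of_set X) C" using U by (auto simp: openin_open)
  moreover have "C \<subseteq> top_of_set X closure_of C" unfolding closure_C by (auto simp: C_def intro: less_imp_le)
  ultimately show "C \<subseteq> top_of_set X interior_of (top_of_set X closure_of C)"
    by (simp add: interior_of_maximal)
  show "top_of_set X interior_of (top_of_set X closure_of C) \<subseteq> C"
  proof
    fix x assume x: "x \<in> top_of_set X interior_of (top_of_set X closure_of C)"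
    then obtain T where T: "openin (top_of_set X) T" "x \<in> T" "T \<subseteq> {x \<in> X. \<forall>n\<in>N. n \<bullet> x \<ge> 0}"
      unfolding closure_C interior_of_def by blast
    obtain V where V: "open V" "T = X \<inter> V" using T(1) by (auto simp: openin_open)
    have xX: "x \<in> X" and x0: "\<And>n. n \<in> N \<Longrightarrow> n \<bullet> x \<ge> 0" using T by auto
    have "n \<bullet> x \<noteq> 0" if n: "n \<in> N" for n
    proof
      assume 0: "n \<bullet> x = 0"
      \<comment> \<open>Points of \<open>C\<close> close to \<open>x\<close>, reflected in a mirror
        through \<open>x\<close>, remain close to \<open>x\<close> but end up on the negative side.
        No neighbourhood of \<open>x\<close> thus stays in the closed chamber.\<close>
      obtain f where f: "\<And>k. f k \<in> C" "f \<longlonglongrightarrow> x" by (rule C_limit[OF xX x0], assumption, rule that)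
      have "(\<lambda>k. reflect J n (f k)) \<longlonglongrightarrow> reflect J n x"
        by (rule bounded_linear.tendsto[OF _ f(2)]) (use linear_reflect linear_conv_bounded_linear in blast)
      then have "(\<lambda>k. reflect J n (f k)) \<longlonglongrightarrow> x" using 0 by simp
      then have "eventually (\<lambda>k. reflect J n (f k) \<in> V) sequentially"
        using V T(2) topological_tendstoD by blast
      then obtain k where k: "reflect J n (f k) \<in> V" using eventually_happens' trivial_limit_sequentially by blast
      have fk: "f k \<in> X" "n \<bullet> f k > 0" using f(1)[of k] n by (auto simp: C_def)
      have "reflect J n (f k) \<in> T" using k V(2) reflect_cc_space[OF N_unit[OF n] fk(1)] by blast
      then have "n \<bullet> reflect J n (f k) \<ge> 0" using T(3) n by blast
      then show False using inner_reflect_self[where J = J, OF N_unit[OF n], of "f k"] fk(2) by simp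
    qed
    then show "x \<in> C" using xX x0 by (force simp: C_def order_le_less)
  qed
qed

section \<open>Fixed points in the chamber\<close>

lemma fixed_point_sphere:
  assumes K: "K = Spherical" and h: "linear h" "\<And>x. x \<in> X \<Longrightarrow> h x \<in> X"
  shows "\<exists>ns v. set ns \<subseteq> N \<and> v \<in> C \<and> act J ns (h v) = v"
proof -
  interpret M: mirror_system J UNIV UNIV "\<lambda>_. 1" "\<lambda>z w. (norm (id (z - w)))\<^sup>2" N p
    by (rule mirror_system_sphere[OF K])
  have norm_h: "norm (id (h z)) = norm (id z)" for z
  proof (cases "z = 0")
    case False
    define u where "u = (1 / norm z) *\<^sub>R z"
    have u: "norm u = 1" "z = norm z *\<^sub>R u" using False by (simp_all add: u_def)
    have "norm (h u) = 1" using h(2)[of u] u(1) K by simp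
    moreover have "h z = norm z *\<^sub>R h u" using u(2) linear_scale[OF h(1), of "norm z" u] by simp
    ultimately show ?thesis by simp
  qed (simp add: linear_0[OF h(1)])
  \<comment> \<open>Here the linear group is the whole of \<open>W\<close>, acting on the full
    ambient space with its standard inner product. Rescaling the fixed vector puts it on the
    sphere.\<close>
  have "\<exists>ns v. set ns \<subseteq> N \<and> v \<in> UNIV \<and> (\<forall>n\<in>N. n \<bullet> v > 0) \<and> act J ns (h v) = v"
  proof (rule linear_fixed_vector[where A = id and p = p])
    show "linear J" by (rule linear_Jm)
    show "linear (id :: real \<times> 'a \<Rightarrow> real \<times> 'a)" "inj (id :: real \<times> 'a \<Rightarrow> real \<times> 'a)"
      by (simp_all add: linear_id[unfolded id_def] id_def)
    show "n \<bullet> J n = 1" "n \<bullet> p > 0" if "n \<in> N" for n using that by (rule N_unit N_pos)+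
    show "id (J n) \<bullet> id z = n \<bullet> z" for n z using K by simp
    show "n - (2 * (n \<bullet> J m)) *\<^sub>R m \<in> N \<or> - (n - (2 * (n \<bullet> J m)) *\<^sub>R m) \<in> N"
      if "m \<in> N" "n \<in> N" for m n
      using that by (rule N_closed)
    show "finite {act J ns y |ns. set ns \<subseteq> N}" for y
      by (rule mirror_orbit_finite[OF K])
    show "N \<noteq> {}" by (rule N_nonempty[OF K])
    show "linear h" by (rule h(1))
    show "norm (id (h z)) = norm (id z)" for z by (rule norm_h)
  qed auto
  then obtain ns v where v: "set ns \<subseteq> N" "\<And>n. n \<in> N \<Longrightarrow> n \<bullet> v > 0" "act J ns (h v) = v" by blast
  obtain m where "m \<in> N" using N_nonempty[OF K] by blast
  then have "m \<bullet> v > 0" by (rule v(2))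
  then have v0: "v \<noteq> 0" by auto
  define u where "u = (1 / norm v) *\<^sub>R v"
  have "norm u = 1" using v0 by (simp add: u_def)
  then have "u \<in> X" using K by simp
  moreover have "n \<bullet> u > 0" if "n \<in> N" for n using v(2)[OF that] v0 by (simp add: u_def)
  moreover have "act J ns (h u) = u"
    using v(3) by (simp add: u_def linear_scale[OF h(1)] linear_scale[OF linear_act])
  ultimately show ?thesis using v(1) unfolding C_def by blast
qed

text \<open>Brouwer's theorem needs a convex set, which a chamber on the hyperboloid need not be.
  The central projection \<phi> to \<open>fst = 1\<close>, the Klein model, makes it convex; on the
  Euclidean space \<phi> is the identity.\<close>

lemma fixed_point_closed_chamber:
  assumes K: "K \<noteq> Spherical" and h: "linear h" "\<And>x. x \<in> X \<Longrightarrow> h x \<in> X"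
    and compact: "compact {x \<in> X. \<forall>n\<in>N. n \<bullet> x \<ge> 0}"
  obtains ns x where "set ns \<subseteq> N" "x \<in> X" "\<And>n. n \<in> N \<Longrightarrow> n \<bullet> x \<ge> 0" "act J ns (h x) = x"
proof -
  interpret M: mirror_system J X "cone K" "nrm K" "qd K" N p
    by (rule mirror_system_X[OF K])
  define \<phi> where "\<phi> = (\<lambda>x :: real \<times> 'a. (1 / fst x) *\<^sub>R x)"
  have fst_pos: "fst z > 0" if "z \<in> cone K" for z :: "real \<times> 'a"
  proof (cases K)
    case Hyperbolic
    then have "norm (snd z) < fst z" using that by simp
    then show ?thesis by (meson le_less_trans norm_ge_zero)
  qed (use that K in auto)
  define S where "S = {z \<in> cone K. fst z = 1 \<and> (\<forall>n\<in>N. n \<bullet> z \<ge> 0)}"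
  have \<phi>_S: "\<phi> x \<in> S" if "x \<in> M.D" for x
  proof -
    have x: "x \<in> X" "x \<in> cone K" "\<And>n. n \<in> N \<Longrightarrow> n \<bullet> x \<ge> 0"
      using that cc_space_cone[of x K] by (auto simp: M.D_def)
    have "\<phi> x \<in> cone K" unfolding \<phi>_def using x fst_pos[OF x(2)] by (intro cone_scale) auto
    moreover have "fst (\<phi> x) = 1" using fst_pos[OF x(2)] by (simp add: \<phi>_def)
    moreover have "n \<bullet> \<phi> x \<ge> 0" if "n \<in> N" for n
      using x(3)[OF that] fst_pos[OF x(2)] by (simp add: \<phi>_def)
    ultimately show ?thesis by (simp add: S_def)
  qed
  have S_D: "(1 / nrm K z) *\<^sub>R z \<in> M.D" if "z \<in> S" for z
  proof -
    have z: "z \<in> cone K" "\<And>n. n \<in> N \<Longrightarrow> n \<bullet> z \<ge> 0" using that by (auto simp: S_def)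
    have "n \<bullet> ((1 / nrm K z) *\<^sub>R z) \<ge> 0" if "n \<in> N" for n
      using z(2)[OF that] nrm_pos[OF z(1)] by simp
    then show ?thesis using nrm_cc_space[OF z(1)] by (simp add: M.D_def)
  qed
  have S_image: "S = \<phi> ` M.D"
  proof
    show "S \<subseteq> \<phi> ` M.D"
    proof
      fix z assume z: "z \<in> S"
      then have "nrm K z > 0" using nrm_pos[of z K] by (simp add: S_def)
      then have "z = \<phi> ((1 / nrm K z) *\<^sub>R z)" using z by (simp add: \<phi>_def S_def)
      then show "z \<in> \<phi> ` M.D" using S_D[OF z] by blast
    qed
  qed (use \<phi>_S in blast)
  have D_cone: "M.D \<subseteq> cone K" using M.X_E by (auto simp: M.D_def)
  have \<phi>_cont: "continuous_on M.D \<phi>" unfolding \<phi>_def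
    using D_cone fst_pos by (intro continuous_intros) force+
  have "compact S" unfolding S_image
    by (rule compact_continuous_image[OF \<phi>_cont]) (use compact in \<open>simp add: M.D_def\<close>)
  moreover have "convex S"
  proof -
    have "S = cone K \<inter> {z. (1, 0) \<bullet> z = 1} \<inter> (\<Inter>n\<in>N. {z. n \<bullet> z \<ge> 0})"
      by (auto simp: S_def inner_prod_def)
    moreover have "convex (cone K \<inter> {z. (1, 0) \<bullet> z = 1} \<inter> (\<Inter>n\<in>N. {z. n \<bullet> z \<ge> 0}))"
      by (intro convex_Int convex_INT convex_halfspace_ge convex_hyperplane convex_cone[OF K])
    ultimately show ?thesis by simp
  qed
  moreover have "S \<noteq> {}"
  proof -
    have "p \<in> M.D" using p(1) less_imp_le[OF N_pos] by (simp add: M.D_def)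
    then show ?thesis using \<phi>_S by blast
  qed
  moreover
  define F where "F = (\<lambda>z. \<phi> (M.fold_map (h ((1 / nrm K z) *\<^sub>R z))))"
  have hX: "h ((1 / nrm K z) *\<^sub>R z) \<in> X" if "z \<in> S" for z
    using h(2) S_D[OF that] by (simp add: M.D_def)
  have "continuous_on S F"
  proof -
    have S_cone: "S \<subseteq> cone K" by (auto simp: S_def)
    have "continuous_on S (\<lambda>z. (1 / nrm K z) *\<^sub>R z)"
      using nrm_pos S_cone by (intro continuous_intros continuous_on_subset[OF nrm_continuous]) force+
    moreover have "continuous_on UNIV h"
      using h(1) linear_continuous_on linear_conv_bounded_linear by blast
    ultimately have "continuous_on S (h \<circ> (\<lambda>z. (1 / nrm K z) *\<^sub>R z))"
      by (meson continuous_on_compose continuous_on_subset subset_UNIV)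
    then have "continuous_on S (M.fold_map \<circ> (h \<circ> (\<lambda>z. (1 / nrm K z) *\<^sub>R z)))"
      by (rule continuous_on_compose) (rule continuous_on_subset[OF M.fold_map_cont], rule image_subsetI, simp add: hX)
    then have "continuous_on S (\<phi> \<circ> (M.fold_map \<circ> (h \<circ> (\<lambda>z. (1 / nrm K z) *\<^sub>R z))))"
      by (rule continuous_on_compose) (rule continuous_on_subset[OF \<phi>_cont], rule image_subsetI, simp add: M.fold_map(1) hX)
    then show ?thesis by (simp add: F_def o_def)
  qed
  moreover have "F \<in> S \<rightarrow> S"
    unfolding F_def using \<phi>_S M.fold_map(1) hX by blast
  ultimately obtain z where z: "z \<in> S" "F z = z" using brouwer[of S F] by blast
  define x where "x = (1 / nrm K z) *\<^sub>R z"
  define x' where "x' = M.fold_map (h x)"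
  have xD: "x \<in> M.D" unfolding x_def by (rule S_D[OF z(1)])
  have hx: "h x \<in> X" unfolding x_def by (rule hX[OF z(1)])
  have x'D: "x' \<in> M.D" unfolding x'_def by (rule M.fold_map(1)[OF hx])
  have x'z: "\<phi> x' = z" using z(2) by (simp add: F_def x'_def x_def)
  have "fst x' > 0" using x'D D_cone fst_pos by blast
  have nz: "nrm K z > 0" using z(1) nrm_pos[of z K] by (simp add: S_def)
  \<comment> \<open>Being fixed in the slice only means that \<open>x\<close> and its folded image
    lie on the same ray. Both belong to the space, where \<open>nrm\<close> is \<open>1\<close>, so
    the factor \<open>c\<close> is \<open>1\<close>.\<close>
  define c where "c = fst x' * nrm K z"
  have c: "c > 0" using \<open>fst x' > 0\<close> nz by (simp add: c_def)
  have "x' = fst x' *\<^sub>R z" using \<open>fst x' > 0\<close> x'z[symmetric] by (simp add: \<phi>_def)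
  then have x'x: "x' = c *\<^sub>R x" using nz by (simp add: c_def x_def)
  have "nrm K x' = 1" "nrm K x = 1" using x'D xD by (simp_all add: M.D_def nrm_1)
  then have "c = 1" using x'x nrm_scale[OF c, of K x] by simp
  then have "x' = x" using x'x by simp
  then obtain ns where ns: "set ns \<subseteq> N" "x = act J ns (h x)"
    using M.fold_map(2)[OF hx] by (auto simp: x'_def)
  show thesis
    using that[of ns x] ns xD by (auto simp: M.D_def)
qed

text \<open>The linear statement is applied to the mirrors through a fixed point \<open>x\<close>,
  with the map \<open>h'\<close> corrected to fix \<open>x\<close> and with the inner product of
  \<open>tangent_form\<close>. The resulting direction is followed from \<open>x\<close> and
  projected back to the space.\<close>

lemma fixed_point_affine:
  assumes K: "K \<noteq> Spherical" and h: "linear h" "\<And>x. x \<in> X \<Longrightarrow> h x \<in> X"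
    and hq: "\<And>x y. x \<in> X \<Longrightarrow> y \<in> X \<Longrightarrow> qd K (h x) (h y) = qd K x y"
    and compact: "compact {x \<in> X. \<forall>n\<in>N. n \<bullet> x \<ge> 0}"
  shows "\<exists>ns v. set ns \<subseteq> N \<and> v \<in> C \<and> act J ns (h v) = v"
proof -
  interpret M: mirror_system J X "cone K" "nrm K" "qd K" N p
    by (rule mirror_system_X[OF K])
  obtain us x where us: "set us \<subseteq> N" and x: "x \<in> X" "\<And>n. n \<in> N \<Longrightarrow> n \<bullet> x \<ge> 0" "act J us (h x) = x"
    using fixed_point_closed_chamber[OF K h compact] by metis
  define h' where "h' = act J us \<circ> h"
  have h'x: "h' x = x" using x(3) by (simp add: h'_def)
  have lh': "linear h'" unfolding h'_def by (rule linear_compose[OF h(1) linear_act])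
  have h'X: "h' y \<in> X" if "y \<in> X" for y using word_X[OF us h(2)[OF that]] by (simp add: h'_def)
  have h'q: "qd K (h' y) (h' z) = qd K y z" if "y \<in> X" "z \<in> X" for y z
    using word_qd[OF us h(2) h(2)] hq that by (simp add: h'_def)
  define N' where "N' = {n \<in> N. n \<bullet> x = 0}"
  show ?thesis
  proof (cases "N' = {}")
    case True
    then have "x \<in> C" using x(1,2) by (force simp: C_def N'_def order_le_less)
    then show ?thesis using us x(3) by blast
  next
    case False
    have N'N: "N' \<subseteq> N" by (auto simp: N'_def)
    have fix_x: "act J ns x = x" if "set ns \<subseteq> N'" for ns
      using that by (intro act_fix) (auto simp: N'_def)
    obtain A :: "real \<times> 'a \<Rightarrow> real \<times> 'a" where A: "linear A" "inj A"
      "\<forall>n z. n \<bullet> x = 0 \<longrightarrow> A (J n) \<bullet> A z = n \<bullet> z"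
      "\<forall>y\<in>X. \<forall>y'\<in>X. qd K x y = qd K x y' \<longrightarrow> norm (A y) = norm (A y') \<and> A x \<bullet> A y = A x \<bullet> A y'"
      using tangent_form[OF K x(1)] by blast
    \<comment> \<open>\<open>tangent_form\<close> controls points of the space only. Writing
      \<open>z\<close> through \<open>x\<close> and such a point \<open>y\<close> reaches all
      vectors; the mixed terms are the products with \<open>A x\<close>, controlled as well.\<close>
    have h'A: "norm (A (h' z)) = norm (A z)" for z
    proof -
      obtain e t y where z: "e > 0" "t > 0" "y \<in> X" "z = (1 / e) *\<^sub>R (t *\<^sub>R y - x)"
        by (rule cone_decomposition[OF x(1), of z], rule that)
      have "qd K x (h' y) = qd K x y" using h'q[OF x(1) z(3)] h'x by simp
      with A(4) h'X[OF z(3)] z(3) have y: "norm (A (h' y)) = norm (A y)" "A x \<bullet> A (h' y) = A x \<bullet> A y" by blast+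
      have "h' z = (1 / e) *\<^sub>R (t *\<^sub>R h' y - x)"
        by (simp add: z(4) linear_scale[OF lh'] linear_diff[OF lh'] h'x)
      then have 1: "A (h' z) = (1 / e) *\<^sub>R (t *\<^sub>R A (h' y) - A x)"
        by (simp add: linear_scale[OF A(1)] linear_diff[OF A(1)])
      have 2: "A z = (1 / e) *\<^sub>R (t *\<^sub>R A y - A x)"
        by (simp add: z(4) linear_scale[OF A(1)] linear_diff[OF A(1)])
      have "A (h' y) \<bullet> A (h' y) = A y \<bullet> A y" using y(1) by (simp add: norm_eq)
      then have "(t *\<^sub>R A (h' y) - A x) \<bullet> (t *\<^sub>R A (h' y) - A x) = (t *\<^sub>R A y - A x) \<bullet> (t *\<^sub>R A y - A x)"
        using y(2) by (simp add: inner_diff_left inner_diff_right inner_commute)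
      then have "norm (t *\<^sub>R A (h' y) - A x) = norm (t *\<^sub>R A y - A x)" by (simp only: norm_eq)
      then show ?thesis unfolding 1 2 by simp
    qed
    have "\<exists>ns v. set ns \<subseteq> N' \<and> v \<in> UNIV \<and> (\<forall>n\<in>N'. n \<bullet> v > 0) \<and> act J ns (h' v) = v"
    proof (rule linear_fixed_vector[where A = A and p = p])
      show "linear J" by (rule linear_Jm)
      show "linear A" "inj A" by fact+
      fix n assume n: "n \<in> N'"
      then show "n \<bullet> J n = 1" "n \<bullet> p > 0" using N'N N_unit N_pos by blast+
      show "A (J n) \<bullet> A z = n \<bullet> z" for z using n A(3) unfolding N'_def by blast
      fix k assume k: "k \<in> N'"
      have "(n - (2 * (n \<bullet> J k)) *\<^sub>R k) \<bullet> x = 0" using n k by (simp add: N'_def inner_diff_left)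
      then show "n - (2 * (n \<bullet> J k)) *\<^sub>R k \<in> N' \<or> - (n - (2 * (n \<bullet> J k)) *\<^sub>R k) \<in> N'"
        using N_closed[of k n] n k unfolding N'_def by (simp add: inner_diff_left)
    next
      fix z
      obtain e t y where z: "e > 0" "t > 0" "y \<in> X" "z = (1 / e) *\<^sub>R (t *\<^sub>R y - x)"
        by (rule cone_decomposition[OF x(1), of z], rule that)
      \<comment> \<open>Words in mirrors through \<open>x\<close> preserve \<open>qd K x y\<close>,
        so the orbit of \<open>y\<close> stays bounded and is finite; the orbit of \<open>z\<close>
        is its image under an affine map.\<close>
      obtain b where b: "\<And>w. w \<in> X \<Longrightarrow> qd K x w \<le> qd K x y \<Longrightarrow> norm w \<le> b"
        using M.q_bdd[of "norm x" "qd K x y"] x(1) by blast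
      have "{act J ns z |ns. set ns \<subseteq> N'}
          \<subseteq> (\<lambda>w. (1 / e) *\<^sub>R (t *\<^sub>R w - x)) ` {act J ns y |ns. set ns \<subseteq> N \<and> norm (act J ns y) \<le> b}"
      proof
        fix w assume "w \<in> {act J ns z |ns. set ns \<subseteq> N'}"
        then obtain ns where ns: "set ns \<subseteq> N'" "w = act J ns z" by blast
        have nsN: "set ns \<subseteq> N" using ns(1) N'N by blast
        have "qd K x (act J ns y) = qd K x y"
          using word_qd[OF nsN x(1) z(3)] fix_x[OF ns(1)] by simp
        then have "norm (act J ns y) \<le> b" using word_X[OF nsN z(3)] by (intro b) auto
        moreover have "w = (1 / e) *\<^sub>R (t *\<^sub>R act J ns y - x)"
          by (simp add: ns(2) z(4) linear_scale[OF linear_act] linear_diff[OF linear_act] fix_x[OF ns(1)])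
        ultimately show "w \<in> (\<lambda>w. (1 / e) *\<^sub>R (t *\<^sub>R w - x)) ` {act J ns y |ns. set ns \<subseteq> N \<and> norm (act J ns y) \<le> b}"
          using nsN by blast
      qed
      then show "finite {act J ns z |ns. set ns \<subseteq> N'}"
        by (rule finite_subset) (intro finite_imageI orbit_finite z(3))
    next
      show "N' \<noteq> {}" "linear h'" by fact+
      show "norm (A (h' z)) = norm (A z)" for z by (rule h'A)
    qed auto
    then obtain ns v where v: "set ns \<subseteq> N'" "\<And>n. n \<in> N' \<Longrightarrow> n \<bullet> v > 0" "act J ns (h' v) = v" by blast
    let ?v = "\<lambda>k. x + (1 / real (Suc k)) *\<^sub>R v"
    let ?y = "\<lambda>k. (1 / nrm K (?v k)) *\<^sub>R ?v k"
    have xc: "x \<in> cone K" by (rule cc_space_cone[OF x(1)])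
    have lim: "?y \<longlonglongrightarrow> x" by (rule normalised_tendsto[OF open_cone xc nrm_continuous nrm_1[OF x(1)]])
    \<comment> \<open>Only the finitely many functionals in \<open>M\<close> can fail to be positive
      at points of the space with norm at most \<open>norm x + 1\<close>, so a small enough step has
      finitely many conditions to meet.\<close>
    define M where "M = {m \<in> N. \<exists>y\<in>X. norm y \<le> norm x + 1 \<and> m \<bullet> y \<le> 0}"
    have finM: "finite M" unfolding M_def by (rule M.finite_near)
    have "(\<lambda>k. 1 / real (Suc k)) \<longlonglongrightarrow> 0"
      using LIMSEQ_inverse_real_of_nat by (simp add: inverse_eq_divide)
    then have "?v \<longlonglongrightarrow> x + 0 *\<^sub>R v" by (intro tendsto_intros)
    then have "?v \<longlonglongrightarrow> x" by simp
    then have ev1: "eventually (\<lambda>k. ?v k \<in> cone K) sequentially"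
      using open_cone xc topological_tendstoD by blast
    have "(\<lambda>k. norm (?y k)) \<longlonglongrightarrow> norm x" using lim by (rule tendsto_norm)
    then have ev2: "eventually (\<lambda>k. norm (?y k) < norm x + 1) sequentially"
      by (rule order_tendstoD) simp
    have ev3: "eventually (\<lambda>k. \<forall>m\<in>M - N'. m \<bullet> ?y k > 0) sequentially"
    proof (rule eventually_ball_finite)
      show "finite (M - N')" using finM by simp
      show "\<forall>m\<in>M - N'. eventually (\<lambda>k. m \<bullet> ?y k > 0) sequentially"
      proof
        fix m assume m: "m \<in> M - N'"
        then have "m \<bullet> x > 0" using x(2)[of m] by (force simp: M_def N'_def)
        moreover have "(\<lambda>k. m \<bullet> ?y k) \<longlonglongrightarrow> m \<bullet> x" by (intro tendsto_inner tendsto_const lim)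
        ultimately show "eventually (\<lambda>k. m \<bullet> ?y k > 0) sequentially" using order_tendstoD(1) by blast
      qed
    qed
    have "eventually (\<lambda>k. ?v k \<in> cone K \<and> norm (?y k) < norm x + 1 \<and> (\<forall>m\<in>M - N'. m \<bullet> ?y k > 0)) sequentially"
      using ev1 ev2 ev3 by eventually_elim blast
    then obtain k where k: "?v k \<in> cone K" "norm (?y k) < norm x + 1" "\<forall>m\<in>M - N'. m \<bullet> ?y k > 0"
      using eventually_happens' trivial_limit_sequentially by blast
    define s where "s = 1 / nrm K (?v k)"
    define e where "e = 1 / real (Suc k)"
    have s: "s > 0" using nrm_pos[OF k(1)] by (simp add: s_def)
    have e: "e > 0" by (simp add: e_def)
    define y where "y = s *\<^sub>R (x + e *\<^sub>R v)"
    have yk: "y = ?y k" by (simp add: y_def s_def e_def)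
    have yX: "y \<in> X" unfolding yk by (rule nrm_cc_space[OF k(1)])
    have "m \<bullet> y > 0" if m: "m \<in> N" for m
    proof (cases "m \<in> N'")
      case True
      then show ?thesis using v(2)[OF True] s e by (simp add: y_def N'_def inner_add_right)
    next
      case False
      show ?thesis
      proof (cases "m \<in> M")
        case True
        then show ?thesis using False k(3) unfolding yk by blast
      next
        case nM: False
        then show ?thesis using m yX k(2) unfolding M_def yk by (force simp: not_le)
      qed
    qed
    then have "y \<in> C" using yX by (simp add: C_def)
    moreover have "act J (ns @ us) (h y) = y"
    proof -
      have "act J (ns @ us) (h y) = act J ns (h' y)" by (simp add: h'_def)
      also have "\<dots> = s *\<^sub>R (act J ns (h' x) + e *\<^sub>R act J ns (h' v))"
        by (simp only: y_def linear_scale[OF lh'] linear_add[OF lh'] linear_scale[OF linear_act] linear_add[OF linear_act])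
      also have "\<dots> = y" by (simp add: h'x fix_x[OF v(1)] v(3) y_def)
      finally show ?thesis .
    qed
    moreover have "set (ns @ us) \<subseteq> N" using v(1) N'N us by auto
    ultimately show ?thesis by blast
  qed
qed

end

theorem lemma2:
  fixes K :: geometry
    and W :: "(real \<times> 'a::euclidean_space \<Rightarrow> real \<times> 'a) set"
    and D :: "(real \<times> 'a) set"
    and g :: "real \<times> 'a \<Rightarrow> real \<times> 'a"
  assumes "discrete_reflection_group K W"
    and "K = Spherical \<Longrightarrow> W \<noteq> {\<one>\<^bsub>isom_group K\<^esub>}"
    and "D \<in> chambers K W"
    and "compact D"
    and "g \<in> carrier (isom_group K)"
  shows "\<exists>!w. w \<in> W \<and>
           (\<exists>x \<in> (top_of_set (cc_space K)) interior_of D.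
              (inv\<^bsub>isom_group K\<^esub> w \<otimes>\<^bsub>isom_group K\<^esub> g) x = x)"
proof -
  obtain Q where Q: "Q \<in> components (cc_space K - \<Union>(mirrors K W))" "D = top_of_set (cc_space K) closure_of Q"
    using assms(3) by (auto simp: chambers_def)
  obtain p where pQ: "p \<in> Q" using in_components_nonempty[OF Q(1)] by blast
  then have "p \<in> cc_space K" "p \<notin> \<Union>(mirrors K W)" using in_components_subset[OF Q(1)] by auto
  then interpret reflection_group K W p
    using assms(1,2) by unfold_locales auto
  interpret G: group "isom_group K :: (real \<times> 'a \<Rightarrow> real \<times> 'a) monoid" by (rule group_isom_group)
  have "Q = C" by (rule component_C[OF Q(1) pQ])
  then have int: "(top_of_set (cc_space K)) interior_of D = C"
    using Q(2) interior_closure_C by simp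
  have D: "D = {x \<in> X. \<forall>n\<in>N. n \<bullet> x \<ge> 0}" using Q(2) \<open>Q = C\<close> closure_C by simp
  have fixed_iff: "(inv\<^bsub>isom_group K\<^esub> w \<otimes>\<^bsub>isom_group K\<^esub> g) x = x \<longleftrightarrow> g x = w x"
    if w: "w \<in> W" and x: "x \<in> X" for w x
  proof -
    have wc: "w \<in> carrier (isom_group K)" by (rule W_carrier[OF w])
    have "(inv\<^bsub>isom_group K\<^esub> w \<otimes>\<^bsub>isom_group K\<^esub> g) x = (inv\<^bsub>isom_group K\<^esub> w) (g x)"
      by (rule isom_mult[OF G.inv_closed[OF wc] assms(5) x])
    moreover have "(inv\<^bsub>isom_group K\<^esub> w) (g x) = x \<longleftrightarrow> g x = w x"
      using isom_inv(2)[OF wc isom_mem[OF assms(5) x]] isom_inv(1)[OF wc x] by metis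
    ultimately show ?thesis by simp
  qed
  have CX: "x \<in> X" if "x \<in> C" for x using that by (simp add: C_def)
  show ?thesis
  proof (rule ex_ex1I)
    obtain h where h: "linear h" "\<And>x. x \<in> X \<Longrightarrow> h x = g x" by (rule isom_linear[OF assms(5)], rule that)
    have hX: "h x \<in> X" if "x \<in> X" for x using isom_mem[OF assms(5) that] h(2)[OF that] by simp
    have hq: "qd K (h x) (h y) = qd K x y" if "x \<in> X" "y \<in> X" for x y
      using isom_qd[OF assms(5) that] h(2) that by simp
    have "\<exists>ns v. set ns \<subseteq> N \<and> v \<in> C \<and> act J ns (h v) = v"
    proof (cases "K = Spherical")
      case True
      show ?thesis by (rule fixed_point_sphere[OF True h(1) hX])
    next
      case False
      show ?thesis by (rule fixed_point_affine[OF False h(1) hX hq]) (use assms(4) D in auto)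
    qed
    then obtain ns v where v: "set ns \<subseteq> N" "v \<in> C" "act J ns (h v) = v" by blast
    \<comment> \<open>The word carries \<open>g v\<close> back to \<open>v\<close>, so the element
      sought is its inverse.\<close>
    define w where "w = restrict (act J ns) X"
    have w: "w \<in> W" unfolding w_def by (rule word_W[OF v(1)])
    have iw: "inv\<^bsub>isom_group K\<^esub> w \<in> W" by (rule subgroup.m_inv_closed[OF W_subgroup w])
    have gX: "g v \<in> X" by (rule isom_mem[OF assms(5) CX[OF v(2)]])
    have "w (g v) = v" using v(3) h(2)[OF CX[OF v(2)]] gX by (simp add: w_def)
    then have "g v = (inv\<^bsub>isom_group K\<^esub> w) v" using isom_inv(1)[OF W_carrier[OF w] gX] by simp
    then show "\<exists>w. w \<in> W \<and> (\<exists>x \<in> (top_of_set (cc_space K)) interior_of D.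
        (inv\<^bsub>isom_group K\<^esub> w \<otimes>\<^bsub>isom_group K\<^esub> g) x = x)"
      unfolding int using fixed_iff[OF iw CX[OF v(2)]] iw v(2) by blast
  next
    fix w w'
    assume "w \<in> W \<and> (\<exists>x \<in> (top_of_set (cc_space K)) interior_of D. (inv\<^bsub>isom_group K\<^esub> w \<otimes>\<^bsub>isom_group K\<^esub> g) x = x)"
      and "w' \<in> W \<and> (\<exists>x \<in> (top_of_set (cc_space K)) interior_of D. (inv\<^bsub>isom_group K\<^esub> w' \<otimes>\<^bsub>isom_group K\<^esub> g) x = x)"
    then obtain x x' where w: "w \<in> W" "x \<in> C" "g x = w x" and w': "w' \<in> W" "x' \<in> C" "g x' = w' x'"
      unfolding int using fixed_iff CX by blast
    note c = W_carrier[OF w(1)] W_carrier[OF w'(1)]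
    have X: "x \<in> X" "x' \<in> X" using w(2) w'(2) CX by auto
    let ?u = "inv\<^bsub>isom_group K\<^esub> w \<otimes>\<^bsub>isom_group K\<^esub> w'"
    have uW: "?u \<in> W"
      by (rule subgroup.m_closed[OF W_subgroup subgroup.m_inv_closed[OF W_subgroup w(1)] w'(1)])
    obtain us where us: "set us \<subseteq> N" "\<And>z. z \<in> X \<Longrightarrow> ?u z = act J us z" by (rule W_word[OF uW], rule that)
    have uz: "w (?u z) = w' z" if z: "z \<in> X" for z
      using isom_mult[OF G.inv_closed[OF c(1)] c(2) z] isom_inv(2)[OF c(1) isom_mem[OF c(2) z]] by simp
    have "qd K x (?u x') = qd K (w x) (w (?u x'))"
      using isom_qd[OF c(1) X(1) isom_mem[OF W_carrier[OF uW] X(2)]] by simp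
    also have "\<dots> = qd K (g x) (g x')" using uz[OF X(2)] w(3) w'(3) by simp
    also have "\<dots> = qd K x x'" by (rule isom_qd[OF assms(5) X])
    finally have eq: "qd K x (act J us x') = qd K x x'" using us(2)[OF X(2)] by simp
    have "act J us z = z" for z
    proof (rule ccontr)
      assume "act J us z \<noteq> z"
      from qd_strict[OF w(2) w'(2) us(1) this] show False using eq by simp
    qed
    then have "w z = w' z" if "z \<in> X" for z using uz[OF that] us(2)[OF that] by simp
    then show "w = w'" by (rule isom_eqI[OF c])
  qed
qed

end
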